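(* Let $H$ be a Hilbert space and $E$ a linear operator in $H$. The following are equivalent. (i) $E$ generates a $C_0$-semigroup $\mathcal T$ which is similar to a semigroup of isometries (i.e. $(RT(t)R^{-1})_{t\ge0}$ consists of isometries for some invertible $R\in\mathcal L(H)$). (ii) $\sigma(E)\subseteq\{z\in\mathbb C:\operatorname{Re}z\le0\}$ and there exist $\alpha,\beta>0$ such that either $$\alpha\|h\|^2\le\limsup_{\varepsilon\to0^+}\varepsilon\int_{-\infty}^\infty\|(\varepsilon+i\xi-E)^{-1}h\|^2\,d\xi\le\beta\|h\|^2\quad\text{for all }h\in H,$$ or the same holds with $\liminf$ in place of $\limsup$.
   Context: $E$ is not assumed a priori to be densely defined; $\rho(E)$ is the set of $\lambda\in\mathbb C$ for which $(\lambda-E)^{-1}$ exists and is bounded on $H$, and $\sigma(E)=\mathbb C\setminus\rho(E)$. *)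

theory Defs
  imports "HOL-Analysis.Analysis"
begin

class complex_hilbert = banach +
  fixes scaleC :: "complex \<Rightarrow> 'a \<Rightarrow> 'a"
    and cinner :: "'a \<Rightarrow> 'a \<Rightarrow> complex"
  assumes scaleC_add_right: "scaleC a (x + y) = scaleC a x + scaleC a y"
    and scaleC_add_left: "scaleC (a + b) x = scaleC a x + scaleC b x"
    and scaleC_scaleC: "scaleC a (scaleC b x) = scaleC (a * b) x"
    and scaleC_one: "scaleC 1 x = x"
    and scaleR_scaleC: "scaleR r x = scaleC (complex_of_real r) x"
    and cinner_commute: "cinner x y = cnj (cinner y x)"
    and cinner_add_left: "cinner (x + y) z = cinner x z + cinner y z"
    and cinner_scaleC_left: "cinner (scaleC a x) y = cnj a * cinner x y"
    and cinner_self: "cinner x x = complex_of_real ((norm x)\<^sup>2)"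


instantiation complex :: complex_hilbert
begin
definition scaleC_complex :: "complex \<Rightarrow> complex \<Rightarrow> complex" where "scaleC_complex a x = a * x"
definition cinner_complex :: "complex \<Rightarrow> complex \<Rightarrow> complex" where "cinner_complex x y = cnj x * y"
instance
proof
  fix a b x y z :: complex and r :: real
  show "scaleC a (x + y) = scaleC a x + scaleC a y" by (simp add: scaleC_complex_def distrib_left)
  show "scaleC (a + b) x = scaleC a x + scaleC b x" by (simp add: scaleC_complex_def distrib_right)
  show "scaleC a (scaleC b x) = scaleC (a * b) x" by (simp add: scaleC_complex_def)
  show "scaleC 1 x = x" by (simp add: scaleC_complex_def)
  show "r *\<^sub>R x = scaleC (complex_of_real r) x" by (simp add: scaleC_complex_def scaleR_conv_of_real)
  show "cinner x y = cnj (cinner y x)" by (simp add: cinner_complex_def mult.commute)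
  show "cinner (x + y) z = cinner x z + cinner y z" by (simp add: cinner_complex_def distrib_right)
  show "cinner (scaleC a x) y = cnj a * cinner x y" by (simp add: cinner_complex_def scaleC_complex_def)
  show "cinner x x = complex_of_real ((norm x)\<^sup>2)" using complex_norm_square[of x] by (simp add: cinner_complex_def mult.commute)
qed
end

definition clinear :: "('a::complex_hilbert \<Rightarrow> 'b::complex_hilbert) \<Rightarrow> bool" where
  "clinear f \<longleftrightarrow> (\<forall>x y. f (x + y) = f x + f y) \<and> (\<forall>c x. f (scaleC c x) = scaleC c (f x))"

definition bounded_clinear :: "('a::complex_hilbert \<Rightarrow> 'b::complex_hilbert) \<Rightarrow> bool" where
  "bounded_clinear f \<longleftrightarrow> clinear f \<and> (\<exists>K. \<forall>x. norm (f x) \<le> norm x * K)"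

definition csubspace :: "'a::complex_hilbert set \<Rightarrow> bool" where
  "csubspace S \<longleftrightarrow> 0 \<in> S \<and> (\<forall>x\<in>S. \<forall>y\<in>S. x + y \<in> S) \<and> (\<forall>c. \<forall>x\<in>S. scaleC c x \<in> S)"

text \<open>A (possibly unbounded, not necessarily densely defined) linear operator in H is
given by its domain D and a function E (whose values outside D are irrelevant).\<close>
definition linear_operator :: "'a::complex_hilbert set \<Rightarrow> ('a \<Rightarrow> 'a) \<Rightarrow> bool" where
  "linear_operator D E \<longleftrightarrow> csubspace D \<and> (\<forall>x\<in>D. \<forall>y\<in>D. E (x + y) = E x + E y)
     \<and> (\<forall>c. \<forall>x\<in>D. E (scaleC c x) = scaleC c (E x))"

definition resolvent_set :: "'a::complex_hilbert set \<Rightarrow> ('a \<Rightarrow> 'a) \<Rightarrow> complex set" where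
  "resolvent_set D E = {z. \<exists>R. bounded_clinear R
      \<and> (\<forall>y. R y \<in> D \<and> scaleC z (R y) - E (R y) = y)
      \<and> (\<forall>x\<in>D. R (scaleC z x - E x) = x)}"

definition spectrum :: "'a::complex_hilbert set \<Rightarrow> ('a \<Rightarrow> 'a) \<Rightarrow> complex set" where
  "spectrum D E = - resolvent_set D E"

definition resolvent :: "'a::complex_hilbert set \<Rightarrow> ('a \<Rightarrow> 'a) \<Rightarrow> complex \<Rightarrow> 'a \<Rightarrow> 'a" where
  "resolvent D E z y = (THE x. x \<in> D \<and> scaleC z x - E x = y)"

definition C0_semigroup :: "(real \<Rightarrow> 'a::complex_hilbert \<Rightarrow> 'a) \<Rightarrow> bool" where
  "C0_semigroup T \<longleftrightarrow> (\<forall>t\<ge>0. bounded_clinear (T t)) \<and> T 0 = id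
     \<and> (\<forall>s\<ge>0. \<forall>t\<ge>0. T (s + t) = T s \<circ> T t)
     \<and> (\<forall>x. ((\<lambda>t. T t x) \<longlongrightarrow> x) (at_right 0))"

definition generator_domain :: "(real \<Rightarrow> 'a::complex_hilbert \<Rightarrow> 'a) \<Rightarrow> 'a set" where
  "generator_domain T = {x. \<exists>y. ((\<lambda>t. (1 / t) *\<^sub>R (T t x - x)) \<longlongrightarrow> y) (at_right 0)}"

definition generator :: "(real \<Rightarrow> 'a::complex_hilbert \<Rightarrow> 'a) \<Rightarrow> 'a \<Rightarrow> 'a" where
  "generator T x = Lim (at_right 0) (\<lambda>t. (1 / t) *\<^sub>R (T t x - x))"

definition generates :: "'a::complex_hilbert set \<Rightarrow> ('a \<Rightarrow> 'a) \<Rightarrow> (real \<Rightarrow> 'a \<Rightarrow> 'a) \<Rightarrow> bool" where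
  "generates D E T \<longleftrightarrow> C0_semigroup T \<and> D = generator_domain T \<and> (\<forall>x\<in>D. E x = generator T x)"

definition similar_to_isometries :: "(real \<Rightarrow> 'a::complex_hilbert \<Rightarrow> 'a) \<Rightarrow> bool" where
  "similar_to_isometries T \<longleftrightarrow> (\<exists>(R::'a \<Rightarrow> 'a) Rinv. bounded_clinear R \<and> bounded_clinear Rinv
     \<and> (\<forall>x. Rinv (R x) = x) \<and> (\<forall>x. R (Rinv x) = x)
     \<and> (\<forall>t\<ge>0. \<forall>x. norm (R (T t (Rinv x))) = norm x))"

end

theory Submission
  imports Defs "HOL-Probability.Probability"
begin

text \<open>
  From (ii) to (i): the Cayley transform \<open>C = (1 + E) (1 - E)\<inverse>\<close> satisfies
  \<open>R(z) y = (1 - z) / (1 + z) * R(z) (C y) + 2 / (1 + z) * R(1) y\<close>. Along the line \<open>Re z = \<epsilon>\<close> the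
  last term is square integrable and the modulus of the first factor tends to one, both uniformly, so both
  the upper and the lower limit of the quadratic means are exactly invariant under \<open>C\<close>. Hence all powers of \<open>C\<close> are
  bounded above and below, uniformly; a generalised limit of the averages of \<open>\<langle>C\<^sup>k x, C\<^sup>k y\<rangle>\<close>
  is an equivalent inner product \<open>\<langle>S x, S y\<rangle>\<close> for which \<open>C\<close> is isometric, that is, for which
  \<open>E\<close> is skew-symmetric. As \<open>r - E\<close> is onto for every \<open>r > 0\<close>, the domain is dense, and the
  backward Euler scheme converges to a semigroup that is isometric for the new norm.

  From (i) to (ii): for an isometric semigroup \<open>\<epsilon> * \<parallel>R(z) h\<parallel>\<^sup>2 = Re \<langle>h, R(z) h\<rangle>\<close> is the real part of the
  Laplace transform of \<open>\<langle>h, T(t) h\<rangle>\<close>, and, being nonnegative, it has total mass \<open>\<pi> * \<parallel>h\<parallel>\<^sup>2\<close> on each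
  line \<open>Re z = \<epsilon> > 0\<close>.
\<close>

section \<open>Complex Hilbert spaces\<close>

text \<open>No semigroup is available when the resolvent bounds are given, so there is no orbit to
  average. The Cayley transform is a bounded operator built from the resolvent at 1 alone, and its
  powers take the place of the missing orbit. The upper or lower limit of the means is in general no
  quadratic form in \<open>h\<close>, so it cannot itself serve as the new squared norm. It is used
  only for its invariance and for being comparable with the squared norm; the quadratic form is
  produced afterwards by averaging. The invariance has to be exact: a factor 1 + \<delta> lost at
  each step would grow to its k-th power and destroy the uniform bounds. Both limits enter through
  monotonicity and compatibility with affine maps alone, so one argument serves both alternatives.
  Nothing forces \<open>C\<close> to be onto, so isometries rather than unitary operators
  result.\<close>

definition rinner :: "'a::complex_hilbert \<Rightarrow> 'a \<Rightarrow> real" where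
  "rinner x y = Re (cinner x y)"

lemma cinner_add_right: "cinner x (y + z) = cinner x y + cinner x (z::'a::complex_hilbert)"
  by (metis cinner_add_left cinner_commute complex_cnj_add)

lemma cinner_scaleC_right: "cinner x (scaleC a y) = a * cinner x (y::'a::complex_hilbert)"
  by (metis cinner_commute cinner_scaleC_left complex_cnj_cnj complex_cnj_mult)

lemma norm_scaleC [simp]: "norm (scaleC a (x::'a::complex_hilbert)) = cmod a * norm x"
proof -
  have "complex_of_real ((norm (scaleC a x))\<^sup>2) = cnj a * (a * complex_of_real ((norm x)\<^sup>2))"
    by (simp only: cinner_self [symmetric] cinner_scaleC_left cinner_scaleC_right mult.left_commute)
  also have "\<dots> = complex_of_real ((cmod a * norm x)\<^sup>2)"
    unfolding mult.assoc [symmetric] mult.commute [of "cnj a" a] complex_norm_square [symmetric]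
      power_mult_distrib of_real_mult by simp
  finally have "(norm (scaleC a x))\<^sup>2 = (cmod a * norm x)\<^sup>2"
    by (simp only: of_real_eq_iff)
  then show ?thesis by (simp add: power2_eq_iff_nonneg)
qed

interpretation scaleC: bounded_bilinear "scaleC :: complex \<Rightarrow> 'a::complex_hilbert \<Rightarrow> 'a"
proof
  fix r :: real and a b :: complex and x y :: 'a
  show "scaleC (r *\<^sub>R a) x = r *\<^sub>R scaleC a x"
    unfolding scaleR_scaleC [of r "scaleC a x"] scaleC_scaleC scaleR_conv_of_real ..
  show "scaleC a (r *\<^sub>R x) = r *\<^sub>R scaleC a x"
    unfolding scaleR_scaleC scaleC_scaleC by (simp only: mult.commute)
  show "\<exists>K. \<forall>a x. norm (scaleC a (x::'a)) \<le> norm a * norm x * K"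
    by (rule exI [of _ 1]) simp
qed (simp_all add: scaleC_add_left scaleC_add_right)

lemma rinner_commute: "rinner x y = rinner y (x::'a::complex_hilbert)"
  unfolding rinner_def by (subst cinner_commute) simp

lemma rinner_add_left: "rinner (x + y) z = rinner x z + rinner y (z::'a::complex_hilbert)"
  by (simp add: rinner_def cinner_add_left)

lemma rinner_add_right: "rinner x (y + z) = rinner x y + rinner x (z::'a::complex_hilbert)"
  by (simp add: rinner_def cinner_add_right)

lemma rinner_scaleR_left: "rinner (r *\<^sub>R x) y = r * rinner x (y::'a::complex_hilbert)"
  by (simp add: rinner_def cinner_scaleC_left scaleR_scaleC)

lemma rinner_scaleC_left: "rinner (scaleC c x) y = rinner x (scaleC (cnj c) (y::'a::complex_hilbert))"
  by (simp add: rinner_def cinner_scaleC_left cinner_scaleC_right)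

lemma rinner_self: "rinner x x = (norm (x::'a::complex_hilbert))\<^sup>2"
  by (simp add: rinner_def cinner_self)

lemma norm_add_sq: "(norm (x + y))\<^sup>2 = (norm x)\<^sup>2 + 2 * rinner x y + (norm (y::'a::complex_hilbert))\<^sup>2"
  using rinner_commute [of x y]
  by (simp add: rinner_self [symmetric] rinner_add_left rinner_add_right)

lemma Cauchy_Schwarz_rinner: "\<bar>rinner x (y::'a::complex_hilbert)\<bar> \<le> norm x * norm y"
proof (cases "y = 0")
  case True
  then show ?thesis using rinner_scaleR_left [of 0 0 x] by (simp add: rinner_commute [of x])
next
  case False
  \<comment> \<open>The minimiser of \<open>norm (x + t *\<^sub>R y)\<close> over real
    \<open>t\<close>; there, nonnegativity of the square is the claim.\<close>
  define t where "t = - rinner x y / (norm y)\<^sup>2"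
  have ny: "norm y > 0" using False by simp
  have "0 \<le> (norm (x + t *\<^sub>R y))\<^sup>2" by simp
  also have "\<dots> = (norm x)\<^sup>2 + 2 * (t * rinner x y) + t\<^sup>2 * (norm y)\<^sup>2"
    by (simp add: norm_add_sq rinner_commute [of x] rinner_scaleR_left power_mult_distrib)
  also have "\<dots> = (norm x)\<^sup>2 - (rinner x y)\<^sup>2 / (norm y)\<^sup>2"
    using ny by (simp add: t_def field_simps power2_eq_square)
  finally have "(rinner x y)\<^sup>2 \<le> (norm x * norm y)\<^sup>2"
    using ny by (simp add: field_simps power_mult_distrib)
  then show ?thesis 
    using abs_le_square_iff [of "rinner x y" "norm x * norm y"] by simp
qed

interpretation rinner: bounded_bilinear "rinner :: 'a::complex_hilbert \<Rightarrow> 'a \<Rightarrow> real"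
proof
  fix r :: real and a b c :: 'a
  show "rinner a (b + c) = rinner a b + rinner a c"
    by (rule rinner_add_right)
  show "rinner a (r *\<^sub>R b) = r *\<^sub>R rinner a b"
    by (metis rinner_scaleR_left rinner_commute real_scaleR_def)
  show "\<exists>K. \<forall>a b. norm (rinner a (b::'a)) \<le> norm a * norm b * K"
    by (rule exI [of _ 1]) (simp add: Cauchy_Schwarz_rinner)
qed (simp_all add: rinner_add_left rinner_scaleR_left)

lemma norm_diff_sq: "(norm (x - y))\<^sup>2 = (norm x)\<^sup>2 - 2 * rinner x y + (norm (y::'a::complex_hilbert))\<^sup>2"
  using norm_add_sq [of x "- y"] by (simp add: rinner.minus_right)

text \<open>Complex linearity is split into real bounded linearity and commutation with
  \<open>scaleC\<close>. Analysis can then be done over the reals with \<open>rinner\<close>, while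
  the second condition is carried along as an algebraic identity that survives limits.\<close>

lemma bounded_clinear_iff:
  "bounded_clinear f \<longleftrightarrow> bounded_linear f \<and> (\<forall>c x. f (scaleC c x) = scaleC c (f x))"
proof
  assume f: "bounded_clinear f"
  then obtain K where "\<And>x. norm (f x) \<le> norm x * K" unfolding bounded_clinear_def by auto
  with f show "bounded_linear f \<and> (\<forall>c x. f (scaleC c x) = scaleC c (f x))"
    unfolding bounded_clinear_def clinear_def
    by (auto intro!: bounded_linear_intro simp: scaleR_scaleC)
next
  assume f: "bounded_linear f \<and> (\<forall>c x. f (scaleC c x) = scaleC c (f x))"
  then interpret bounded_linear f by simp
  show "bounded_clinear f"
    unfolding bounded_clinear_def clinear_def using f add bounded by blast
qed

lemma bounded_clinear_compose:
  assumes "bounded_clinear f" "bounded_clinear g"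
  shows "bounded_clinear (\<lambda>x. f (g x))"
  using assms by (auto simp: bounded_clinear_iff intro: bounded_linear_compose)

section \<open>Orthogonal projections, Riesz representation and density\<close>

lemma orthogonal_projection:
  fixes V :: "'a::complex_hilbert set"
  assumes V: "subspace V" "closed V"
  obtains v where "v \<in> V" "\<And>w. w \<in> V \<Longrightarrow> rinner (x - v) w = 0"
proof -
  define q where "q w = (norm (x - w))\<^sup>2" for w
  define m where "m = Inf (q ` V)"
  have ne: "V \<noteq> {}" using subspace_0 [OF V(1)] by blast
  have bdd: "bdd_below (q ` V)" by (rule bdd_belowI [of _ 0]) (auto simp: q_def)
  have m_le: "m \<le> q w" if "w \<in> V" for w
    unfolding m_def by (rule cInf_lower) (use that bdd in auto)
  have "\<exists>w\<in>V. q w < m + inverse (real (Suc n))" for n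
    using cInf_lessD [of "q ` V" "m + inverse (real (Suc n))"] ne by (auto simp: m_def)
  then obtain u where u: "\<And>n. u n \<in> V" "\<And>n. q (u n) < m + inverse (real (Suc n))" by metis
  \<comment> \<open>The parallelogram law, with the midpoint of \<open>a\<close> and
    \<open>b\<close> as competitor for the infimum \<open>m\<close>: nearly minimising points are
    close to each other.\<close>
  have par: "(norm (a - b))\<^sup>2 \<le> 2 * q a + 2 * q b - 4 * m" if "a \<in> V" "b \<in> V" for a b
  proof -
    have "(1/2) *\<^sub>R (a + b) \<in> V" using V(1) that by (simp add: subspace_add subspace_scale)
    from m_le [OF this] have "4 * m \<le> (2 * norm (x - (1/2) *\<^sub>R (a + b)))\<^sup>2"
      by (simp add: q_def power_mult_distrib)
    also have "2 * norm (x - (1/2) *\<^sub>R (a + b)) = norm (2 *\<^sub>R (x - (1/2) *\<^sub>R (a + b)))" by simp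
    also have "2 *\<^sub>R (x - (1/2) *\<^sub>R (a + b)) = (x - a) + (x - b)"
      by (simp add: scaleR_diff_right algebra_simps scaleR_2)
    finally have *: "4 * m \<le> (norm ((x - a) + (x - b)))\<^sup>2" .
    have "(norm (a - b))\<^sup>2 = (norm ((x - a) - (x - b)))\<^sup>2"
      by (simp add: norm_minus_commute)
    with * show ?thesis
      unfolding norm_add_sq [of "x - a" "x - b"] norm_diff_sq [of "x - a" "x - b"] q_def by linarith
  qed
  have "Cauchy u"
  proof (rule metric_CauchyI)
    fix e :: real assume e: "e > 0"
    obtain N where N: "inverse (real (Suc N)) < e\<^sup>2 / 4"
      using reals_Archimedean [of "e\<^sup>2 / 4"] e by auto
    have "dist (u i) (u j) < e" if "i \<ge> N" "j \<ge> N" for i j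
    proof -
      have "inverse (real (Suc i)) \<le> inverse (real (Suc N))" 
           "inverse (real (Suc j)) \<le> inverse (real (Suc N))" using that by (auto simp: field_simps)
      then have "(norm (u i - u j))\<^sup>2 < e\<^sup>2"
        using par [OF u(1)[of i] u(1)[of j]] u(2)[of i] u(2)[of j] N by linarith
      then show ?thesis using e by (simp add: dist_norm power2_less_imp_less)
    qed
    then show "\<exists>M. \<forall>m\<ge>M. \<forall>n\<ge>M. dist (u m) (u n) < e" by blast
  qed
  then obtain v where v: "u \<longlonglongrightarrow> v" using Cauchy_convergent_iff convergent_def by blast
  have vV: "v \<in> V" using closed_sequentially [OF V(2) _ v] u(1) by blast
  have "(\<lambda>n. q (u n)) \<longlonglongrightarrow> q v" unfolding q_def by (intro tendsto_intros v)
  moreover have "(\<lambda>n. m + inverse (real (Suc n))) \<longlonglongrightarrow> m + 0"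
    by (intro tendsto_intros LIMSEQ_inverse_real_of_nat)
  ultimately have "q v \<le> m + 0"
    by (rule LIMSEQ_le) (use u(2) less_imp_le in blast)
  then have qv: "q v \<le> q w" if "w \<in> V" for w using m_le [OF that] by simp
  have "rinner (x - v) w = 0" if w: "w \<in> V" for w
  proof (cases "w = 0")
    case True
    then show ?thesis by (simp add: rinner.zero_right)
  next
    case False
    \<comment> \<open>The step that minimises the distance along \<open>w\<close>; it can bring no
      gain over \<open>v\<close>, so the inner product vanishes.\<close>
    define t where "t = rinner (x - v) w / (norm w)\<^sup>2"
    have "q v \<le> q (v + t *\<^sub>R w)"
      by (rule qv) (use V(1) w vV in \<open>simp add: subspace_add subspace_scale\<close>)
    also have "q (v + t *\<^sub>R w) = (norm ((x - v) - t *\<^sub>R w))\<^sup>2" by (simp add: q_def algebra_simps)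
    also have "\<dots> = q v - 2 * (t * rinner (x - v) w) + t\<^sup>2 * (norm w)\<^sup>2"
      by (simp add: norm_diff_sq rinner.scaleR_right power_mult_distrib q_def)
    also have "\<dots> = q v - (rinner (x - v) w)\<^sup>2 / (norm w)\<^sup>2"
      using False by (simp add: t_def field_simps power2_eq_square)
    finally show ?thesis using False by (simp add: divide_le_0_iff)
  qed
  with vV that show thesis by blast
qed

text \<open>Unless \<open>f\<close> vanishes, the part of \<open>x0\<close> orthogonal to the kernel
  spans the complement of the kernel. So \<open>f\<close> is a multiple of the inner product with
  that vector, and evaluation at the vector itself fixes the factor.\<close>

lemma Riesz_representation:
  fixes f :: "'a::complex_hilbert \<Rightarrow> real"
  assumes "bounded_linear f"
  obtains a where "\<And>x. f x = rinner a x"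
proof (cases "\<forall>x. f x = 0")
  case True
  then show ?thesis using that [of 0] by (simp add: rinner.zero_left)
next
  case False
  interpret bounded_linear f by fact
  obtain x0 where x0: "f x0 \<noteq> 0" using False by blast
  define V where "V = {x. f x = 0}"
  have "subspace V" unfolding V_def subspace_def by (simp add: zero add scaleR)
  moreover have "closed V" unfolding V_def
    by (intro closed_Collect_eq continuous_on continuous_on_const continuous_on_id)
  ultimately obtain v where v: "v \<in> V" "\<And>w. w \<in> V \<Longrightarrow> rinner (x0 - v) w = 0"
    using orthogonal_projection [of V x0] by blast
  define u where "u = x0 - v"
  have fu: "f u \<noteq> 0" using v(1) x0 by (simp add: u_def V_def diff)
  then have nu: "u \<noteq> 0" using zero by auto
  have "f x = rinner ((f u / (norm u)\<^sup>2) *\<^sub>R u) x" for x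
  proof -
    have "x - (f x / f u) *\<^sub>R u \<in> V" using fu by (simp add: V_def diff scaleR)
    then have "rinner u (x - (f x / f u) *\<^sub>R u) = 0" using v(2) u_def by blast
    then have "rinner u x = f x / f u * (norm u)\<^sup>2"
      by (simp add: rinner.diff_right rinner.scaleR_right rinner_self)
    then show ?thesis using fu nu by (simp add: rinner.scaleR_left)
  qed
  then show ?thesis using that by blast
qed

lemma rinner_eqI: "(\<And>y. rinner x y = rinner x' (y::'a::complex_hilbert)) \<Longrightarrow> x = x'"
  using rinner_self [of "x - x'"] by (simp add: rinner.diff_left)

lemma subspace_closure:
  fixes V :: "'a::real_normed_vector set"
  assumes "subspace V"
  shows "subspace (closure V)"
  unfolding subspace_def
proof (intro conjI ballI allI)
  show "0 \<in> closure V" using assms closure_subset subspace_0 by blast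
next
  fix x y assume "x \<in> closure V" "y \<in> closure V"
  then obtain a b where "\<And>n. a n \<in> V" "a \<longlonglongrightarrow> x" "\<And>n. b n \<in> V" "b \<longlonglongrightarrow> y"
    unfolding closure_sequential by blast
  then show "x + y \<in> closure V"
    unfolding closure_sequential using assms
    by (intro exI [of _ "\<lambda>n. a n + b n"]) (auto intro: tendsto_add subspace_add)
next
  fix c :: real and x assume "x \<in> closure V"
  then obtain a where "\<And>n. a n \<in> V" "a \<longlonglongrightarrow> x"
    unfolding closure_sequential by blast
  then show "c *\<^sub>R x \<in> closure V"
    unfolding closure_sequential using assms
    by (intro exI [of _ "\<lambda>n. c *\<^sub>R a n"]) (auto intro: tendsto_scaleR subspace_scale)
qed

lemma dense_if_orthogonal_trivial:
  fixes V :: "'a::complex_hilbert set"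
  assumes V: "subspace V" and triv: "\<And>h. (\<And>w. w \<in> V \<Longrightarrow> rinner h w = 0) \<Longrightarrow> h = 0"
  shows "closure V = UNIV"
proof -
  have "x \<in> closure V" for x
  proof -
    obtain v where v: "v \<in> closure V" "\<And>w. w \<in> closure V \<Longrightarrow> rinner (x - v) w = 0"
      using orthogonal_projection [of "closure V" x] V by (auto intro: subspace_closure)
    have "x - v = 0" by (rule triv) (use v(2) closure_subset in blast)
    then show ?thesis using v(1) by simp
  qed
  then show ?thesis by blast
qed

section \<open>Similarity to isometries for a power-bounded operator\<close>

text \<open>Tychonoff's theorem in the role of a Banach limit: the values lie in a compact product
  of intervals, hence have a cluster point, and a finer filter converges to it in all coordinates at
  once. A limit along one fixed proper filter is automatically additive, homogeneous and
  monotone.\<close>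

lemma pointwise_cluster_filter:
  fixes f :: "'n \<Rightarrow> 'i \<Rightarrow> real"
  assumes f: "\<And>n i. \<bar>f n i\<bar> \<le> K i" and F: "F \<noteq> bot"
  obtains G g where "G \<noteq> bot" "G \<le> F" "\<And>i. ((\<lambda>n. f n i) \<longlongrightarrow> g i) G"
proof -
  define U where "U = PiE UNIV (\<lambda>i. {- K i..K i})"
  have "compactin (product_topology (\<lambda>i. euclidean) UNIV) U"
    unfolding U_def by (subst compactin_PiE) (auto simp: compactin_euclidean_iff)
  then have "compact U" by (simp add: euclidean_product_topology)
  moreover have "eventually (\<lambda>y. y \<in> U) (filtermap f F)"
    unfolding eventually_filtermap using f by (intro always_eventually) (auto simp: U_def abs_le_iff minus_le_iff)
  moreover have "filtermap f F \<noteq> bot" using F by (simp add: filtermap_bot_iff)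
  ultimately obtain g where g: "inf (nhds g) (filtermap f F) \<noteq> bot"
    unfolding compact_filter by blast
  \<comment> \<open>Neighbourhoods of the cluster point are pulled back to the indices; that
    \<open>g\<close> is a cluster point is what makes this filter proper.\<close>
  define G where "G = inf (filtercomap f (nhds g)) F"
  have "G \<noteq> bot"
  proof
    assume "G = bot"
    then obtain P Q where P: "eventually P (filtercomap f (nhds g))" and Q: "eventually Q F"
      and PQ: "\<And>n. \<not> (P n \<and> Q n)"
      unfolding G_def trivial_limit_def eventually_inf by auto
    obtain P' where P': "eventually P' (nhds g)" "\<And>n. P' (f n) \<Longrightarrow> P n"
      using P unfolding eventually_filtercomap by blast
    have "eventually (\<lambda>y. \<not> P' y) (filtermap f F)"
      unfolding eventually_filtermap using Q by eventually_elim (use P'(2) PQ in blast)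
    then have "eventually (\<lambda>y. False) (inf (nhds g) (filtermap f F))"
      unfolding eventually_inf using P'(1) by blast
    with g show False by (simp add: trivial_limit_def)
  qed
  moreover have "G \<le> F" by (simp add: G_def)
  moreover have "((\<lambda>n. f n i) \<longlongrightarrow> g i) G" for i
  proof -
    have lim: "filterlim f (nhds g) G"
      unfolding G_def by (rule filterlim_mono [OF filterlim_filtercomap]) auto
    have "continuous_on UNIV (\<lambda>y. y i :: real)" by simp
    from continuous_on_tendsto_compose [OF this lim] show ?thesis by simp
  qed
  ultimately show thesis using that by blast
qed

section \<open>Bounded forms, inverses and square roots\<close>

lemma bounded_form_operator:
  fixes b :: "'a::complex_hilbert \<Rightarrow> 'a \<Rightarrow> real"
  assumes "bounded_bilinear b"
  obtains A where "bounded_linear A" "\<And>x y. b x y = rinner (A x) y"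
proof -
  interpret bounded_bilinear b by fact
  have "\<exists>a. \<forall>y. b x y = rinner a y" for x
    using Riesz_representation [OF bounded_linear_right [of x]] by metis
  then obtain A where A: "\<And>x y. b x y = rinner (A x) y" by metis
  obtain K where K: "0 \<le> K" "\<And>x y. norm (b x y) \<le> norm x * norm y * K"
    using nonneg_bounded by blast
  have "bounded_linear A"
  proof (rule bounded_linear_intro)
    show "A (x + y) = A x + A y" for x y
      by (rule rinner_eqI) (simp add: rinner_add_left A [symmetric] add_left)
    show "A (r *\<^sub>R x) = r *\<^sub>R A x" for r x
      by (rule rinner_eqI) (simp add: rinner_scaleR_left A [symmetric] scaleR_left)
    show "norm (A x) \<le> norm x * K" for x
    proof (cases "A x = 0")
      case False
      have "(norm (A x))\<^sup>2 \<le> norm (A x) * (norm x * K)"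
        using K(2) [of x "A x"] by (simp add: A rinner_self ac_simps)
      with False show ?thesis by (simp add: power2_eq_square)
    qed (use K in simp)
  qed
  with A that show thesis by blast
qed

lemma bounded_clinear_inverse:
  fixes R :: "'a::complex_hilbert \<Rightarrow> 'a"
  assumes R: "bounded_clinear R" and surj: "\<And>y. \<exists>x. R x = y"
    and c: "c > 0" and lower: "\<And>x. c * norm x \<le> norm (R x)"
  obtains Rinv where "bounded_clinear Rinv" "\<And>x. Rinv (R x) = x" "\<And>x. R (Rinv x) = x"
proof -
  interpret R: bounded_linear R using R by (simp add: bounded_clinear_iff)
  have inj: "x = y" if "R x = R y" for x y
    using lower [of "x - y"] that c by (simp add: R.diff mult_le_0_iff)
  obtain Q where Q: "\<And>y. R (Q y) = y" using surj by metis
  have "bounded_linear Q"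
  proof (rule bounded_linear_intro)
    show "Q (x + y) = Q x + Q y" for x y by (rule inj) (simp add: Q R.add)
    show "Q (r *\<^sub>R x) = r *\<^sub>R Q x" for r x by (rule inj) (simp add: Q R.scaleR)
    show "norm (Q x) \<le> norm x * inverse c" for x
      using lower [of "Q x"] c by (simp add: Q field_simps)
  qed
  moreover have "Q (scaleC a x) = scaleC a (Q x)" for a x
    by (rule inj) (use R in \<open>simp add: Q bounded_clinear_iff\<close>)
  ultimately have "bounded_clinear Q" by (simp add: bounded_clinear_iff)
  moreover have "Q (R x) = x" for x by (rule inj) (rule Q)
  ultimately show thesis using that Q by blast
qed

lemma one_minus_contraction_surj:
  fixes Y :: "'a::banach \<Rightarrow> 'a"
  assumes Y: "bounded_linear Y" and r: "0 \<le> r" "r < 1" and le: "\<And>x. norm (Y x) \<le> r * norm x"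
  shows "\<exists>x. x - Y x = y"
proof -
  interpret bounded_linear Y by fact
  have "\<exists>!x\<in>UNIV. y + Y x = x"
    by (rule Banach_fix [where c = r]) (use r le in \<open>auto simp: complete_UNIV dist_norm diff [symmetric]\<close>)
  then show ?thesis by (metis add_diff_cancel_right')
qed

text \<open>For a suitable \<open>t\<close>, \<open>t *\<^sub>R A\<close> is 1 - G with a strict
  contraction \<open>G\<close>. A solution of 2 Y = G + Y^2 satisfies (1 - Y)^2 = 1 - G, so 1 - Y is
  a square root of \<open>t *\<^sub>R A\<close>; it is obtained as a fixed point, without functional
  calculus. Self-adjointness of the root turns its squared norm into the form of
  \<open>A\<close>.\<close>

lemma coercive_sqrt:
  fixes A :: "'a::complex_hilbert \<Rightarrow> 'a"
  assumes A: "bounded_clinear A" and sym: "\<And>x y. rinner (A x) y = rinner x (A y)"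
    and c: "c > 0" and coercive: "\<And>x. c * (norm x)\<^sup>2 \<le> rinner (A x) x"
  obtains S Sinv :: "'a \<Rightarrow> 'a" where "bounded_clinear S" "bounded_clinear Sinv"
    "\<And>x. Sinv (S x) = x" "\<And>x. S (Sinv x) = x" "\<And>x. (norm (S x))\<^sup>2 = rinner (A x) x"
proof -
  interpret A: bounded_linear A using A by (simp add: bounded_clinear_iff)
  obtain K0 where K0: "\<And>x. norm (A x) \<le> norm x * K0" using A.bounded by blast
  \<comment> \<open>The maximum with \<open>2 * c\<close> forces \<open>c < K\<close>, so that the
    contraction factor \<open>q\<close> below is strictly positive.\<close>
  define K where "K = max K0 (2 * c)"
  have K: "norm (A x) \<le> K * norm x" for x
    by (rule order_trans [OF K0]) (simp add: K_def mult.commute [of _ "norm x"] mult_left_mono)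
  have Kc: "c < K" "K > 0" using c by (auto simp: K_def)
  \<comment> \<open>The minimiser of 1 - 2 t c + t^2 K^2, which bounds the squared norm of 1 - t A;
    the minimum is \<open>q\<^sup>2\<close>.\<close>
  define t where "t = c / K\<^sup>2"
  have t: "t > 0" using c Kc by (simp add: t_def)
  define q where "q = sqrt (1 - c\<^sup>2 / K\<^sup>2)"
  have "c\<^sup>2 < K\<^sup>2" using c Kc by (simp add: power_strict_mono)
  then have pos: "0 < 1 - c\<^sup>2 / K\<^sup>2" using Kc by (simp add: field_simps)
  then have q: "0 < q" "q < 1" using c Kc by (auto simp: q_def real_sqrt_lt_1_iff)
  \<comment> \<open>The smaller root of r^2 - 2 r + q = 0. With this radius the ball is mapped into
    itself by \<open>\<Phi>\<close>, and \<open>r\<close> is also a Lipschitz constant of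
    \<open>\<Phi>\<close> on it.\<close>
  define r where "r = 1 - sqrt (1 - q)"
  have r: "0 < r" "r < 1" using q by (auto simp: r_def)
  have qr: "(q + r\<^sup>2) / 2 = r" using q by (simp add: r_def power2_diff)
  define G where "G = Blinfun (\<lambda>x. x - t *\<^sub>R A x)"
  have G: "blinfun_apply G x = x - t *\<^sub>R A x" for x
    unfolding G_def
    by (subst bounded_linear_Blinfun_apply)
       (auto intro!: bounded_linear_sub bounded_linear_ident bounded_linear_const_scaleR A.bounded_linear_axioms)
  have normG: "norm G \<le> q"
  proof (rule norm_blinfun_bound)
    fix x
    have "(norm (blinfun_apply G x))\<^sup>2 = (norm x)\<^sup>2 - 2 * (t * rinner (A x) x) + t\<^sup>2 * (norm (A x))\<^sup>2"
      by (simp add: G norm_diff_sq rinner.scaleR_right rinner_commute [of x] power_mult_distrib)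
    also have "\<dots> \<le> (norm x)\<^sup>2 - 2 * (t * (c * (norm x)\<^sup>2)) + t\<^sup>2 * (K * norm x)\<^sup>2"
      using K [of x] coercive [of x] t by (intro add_mono diff_mono mult_left_mono power_mono) auto
    also have "\<dots> = (1 - c\<^sup>2 / K\<^sup>2) * (norm x)\<^sup>2"
      using Kc by (simp add: t_def field_simps power2_eq_square)
    also have "\<dots> = (q * norm x)\<^sup>2" using pos by (simp add: q_def power_mult_distrib)
    finally show "norm (blinfun_apply G x) \<le> q * norm x"
      by (rule power2_le_imp_le) (use q in simp)
  qed (use q in simp)
  \<comment> \<open>Self-adjointness and complex linearity are closed conditions respected by
    \<open>\<Phi>\<close>; built into the complete set, they hold for the fixed point.\<close>
  define \<Y> :: "('a \<Rightarrow>\<^sub>L 'a) set" where "\<Y> = {Y. norm Y \<le> r \<and>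
    (\<forall>x y. rinner (blinfun_apply Y x) y = rinner x (blinfun_apply Y y)) \<and>
    (\<forall>a x. blinfun_apply Y (scaleC a x) = scaleC a (blinfun_apply Y x))}"
  define \<Phi> where "\<Phi> Y = (1/2::real) *\<^sub>R (G + (Y o\<^sub>L Y))" for Y
  have cont: "continuous_on UNIV (\<lambda>Y. blinfun_apply Y (x::'a))" for x
    by (intro continuous_intros)
  have "closed \<Y>"
    unfolding \<Y>_def
    by (intro closed_Collect_conj closed_Collect_all closed_Collect_le closed_Collect_eq
        continuous_on_norm continuous_on_id continuous_on_const rinner.continuous_on scaleC.continuous_on cont)
  note complete_eq_closed [THEN iffD2, OF this]
  moreover have "0 \<in> \<Y>" using r by (simp add: \<Y>_def rinner.zero_left rinner.zero_right scaleC.zero_right)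
  moreover have "\<Phi> ` \<Y> \<subseteq> \<Y>"
  proof clarify
    fix Y assume Y: "Y \<in> \<Y>"
    have "norm (\<Phi> Y) \<le> (norm G + norm (Y o\<^sub>L Y)) / 2"
      using norm_triangle_ineq [of G "Y o\<^sub>L Y"] by (simp add: \<Phi>_def)
    also have "\<dots> \<le> (q + r\<^sup>2) / 2"
    proof -
      have "norm (Y o\<^sub>L Y) \<le> norm Y * norm Y" by (rule norm_blinfun_compose)
      also have "\<dots> \<le> r * r" using Y r by (intro mult_mono) (auto simp: \<Y>_def)
      finally show ?thesis using normG by (simp add: power2_eq_square)
    qed
    finally have "norm (\<Phi> Y) \<le> r" by (simp only: qr)
    then show "\<Phi> Y \<in> \<Y>" using Y A sym
      by (auto simp: \<Y>_def \<Phi>_def G blinfun.add_left blinfun.scaleR_left rinner.scaleR_left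
          rinner.scaleR_right rinner.add_left rinner.add_right rinner.diff_left rinner.diff_right
          scaleC.add_right scaleC.diff_right scaleC.scaleR_right bounded_clinear_iff)
  qed
  moreover have "dist (\<Phi> Y) (\<Phi> Z) \<le> r * dist Y Z" if Y: "Y \<in> \<Y>" and Z: "Z \<in> \<Y>" for Y Z
  proof -
    \<comment> \<open>A factorisation of Y^2 - Z^2 that does not ask \<open>Y\<close> and
      \<open>Z\<close> to commute.\<close>
    have "\<Phi> Y - \<Phi> Z = (1/2::real) *\<^sub>R ((Y o\<^sub>L (Y - Z)) + ((Y - Z) o\<^sub>L Z))"
      by (rule blinfun_eqI)
         (simp add: \<Phi>_def blinfun.bilinear_simps algebra_simps)
    then have "dist (\<Phi> Y) (\<Phi> Z) \<le> (norm (Y o\<^sub>L (Y - Z)) + norm ((Y - Z) o\<^sub>L Z)) / 2"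
      using norm_triangle_ineq [of "Y o\<^sub>L (Y - Z)" "(Y - Z) o\<^sub>L Z"] by (simp add: dist_norm)
    also have "\<dots> \<le> (norm Y * norm (Y - Z) + norm (Y - Z) * norm Z) / 2"
      by (intro divide_right_mono add_mono norm_blinfun_compose) simp
    also have "\<dots> \<le> (r * norm (Y - Z) + norm (Y - Z) * r) / 2"
      using Y Z r by (intro divide_right_mono add_mono mult_mono) (auto simp: \<Y>_def)
    finally show ?thesis by (simp add: dist_norm)
  qed
  ultimately have "\<exists>!Y\<in>\<Y>. \<Phi> Y = Y"
    using r by (intro Banach_fix [where c = r]) auto
  then obtain Y where Y: "Y \<in> \<Y>" "\<Phi> Y = Y" by blast
  define R where "R x = x - blinfun_apply Y x" for x
  have Yle: "norm (blinfun_apply Y x) \<le> r * norm x" for x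
    by (rule order_trans [OF norm_blinfun mult_right_mono]) (use Y(1) in \<open>auto simp: \<Y>_def\<close>)
  have RR: "R (R x) = t *\<^sub>R A x" for x
  proof -
    have "2 *\<^sub>R blinfun_apply Y x = 2 *\<^sub>R blinfun_apply (\<Phi> Y) x" using Y(2) by simp
    also have "\<dots> = x - t *\<^sub>R A x + blinfun_apply Y (blinfun_apply Y x)"
      by (simp add: \<Phi>_def G blinfun.bilinear_simps)
    finally show ?thesis by (simp add: R_def blinfun.diff_right scaleR_2 algebra_simps)
  qed
  have Rsym: "rinner (R x) y = rinner x (R y)" for x y
    using Y(1) by (simp add: R_def \<Y>_def rinner.diff_left rinner.diff_right)
  have Rlin: "bounded_clinear R"
    using Y(1) unfolding bounded_clinear_iff R_def \<Y>_def
    by (auto intro!: bounded_linear_sub bounded_linear_ident blinfun.bounded_linear_right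
        simp: scaleC.diff_right)
  define S where "S x = (1 / sqrt t) *\<^sub>R R x" for x
  have "bounded_clinear S"
    using Rlin unfolding bounded_clinear_iff S_def
    by (auto intro!: bounded_linear_const_scaleR simp: scaleC.scaleR_right)
  moreover have "\<exists>x. S x = y" for y
  proof -
    obtain x where "x - blinfun_apply Y x = sqrt t *\<^sub>R y"
      using one_minus_contraction_surj [OF blinfun.bounded_linear_right, of r Y "sqrt t *\<^sub>R y"] r Yle by auto
    then show ?thesis using t by (intro exI [of _ x]) (simp add: S_def R_def)
  qed
  moreover have "(1 - r) / sqrt t * norm x \<le> norm (S x)" for x
  proof -
    have "(1 - r) * norm x \<le> norm (R x)"
      using norm_triangle_ineq2 [of x "blinfun_apply Y x"] Yle [of x] by (simp add: R_def algebra_simps)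
    then show ?thesis using t by (simp add: S_def divide_right_mono)
  qed
  moreover have "(1 - r) / sqrt t > 0" using r t by simp
  ultimately obtain Sinv where Sinv: "bounded_clinear Sinv" "\<And>x. Sinv (S x) = x" "\<And>x. S (Sinv x) = x"
    using bounded_clinear_inverse [of S] by blast
  have "(norm (S x))\<^sup>2 = rinner (A x) x" for x
  proof -
    have "(norm (S x))\<^sup>2 = (1 / t) * (norm (R x))\<^sup>2"
      using t by (simp add: S_def power_divide)
    also have "(norm (R x))\<^sup>2 = t * rinner (A x) x"
      by (simp add: rinner_self [symmetric] Rsym RR rinner.scaleR_right rinner_commute [of x])
    finally show ?thesis using t by simp
  qed
  then show thesis by (intro that [of S Sinv] \<open>bounded_clinear S\<close> Sinv)
qed

lemma bounded_linear_funpow: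
  fixes f :: "'a::real_normed_vector \<Rightarrow> 'a"
  assumes "bounded_linear f"
  shows "bounded_linear (f ^^ k)"
  by (induction k) (auto intro: bounded_linear_compose [OF assms] bounded_linear_ident simp: o_def id_def)

text \<open>Sz.-Nagy's averaging argument. The Cesaro means of the forms inherit the two-sided
  bounds, so their limit is bounded and coercive, and shifting the average by one power leaves only
  two end terms divided by the length. The square root of the representing operator is the
  similarity.\<close>

lemma power_bounded_similar_to_isometry:
  fixes C :: "'a::complex_hilbert \<Rightarrow> 'a"
  assumes C: "bounded_clinear C" and c: "c > 0"
    and lower: "\<And>k x. c * norm x \<le> norm ((C ^^ k) x)"
    and upper: "\<And>k x. norm ((C ^^ k) x) \<le> M * norm x"
  obtains S Sinv :: "'a \<Rightarrow> 'a" where "bounded_clinear S" "bounded_clinear Sinv"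
    "\<And>x. Sinv (S x) = x" "\<And>x. S (Sinv x) = x" "\<And>x. norm (S (C x)) = norm (S x)"
proof -
  interpret Ck: bounded_linear "C ^^ k" for k
    using C by (simp add: bounded_clinear_iff bounded_linear_funpow)
  have CkC: "(C ^^ k) (scaleC a x) = scaleC a ((C ^^ k) x)" for a k x
    using C by (induction k) (auto simp: bounded_clinear_iff)
  have M: "0 \<le> M * norm x" for x :: 'a using upper [of 0 x] norm_ge_zero order_trans by blast
  have term_le: "\<bar>rinner ((C ^^ k) x) ((C ^^ k) y)\<bar> \<le> (M * norm x) * (M * norm y)" for k x y
    by (rule order_trans [OF Cauchy_Schwarz_rinner]) (intro mult_mono upper M norm_ge_zero)
  define f where "f N p = (\<Sum>k<Suc N. rinner ((C ^^ k) (fst p)) ((C ^^ k) (snd p))) / Suc N"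
    for N :: nat and p
  have f_le: "\<bar>f N p\<bar> \<le> (M * norm (fst p)) * (M * norm (snd p))" for N p
  proof -
    have "\<bar>\<Sum>k<Suc N. rinner ((C ^^ k) (fst p)) ((C ^^ k) (snd p))\<bar>
        \<le> (\<Sum>k<Suc N. (M * norm (fst p)) * (M * norm (snd p)))"
      by (rule order_trans [OF sum_abs]) (intro sum_mono term_le)
    then show ?thesis by (simp add: f_def field_simps)
  qed
  obtain G g where G: "G \<noteq> bot" "G \<le> sequentially" and g: "\<And>p. ((\<lambda>N. f N p) \<longlongrightarrow> g p) G"
    using pointwise_cluster_filter [of f "\<lambda>p. (M * norm (fst p)) * (M * norm (snd p))" sequentially] f_le by auto
  define b where "b x y = g (x, y)" for x y
  have b: "((\<lambda>N. f N (x, y)) \<longlongrightarrow> b x y) G" for x y using g by (simp add: b_def)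
  note b_eqI = tendsto_unique [OF G(1) b]
  have "bounded_bilinear b"
  proof
    fix x x' y y' :: 'a and r :: real
    show "b (x + x') y = b x y + b x' y"
    proof (rule b_eqI)
      show "((\<lambda>N. f N (x + x', y)) \<longlongrightarrow> b x y + b x' y) G"
        using tendsto_add [OF b [of x y] b [of x' y]]
        by (simp add: f_def Ck.add rinner.add_left sum.distrib add_divide_distrib)
    qed
    show "b x (y + y') = b x y + b x y'"
    proof (rule b_eqI)
      show "((\<lambda>N. f N (x, y + y')) \<longlongrightarrow> b x y + b x y') G"
        using tendsto_add [OF b [of x y] b [of x y']]
        by (simp add: f_def Ck.add rinner.add_right sum.distrib add_divide_distrib)
    qed
    show "b (r *\<^sub>R x) y = r *\<^sub>R b x y"
    proof (rule b_eqI)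
      show "((\<lambda>N. f N (r *\<^sub>R x, y)) \<longlongrightarrow> r *\<^sub>R b x y) G"
        using tendsto_mult_left [OF b [of x y], of r]
        by (simp add: f_def Ck.scaleR rinner.scaleR_left sum_distrib_left algebra_simps)
    qed
    show "b x (r *\<^sub>R y) = r *\<^sub>R b x y"
    proof (rule b_eqI)
      show "((\<lambda>N. f N (x, r *\<^sub>R y)) \<longlongrightarrow> r *\<^sub>R b x y) G"
        using tendsto_mult_left [OF b [of x y], of r]
        by (simp add: f_def Ck.scaleR rinner.scaleR_right sum_distrib_left algebra_simps)
    qed
    show "\<exists>K. \<forall>x y. norm (b x y) \<le> norm x * norm y * K"
    proof (intro exI allI)
      fix x y
      show "norm (b x y) \<le> norm x * norm y * M\<^sup>2"
        by (rule tendsto_upperbound [OF tendsto_norm [OF b] _ G(1)], rule always_eventually)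
           (use f_le [of _ "(x, y)"] in \<open>simp add: ac_simps power2_eq_square\<close>)
    qed
  qed
  then obtain A where A: "bounded_linear A" and bA: "\<And>x y. b x y = rinner (A x) y"
    using bounded_form_operator by blast
  have b_sym: "b x y = b y x" for x y
    by (rule b_eqI) (use b [of y x] in \<open>simp add: f_def rinner_commute\<close>)
  \<comment> \<open>Sesquilinearity expressed through the real part; it makes the representing
    operator, and with it the similarity, complex linear.\<close>
  have b_scaleC: "b (scaleC a x) y = b x (scaleC (cnj a) y)" for a x y
    by (rule b_eqI) (use b [of x "scaleC (cnj a) y"] in \<open>simp add: f_def CkC rinner_scaleC_left\<close>)
  have b_lower: "c\<^sup>2 * (norm x)\<^sup>2 \<le> b x x" for x
  proof (rule tendsto_lowerbound [OF b _ G(1)], rule always_eventually, rule allI)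
    fix N
    have "(\<Sum>k<Suc N. c\<^sup>2 * (norm x)\<^sup>2) \<le> (\<Sum>k<Suc N. rinner ((C ^^ k) x) ((C ^^ k) x))"
    proof (rule sum_mono)
      fix k
      have "(c * norm x)\<^sup>2 \<le> (norm ((C ^^ k) x))\<^sup>2" using lower c by (intro power_mono) auto
      then show "c\<^sup>2 * (norm x)\<^sup>2 \<le> rinner ((C ^^ k) x) ((C ^^ k) x)"
        by (simp add: rinner_self power_mult_distrib)
    qed
    then show "c\<^sup>2 * (norm x)\<^sup>2 \<le> f N (x, x)" by (simp add: f_def field_simps)
  qed
  have b_invariant: "b (C x) (C x) = b x x" for x
  proof -
    define K where "K = (M * norm x) * (M * norm x)"
    have diff: "norm (f N (C x, C x) - f N (x, x)) \<le> 2 * K / Suc N" for N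
    proof -
      define u where "u k = rinner ((C ^^ k) x) ((C ^^ k) x)" for k
      have "f N (C x, C x) - f N (x, x) = ((\<Sum>k<Suc N. u (Suc k)) - (\<Sum>k<Suc N. u k)) / Suc N"
        by (simp only: f_def u_def fst_conv snd_conv funpow_Suc_right o_apply diff_divide_distrib)
      also have "(\<Sum>k<Suc N. u (Suc k)) - (\<Sum>k<Suc N. u k) = u (Suc N) - u 0"
        by (simp only: sum_subtractf [symmetric] sum_lessThan_telescope)
      finally have "norm (f N (C x, C x) - f N (x, x)) = \<bar>u (Suc N) - u 0\<bar> / Suc N" by simp
      also have "\<dots> \<le> 2 * K / Suc N"
        using term_le [of "Suc N" x x] term_le [of 0 x x]
        by (intro divide_right_mono) (auto simp: u_def K_def)
      finally show ?thesis .
    qed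
    have lim: "(\<lambda>N. 2 * K / Suc N) \<longlonglongrightarrow> 0"
      using tendsto_mult_right_zero [OF LIMSEQ_inverse_real_of_nat, of "2 * K"]
      by (simp add: divide_inverse)
    have "(\<lambda>N. f N (C x, C x) - f N (x, x)) \<longlonglongrightarrow> 0"
      by (rule Lim_null_comparison [OF _ lim]) (use diff in \<open>simp only: eventually_True\<close>)
    then have "((\<lambda>N. f N (C x, C x) - f N (x, x)) \<longlongrightarrow> 0) G"
      using G(2) tendsto_mono by blast
    from tendsto_unique [OF G(1) this tendsto_diff [OF b b]] show ?thesis by simp
  qed
  have "A (scaleC a x) = scaleC a (A x)" for a x
    by (rule rinner_eqI) (simp add: rinner_scaleC_left bA [symmetric] b_scaleC)
  then have A': "bounded_clinear A" using A by (simp add: bounded_clinear_iff)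
  have A_sym: "rinner (A x) y = rinner x (A y)" for x y
    using b_sym [of x y] by (simp add: bA rinner_commute)
  have c2: "c\<^sup>2 > 0" using c by simp
  obtain S Sinv :: "'a \<Rightarrow> 'a" where S: "bounded_clinear S" "bounded_clinear Sinv" "\<And>x. Sinv (S x) = x"
     "\<And>x. S (Sinv x) = x" "\<And>x. (norm (S x))\<^sup>2 = rinner (A x) x"
    using coercive_sqrt [OF A' A_sym c2 b_lower [unfolded bA]] by blast
  have "norm (S (C x)) = norm (S x)" for x
    using b_invariant [of x] by (simp add: bA S(5) [symmetric] power2_eq_iff_nonneg)
  then show thesis by (intro that [of S Sinv] S(1-4))
qed

section \<open>Skew-symmetric operators generate isometric semigroups\<close>

lemma bounded_clinear_strong_limit:
  fixes f :: "nat \<Rightarrow> 'a::complex_hilbert \<Rightarrow> 'a"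
  assumes f: "\<And>n. bounded_clinear (f n)" "\<And>n x. norm (f n x) \<le> norm x"
    and lim: "\<And>x. (\<lambda>n. f n x) \<longlonglongrightarrow> g x"
  shows "bounded_clinear g" "norm (g x) \<le> norm x"
proof -
  interpret f: bounded_linear "f n" for n using f(1) by (simp add: bounded_clinear_iff)
  have le: "norm (g x) \<le> norm x" for x
    by (rule LIMSEQ_le_const2 [OF tendsto_norm [OF lim]]) (use f(2) in blast)
  show "norm (g x) \<le> norm x" by (rule le)
  have "bounded_linear g"
  proof (rule bounded_linear_intro)
    show "g (x + y) = g x + g y" for x y
      using tendsto_add [OF lim lim, of x y] by (intro LIMSEQ_unique [OF lim]) (simp add: f.add)
    show "g (r *\<^sub>R x) = r *\<^sub>R g x" for r x
      using tendsto_scaleR [OF tendsto_const lim, of r x]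
      by (intro LIMSEQ_unique [OF lim]) (simp add: f.scaleR)
    show "norm (g x) \<le> norm x * 1" for x using le by simp
  qed
  moreover have "g (scaleC a x) = scaleC a (g x)" for a x
    using scaleC.tendsto [OF tendsto_const lim, of a x] f(1)
    by (intro LIMSEQ_unique [OF lim]) (simp add: bounded_clinear_iff)
  ultimately show "bounded_clinear g" by (simp add: bounded_clinear_iff)
qed

lemma eq_on_closure_UNIV:
  fixes f g :: "'a::topological_space \<Rightarrow> 'b::t2_space"
  assumes "closure S = UNIV" "continuous_on UNIV f" "continuous_on UNIV g" "\<And>x. x \<in> S \<Longrightarrow> f x = g x"
  shows "f x = g x"
proof -
  have "closed {x. f x = g x}" by (rule closed_Collect_eq assms)+
  then have "closure S \<subseteq> {x. f x = g x}" by (rule closure_minimal [rotated]) (use assms(4) in blast)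
  then show ?thesis using assms(1) by blast
qed

text \<open>Lumer-Phillips data with equality in the dissipativity condition. The range condition is
  one-sided, so what is built is a forward semigroup. Density of the domain is a consequence, see
  \<open>dense_D\<close>.\<close>

locale skew_operator =
  fixes D :: "'a::complex_hilbert set" and E :: "'a \<Rightarrow> 'a"
  assumes linear: "linear_operator D E"
    and skew: "x \<in> D \<Longrightarrow> rinner (E x) x = 0"
    and surj: "0 < r \<Longrightarrow> \<exists>x\<in>D. r *\<^sub>R x - E x = y"
begin

lemma D_add: "x \<in> D \<Longrightarrow> y \<in> D \<Longrightarrow> x + y \<in> D"
  and D_scaleC: "x \<in> D \<Longrightarrow> scaleC c x \<in> D"
  and D_scaleR: "x \<in> D \<Longrightarrow> r *\<^sub>R x \<in> D"
  and E_add: "x \<in> D \<Longrightarrow> y \<in> D \<Longrightarrow> E (x + y) = E x + E y"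
  and E_scaleC: "x \<in> D \<Longrightarrow> E (scaleC c x) = scaleC c (E x)"
  and E_scaleR: "x \<in> D \<Longrightarrow> E (r *\<^sub>R x) = r *\<^sub>R E x"
  using linear by (auto simp: linear_operator_def csubspace_def scaleR_scaleC)

lemma D_diff: "x \<in> D \<Longrightarrow> y \<in> D \<Longrightarrow> x - y \<in> D"
  using D_add [of x "(-1) *\<^sub>R y"] D_scaleR [of y "-1"] by simp

lemma E_diff: "x \<in> D \<Longrightarrow> y \<in> D \<Longrightarrow> E (x - y) = E x - E y"
  using E_add [of x "(-1) *\<^sub>R y"] D_scaleR [of y "-1"] E_scaleR [of y "-1"] by simp

lemma subspace_D: "subspace D"
  using linear unfolding subspace_def linear_operator_def csubspace_def
  by (simp add: D_add D_scaleR)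

text \<open>Skewness makes \<open>x\<close> and \<open>E x\<close> orthogonal, so this is
  Pythagoras. Injectivity of 1 - h E, contractivity of \<open>J h\<close> and the exact norm lost in
  an Euler step all rest on it.\<close>

lemma norm_minus_E: "x \<in> D \<Longrightarrow> (norm (x - h *\<^sub>R E x))\<^sup>2 = (norm x)\<^sup>2 + h\<^sup>2 * (norm (E x))\<^sup>2"
  by (simp add: norm_diff_sq rinner.scaleR_right rinner_commute [of x] skew power_mult_distrib)

lemma minus_E_inj:
  assumes "x \<in> D" "y \<in> D" "x - h *\<^sub>R E x = y - h *\<^sub>R E y"
  shows "x = y"
proof -
  have "(x - y) - h *\<^sub>R E (x - y) = 0" using assms by (simp add: E_diff algebra_simps)
  with norm_minus_E [OF D_diff, OF assms(1,2), of h] have "(norm (x - y))\<^sup>2 + h\<^sup>2 * (norm (E (x - y)))\<^sup>2 = 0"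
    by simp
  then have "(norm (x - y))\<^sup>2 = 0" by (simp add: add_nonneg_eq_0_iff)
  then show ?thesis by simp
qed

text \<open>One backward Euler step of size \<open>h\<close>, that is, the inverse of 1 - h E.
  Existence is guaranteed for positive \<open>h\<close>, hence the contexts that fix such an
  \<open>h\<close>.\<close>

definition J :: "real \<Rightarrow> 'a \<Rightarrow> 'a" where
  "J h y = (SOME x. x \<in> D \<and> x - h *\<^sub>R E x = y)"

context
  fixes h :: real
  assumes h: "0 < h"
begin

lemma J: "J h y \<in> D" "J h y - h *\<^sub>R E (J h y) = y"
proof -
  obtain x where "x \<in> D" "inverse h *\<^sub>R x - E x = inverse h *\<^sub>R y" using surj h by (metis inverse_positive_iff_positive)
  then have "h *\<^sub>R (inverse h *\<^sub>R x - E x) = h *\<^sub>R inverse h *\<^sub>R y" by simp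
  then have "x - h *\<^sub>R E x = y" using h by (simp add: scaleR_diff_right)
  with \<open>x \<in> D\<close> have "x \<in> D \<and> x - h *\<^sub>R E x = y" by simp
  from someI [where P = "\<lambda>x. x \<in> D \<and> x - h *\<^sub>R E x = y", OF this]
  show "J h y \<in> D" "J h y - h *\<^sub>R E (J h y) = y" unfolding J_def by auto
qed

lemma J_eqI: "x \<in> D \<Longrightarrow> x - h *\<^sub>R E x = y \<Longrightarrow> J h y = x"
  by (rule minus_E_inj [where h = h]) (auto simp: J)

lemma norm_J: "norm (J h y) \<le> norm y"
  using norm_minus_E [OF J(1) [of y], of h] by - (rule power2_le_imp_le, auto simp: J(2))

lemma bounded_clinear_J: "bounded_clinear (J h)"
proof -
  have "J h (x + y) = J h x + J h y" for x y
    by (rule J_eqI) (simp_all add: J D_add E_add scaleR_add_right add_diff_add)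
  moreover have "J h (scaleC c x) = scaleC c (J h x)" for c x
    by (rule J_eqI) (simp_all add: J D_scaleC E_scaleC scaleC.scaleR_right [symmetric] scaleC.diff_right [symmetric])
  ultimately show ?thesis
    unfolding bounded_clinear_def clinear_def using norm_J by (auto intro!: exI [of _ 1])
qed

lemma J_commute_E:
  assumes "x \<in> D"
  shows "E (J h x) \<in> D" "J h (E x) = E (J h x)"
proof -
  have "h *\<^sub>R E (J h x) = J h x - x" using J(2) [of x] by (simp add: algebra_simps)
  moreover have "E (J h x) = inverse h *\<^sub>R h *\<^sub>R E (J h x)" using h by simp
  \<comment> \<open>The Yosida approximation: on the range of \<open>J h\<close> the operator is a
    combination of \<open>J h x\<close> and \<open>x\<close>, so membership of \<open>x\<close> in
    \<open>D\<close> passes to \<open>E (J h x)\<close>.\<close>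
  ultimately have eq: "E (J h x) = inverse h *\<^sub>R (J h x - x)" by simp
  then show *: "E (J h x) \<in> D" using assms J(1) by (simp add: D_scaleR D_diff)
  have "E (J h x) - h *\<^sub>R E (E (J h x)) = E (J h x - h *\<^sub>R E (J h x))"
    using * J(1) by (simp add: E_diff E_scaleR D_scaleR)
  then show "J h (E x) = E (J h x)" using * by (intro J_eqI) (auto simp: J(2))
qed

lemma J_minus_E: "x \<in> D \<Longrightarrow> J h (x - h *\<^sub>R E x) = x"
  by (rule J_eqI) auto

end

section \<open>Error estimates for powers of a backward Euler step\<close>

context
  fixes h :: real
  assumes h: "0 < h"
begin

interpretation Jh: bounded_linear "J h"
  using bounded_clinear_J [OF h] by (simp add: bounded_clinear_iff)

lemma J_commute: "0 < g \<Longrightarrow> J h (J g y) = J g (J h y)"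
proof (rule sym, rule J_eqI)
  assume g: "0 < g"
  have "J h (J g y) - g *\<^sub>R E (J h (J g y)) = J h (J g y - g *\<^sub>R E (J g y))"
    by (simp add: J_commute_E(2) [OF h J(1) [OF g], symmetric] Jh.diff Jh.scaleR)
  then show "J h (J g y) - g *\<^sub>R E (J h (J g y)) = J h y" by (simp add: J(2) [OF g])
qed (simp_all add: J h)

lemma J_pow_D: "x \<in> D \<Longrightarrow> (J h ^^ k) x \<in> D"
  by (induction k) (auto simp: J h)

lemma J_pow_E: "x \<in> D \<Longrightarrow> E ((J h ^^ k) x) = (J h ^^ k) (E x)"
  by (induction k) (auto simp: J_commute_E(2) [OF h, symmetric] J_pow_D)

lemma J_pow_J: "0 < g \<Longrightarrow> (J h ^^ k) (J g x) = J g ((J h ^^ k) x)"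
  by (induction k) (auto simp: J_commute)

lemma norm_J_pow: "norm ((J h ^^ k) x) \<le> norm x"
  by (induction k) (auto intro: order_trans [OF norm_J [OF h]])

lemma bounded_clinear_J_pow: "bounded_clinear (J h ^^ k)"
proof (induction k)
  case (Suc k)
  show ?case using bounded_clinear_compose [OF bounded_clinear_J [OF h] Suc] by (simp add: o_def)
qed (auto simp: bounded_clinear_iff bounded_linear_ident id_def)

interpretation Jk: bounded_linear "J h ^^ k" for k
  using bounded_clinear_J_pow by (simp add: bounded_clinear_iff)

lemma J_diff: "x \<in> D \<Longrightarrow> J h x - x = h *\<^sub>R J h (E x)"
  using J(2) [OF h, of x] J_commute_E(2) [OF h] by (simp add: algebra_simps)

lemma norm_J_pow_diff_0: "x \<in> D \<Longrightarrow> norm ((J h ^^ k) x - x) \<le> k * h * norm (E x)"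
proof (induction k)
  case (Suc k)
  have "(J h ^^ Suc k) x - x = (J h ((J h ^^ k) x) - (J h ^^ k) x) + ((J h ^^ k) x - x)" by simp
  also have "\<dots> = h *\<^sub>R (J h ^^ Suc k) (E x) + ((J h ^^ k) x - x)"
    by (simp add: J_diff J_pow_D J_pow_E Suc.prems)
  also have "norm \<dots> \<le> h * norm (E x) + k * h * norm (E x)"
    using h norm_J_pow [of "Suc k" "E x"] Suc
    by (intro order_trans [OF norm_triangle_ineq] add_mono) (auto simp del: funpow.simps)
  finally show ?case by (simp add: algebra_simps)
qed simp

lemma norm_J_pow_diff:
  assumes "x \<in> D"
  shows "norm ((J h ^^ k) x - (J h ^^ l) x) \<le> \<bar>real k - real l\<bar> * h * norm (E x)"
proof -
  have *: "norm ((J h ^^ (l + m)) x - (J h ^^ l) x) \<le> m * h * norm (E x)" for l m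
  proof -
    have "(J h ^^ (l + m)) x - (J h ^^ l) x = (J h ^^ l) ((J h ^^ m) x - x)"
      by (simp add: funpow_add Jk.diff)
    also have "norm \<dots> \<le> norm ((J h ^^ m) x - x)" by (rule norm_J_pow)
    finally show ?thesis using norm_J_pow_diff_0 [OF assms, of m] by linarith
  qed
  show ?thesis
  proof (cases "l \<le> k")
    case True
    then show ?thesis using * [of l "k - l"] by (simp add: of_nat_diff)
  next
    case False
    then show ?thesis using * [of k "l - k"] by (simp add: of_nat_diff norm_minus_commute)
  qed
qed

text \<open>The step number j deviates from \<open>h *\<^sub>R E x\<close> by at most j h^2 times
  the norm of \<open>E (E x)\<close>; summing over j gives a quadratic bound. The constant 1 is
  generous, but any quadratic error suffices for the derivative at 0.\<close>

lemma norm_J_pow_taylor: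
  assumes "x \<in> D" "E x \<in> D"
  shows "norm ((J h ^^ k) x - x - (k * h) *\<^sub>R E x) \<le> (k * h)\<^sup>2 * norm (E (E x))"
proof (induction k)
  case (Suc k)
  have "(J h ^^ Suc k) x - x - (Suc k * h) *\<^sub>R E x
      = ((J h ^^ k) x - x - (k * h) *\<^sub>R E x) + (J h ((J h ^^ k) x) - (J h ^^ k) x - h *\<^sub>R E x)"
    by (simp add: algebra_simps)
  also have "\<dots> = ((J h ^^ k) x - x - (k * h) *\<^sub>R E x) + h *\<^sub>R ((J h ^^ Suc k) (E x) - E x)"
    by (simp add: J_diff J_pow_D J_pow_E assms scaleR_diff_right)
  also have "norm \<dots> \<le> (k * h)\<^sup>2 * norm (E (E x)) + h * (Suc k * h * norm (E (E x)))"
    using h norm_J_pow_diff_0 [OF assms(2), of "Suc k"] Suc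
    by (intro order_trans [OF norm_triangle_ineq] add_mono) (auto simp del: funpow.simps of_nat_Suc)
  also have "\<dots> = (k\<^sup>2 + k + 1) * (h\<^sup>2 * norm (E (E x)))" by (simp add: algebra_simps power2_eq_square)
  also have "\<dots> \<le> (Suc k)\<^sup>2 * (h\<^sup>2 * norm (E (E x)))"
    by (intro mult_right_mono mult_nonneg_nonneg) (simp_all add: power2_eq_square algebra_simps)
  also have "\<dots> = (Suc k * h)\<^sup>2 * norm (E (E x))" by (simp add: power_mult_distrib del: of_nat_Suc)
  finally show ?case .
qed simp

text \<open>Each \<open>J h\<close> strictly shrinks most vectors, but by Pythagoras the squared
  norm lost in one step is only of order h^2. Over a time k h the total loss is of order h, so it
  disappears in the limit and the limit is isometric.\<close>

lemma norm_J_pow_loss: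
  assumes "x \<in> D"
  shows "(norm x)\<^sup>2 - (norm ((J h ^^ k) x))\<^sup>2 \<le> k * h\<^sup>2 * (norm (E x))\<^sup>2"
proof (induction k)
  case (Suc k)
  have "(norm ((J h ^^ k) x))\<^sup>2 = (norm ((J h ^^ Suc k) x))\<^sup>2 + h\<^sup>2 * (norm (E ((J h ^^ Suc k) x)))\<^sup>2"
    using norm_minus_E [OF J(1) [OF h, of "(J h ^^ k) x"], of h] by (simp add: J(2) [OF h])
  moreover have "norm (E ((J h ^^ Suc k) x)) \<le> norm (E x)"
    unfolding J_pow_E [OF assms] by (rule norm_J_pow)
  then have "h\<^sup>2 * (norm (E ((J h ^^ Suc k) x)))\<^sup>2 \<le> h\<^sup>2 * (norm (E x))\<^sup>2"
    by (intro mult_left_mono power_mono) auto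
  ultimately show ?case using Suc by (simp add: algebra_simps)
qed simp

text \<open>One step of size \<open>h\<close> is compared with two steps of half the size. Since (1
  - h E / 2)^2 differs from 1 - h E by h^2 / 4 times E^2, this is the local error on the domain of
  E^2; it is what makes dyadic refinement converge.\<close>

lemma norm_J_half_pow_diff:
  assumes "x \<in> D" "E x \<in> D"
  shows "norm ((J (h/2) ^^ (2 * k)) x - (J h ^^ k) x) \<le> k * h\<^sup>2 / 4 * norm (E (E x))"
proof -
  define g where "g = h / 2"
  have g: "0 < g" "h = 2 * g" using h by (auto simp: g_def)
  interpret Jg: bounded_linear "J g" using bounded_clinear_J [OF g(1)] by (simp add: bounded_clinear_iff)
  \<comment> \<open>The square of 1 - g E is inserted together with the two \<open>J g\<close> that
    undo it.\<close>
  have "J h x = J h (J g (J g ((x - g *\<^sub>R E x) - g *\<^sub>R E (x - g *\<^sub>R E x))))"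
    using assms g(1) by (simp add: J_minus_E D_diff D_scaleR)
  also have "(x - g *\<^sub>R E x) - g *\<^sub>R E (x - g *\<^sub>R E x) = (x - h *\<^sub>R E x) + g\<^sup>2 *\<^sub>R E (E x)"
    using assms by (simp add: E_diff E_scaleR D_scaleR g(2) power2_eq_square scaleR_2 algebra_simps
        flip: scaleR_scaleR)
  also have "J h (J g (J g \<dots>)) = J g (J g (J h (x - h *\<^sub>R E x))) + g\<^sup>2 *\<^sub>R J h (J g (J g (E (E x))))"
    by (simp add: Jg.add Jh.add Jg.scaleR Jh.scaleR J_commute [OF g(1)])
  also have "J h (x - h *\<^sub>R E x) = x" using assms(1) h by (simp add: J_minus_E)
  finally have step: "J g (J g x) - J h x = - (g\<^sup>2 *\<^sub>R J h (J g (J g (E (E x)))))" by simp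
  have "norm (J g (J g x) - J h x) \<le> g\<^sup>2 * norm (J h (J g (J g (E (E x)))))"
    unfolding step by simp
  also have "\<dots> \<le> g\<^sup>2 * norm (E (E x))"
    by (intro mult_left_mono order_trans [OF norm_J [OF h]] order_trans [OF norm_J [OF g(1)]]
        norm_J [OF g(1)]) simp
  finally have step_le: "norm (J g (J g x) - J h x) \<le> h\<^sup>2 / 4 * norm (E (E x))"
    by (simp add: g_def power_divide)
  have "norm ((J g ^^ (2 * k)) x - (J h ^^ k) x) \<le> k * h\<^sup>2 / 4 * norm (E (E x))"
  proof (induction k)
    case (Suc k)
    have "(J g ^^ (2 * Suc k)) x - (J h ^^ Suc k) x
       = J g (J g ((J g ^^ (2 * k)) x)) - (J h ^^ k) (J h x)"
      by (simp add: funpow_swap1)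
    \<comment> \<open>Telescoping of a difference of powers: local errors are transported by
      commuting contractions, so they add up without amplification.\<close>
    also have "\<dots> = J g (J g ((J g ^^ (2 * k)) x - (J h ^^ k) x)) + (J h ^^ k) (J g (J g x) - J h x)"
      by (simp add: Jg.diff Jk.diff J_pow_J [OF g(1)])
    finally have eq: "(J g ^^ (2 * Suc k)) x - (J h ^^ Suc k) x
      = J g (J g ((J g ^^ (2 * k)) x - (J h ^^ k) x)) + (J h ^^ k) (J g (J g x) - J h x)" .
    have "norm ((J g ^^ (2 * Suc k)) x - (J h ^^ Suc k) x) \<le> norm ((J g ^^ (2 * k)) x - (J h ^^ k) x) + norm (J g (J g x) - J h x)"
      unfolding eq by (intro order_trans [OF norm_triangle_ineq] add_mono norm_J_pow
          order_trans [OF norm_J [OF g(1)]] norm_J [OF g(1)])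
    also have "\<dots> \<le> k * h\<^sup>2 / 4 * norm (E (E x)) + h\<^sup>2 / 4 * norm (E (E x))"
      by (rule add_mono [OF Suc step_le])
    also have "\<dots> = Suc k * h\<^sup>2 / 4 * norm (E (E x))"
      by (simp add: distrib_right add_divide_distrib)
    finally show ?case .
  qed simp
  then show ?thesis by (simp add: g_def)
qed

end

section \<open>Density of the domain and approximation in the graph norm\<close>

lemma dense_D: "closure D = UNIV"
proof (rule dense_if_orthogonal_trivial [OF subspace_D])
  fix y assume y: "\<And>w. w \<in> D \<Longrightarrow> rinner y w = 0"
  \<comment> \<open>\<open>y\<close> is tested against its own image under the inverse of 1 - E,
    which lies in \<open>D\<close>; by skewness the result is the squared norm of that
    image.\<close>
  define x where "x = J 1 y"
  have x: "x \<in> D" "y = x - E x" using J [of 1 y] by (auto simp: x_def)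
  have "rinner (x - E x) x = 0" using y [OF x(1)] x(2) by simp
  then have "x = 0" by (simp add: rinner.diff_left skew x(1) rinner_self)
  moreover have "E 0 = 0" using E_scaleR [OF x(1), of 0] by simp
  ultimately show "y = 0" using x(2) by simp
qed

lemma approximate_D:
  assumes "0 < e"
  obtains d where "d \<in> D" "norm (x - d) < e"
proof -
  have "x \<in> closure D" by (simp add: dense_D)
  then obtain d where "d \<in> D" "dist d x < e" using assms by (meson closure_approachable)
  then show thesis using that by (simp add: dist_norm norm_minus_commute)
qed

text \<open>The domain of E^2 is a core: \<open>J 1\<close> is bounded into the graph norm, so it is
  enough to approximate x - E x in norm by some \<open>u\<close> in \<open>D\<close>, and
  \<open>J 1 u\<close> then lies in the domain of E^2. The second-order estimates are available only
  there.\<close>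

lemma approximate_D2:
  assumes x: "x \<in> D" and e: "0 < e"
  obtains d where "d \<in> D" "E d \<in> D" "norm (x - d) < e" "norm (E x - E d) < e"
proof -
  obtain u where u: "u \<in> D" "norm (x - E x - u) < e / 2" using approximate_D [of "e/2" "x - E x"] e by auto
  define d where "d = J 1 u"
  have d: "d \<in> D" "u = d - E d" using J [of 1 u] by (auto simp: d_def)
  have Ed: "E d \<in> D" unfolding d_def by (rule J_commute_E) (use u in auto)
  interpret J1: bounded_linear "J 1" using bounded_clinear_J [of 1] by (simp add: bounded_clinear_iff)
  have "x - d = J 1 (x - E x - u)"
    using J_minus_E [OF _ x, of 1] by (simp add: J1.diff d_def)
  then have 1: "norm (x - d) < e / 2" using norm_J [of 1 "x - E x - u"] u(2) by simp
  have "E x - E d = (x - d) - (x - E x - u)" using d(2) by simp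
  then have "norm (E x - E d) \<le> norm (x - d) + norm (x - E x - u)"
    by (simp only: norm_triangle_ineq4)
  with 1 u(2) have "norm (E x - E d) < e" by simp
  moreover have "norm (x - d) < e" using 1 e by simp
  ultimately show thesis using that d(1) Ed by blast
qed

section \<open>Convergence of the dyadic Euler scheme\<close>

definition approx :: "nat \<Rightarrow> real \<Rightarrow> 'a \<Rightarrow> 'a" where
  "approx n t = J (1 / 2 ^ n) ^^ nat \<lfloor>2 ^ n * t\<rfloor>"

lemma bounded_clinear_approx: "bounded_clinear (approx n t)"
  and norm_approx: "norm (approx n t x) \<le> norm x"
  by (simp_all add: approx_def bounded_clinear_J_pow norm_J_pow)

lemma steps_tendsto: "0 \<le> t \<Longrightarrow> (\<lambda>n. nat \<lfloor>2 ^ n * t\<rfloor> * (1 / 2 ^ n :: real)) \<longlonglongrightarrow> t"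
proof (rule tendsto_sandwich [of "\<lambda>n. t - (1/2) ^ n" _ _ "\<lambda>n. t"])
  assume t: "0 \<le> t"
  have "t - (1/2) ^ n \<le> nat \<lfloor>2 ^ n * t\<rfloor> * (1 / 2 ^ n)" "nat \<lfloor>2 ^ n * t\<rfloor> * (1 / 2 ^ n) \<le> t" for n
  proof -
    have "2 ^ n * t \<le> real (nat \<lfloor>2 ^ n * t\<rfloor>) + 1" and *: "real (nat \<lfloor>2 ^ n * t\<rfloor>) \<le> 2 ^ n * t"
      using t by (auto simp: of_nat_nat)
    then have "t \<le> (real (nat \<lfloor>2 ^ n * t\<rfloor>) + 1) / 2 ^ n"
      by (simp add: pos_le_divide_eq mult.commute)
    then show "t - (1/2) ^ n \<le> nat \<lfloor>2 ^ n * t\<rfloor> * (1 / 2 ^ n)"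
      by (simp add: power_one_over add_divide_distrib)
    show "nat \<lfloor>2 ^ n * t\<rfloor> * (1 / 2 ^ n) \<le> t"
      using * by (simp add: pos_divide_le_eq mult.commute)
  qed
  then show "\<forall>\<^sub>F n in sequentially. t - (1/2) ^ n \<le> nat \<lfloor>2 ^ n * t\<rfloor> * (1 / 2 ^ n)"
    "\<forall>\<^sub>F n in sequentially. nat \<lfloor>2 ^ n * t\<rfloor> * (1 / 2 ^ n) \<le> t"
    by (simp_all only: eventually_True)
  have "(\<lambda>n. t - (1/2) ^ n) \<longlonglongrightarrow> t - 0" by (intro tendsto_diff tendsto_const LIMSEQ_realpow_zero) auto
  then show "(\<lambda>n. t - (1/2) ^ n) \<longlonglongrightarrow> t" by simp
qed auto

lemma step_size_tendsto: "(\<lambda>n. 1 / 2 ^ n :: real) \<longlonglongrightarrow> 0"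
  using LIMSEQ_realpow_zero [of "1/2 :: real"] by (simp add: power_one_over)

text \<open>With dyadic steps each level halves the previous one, so consecutive levels differ by
  the halving error and a possible rounding error. Both are of order 2^-n, and the differences are
  dominated by a geometric series.\<close>

lemma convergent_approx_D2:
  assumes t: "0 \<le> t" and x: "x \<in> D" "E x \<in> D"
  shows "convergent (\<lambda>n. approx n t x)"
proof -
  have "norm (approx (Suc n) t x - approx n t x) \<le> (t * norm (E (E x)) + norm (E x)) * (1/2) ^ n" for n
  proof -
    define h :: real where "h = 1 / 2 ^ n"
    define k where "k = nat \<lfloor>2 ^ n * t\<rfloor>"
    define m where "m = nat \<lfloor>2 ^ Suc n * t\<rfloor>"
    have h: "0 < h" "1 / 2 ^ Suc n = h / 2" by (auto simp: h_def)
    have kt: "k * h \<le> t" using t by (simp add: k_def h_def field_simps of_nat_nat)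
    have "real k \<le> 2 ^ n * t" "2 ^ n * t < real k + 1" "real m \<le> 2 ^ Suc n * t" "2 ^ Suc n * t < real m + 1"
      using t by (auto simp: k_def m_def of_nat_nat)
    then have "real m < 2 * real k + 2" "2 * real k < real m + 1" by auto
    then have "m < 2 * k + 2" "2 * k < m + 1" by linarith+
    \<comment> \<open>The floor of a doubled number is twice the floor or one more: the finer scheme
      makes at most one extra half step.\<close>
    then have m: "\<bar>real m - real (2 * k)\<bar> \<le> 1" by linarith
    have "norm (approx (Suc n) t x - approx n t x) = norm ((J (h/2) ^^ m) x - (J h ^^ k) x)"
      unfolding approx_def h(2) by (simp only: h_def k_def m_def)
    also have "\<dots> \<le> norm ((J (h/2) ^^ m) x - (J (h/2) ^^ (2 * k)) x) + norm ((J (h/2) ^^ (2 * k)) x - (J h ^^ k) x)"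
      using dist_triangle [of "(J (h/2) ^^ m) x" "(J h ^^ k) x" "(J (h/2) ^^ (2 * k)) x"]
      by (simp only: dist_norm)
    also have "\<dots> \<le> 1 * (h/2) * norm (E x) + k * h\<^sup>2 / 4 * norm (E (E x))"
      using h(1) by (intro add_mono norm_J_half_pow_diff x order_trans [OF norm_J_pow_diff] mult_right_mono m) auto
    also have "k * h\<^sup>2 / 4 * norm (E (E x)) \<le> h * (t * norm (E (E x)))"
    proof -
      have nonneg: "0 \<le> h * (t * norm (E (E x)))" using h(1) t by simp
      have "k * h\<^sup>2 / 4 * norm (E (E x)) = (k * h) * (h * norm (E (E x))) / 4"
        by (simp add: power2_eq_square)
      also have "\<dots> \<le> t * (h * norm (E (E x))) / 4"
        using kt h(1) by (intro divide_right_mono mult_right_mono) auto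
      also have "\<dots> = h * (t * norm (E (E x))) / 4" by (simp add: mult.left_commute)
      finally show ?thesis using nonneg by linarith
    qed
    also have "1 * (h/2) * norm (E x) + h * (t * norm (E (E x))) \<le> (t * norm (E (E x)) + norm (E x)) * h"
      using h(1) by (simp add: algebra_simps)
    finally show ?thesis by (simp add: h_def power_one_over)
  qed
  then have "summable (\<lambda>n. approx (Suc n) t x - approx n t x)"
    by (rule summable_comparison_test' [OF summable_mult [OF summable_geometric], rotated]) auto
  then have "convergent (\<lambda>n. (\<Sum>i<n. approx (Suc i) t x - approx i t x))"
    by (simp add: summable_iff_convergent)
  then obtain l where "(\<lambda>n. approx n t x - approx 0 t x) \<longlonglongrightarrow> l"
    unfolding sum_lessThan_telescope [of "\<lambda>n. approx n t x"] convergent_def by blast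
  from tendsto_add [OF this tendsto_const [of "approx 0 t x"]] show ?thesis
    by (auto simp: convergent_def)
qed

text \<open>All approximants are contractions, so convergence spreads from a dense set; the domain
  of E^2 is reached from an arbitrary vector in two stages, through \<open>D\<close>.\<close>

lemma convergent_approx:
  assumes t: "0 \<le> t"
  shows "convergent (\<lambda>n. approx n t x)"
proof (rule Cauchy_convergent, rule metric_CauchyI)
  fix e :: real assume e: "0 < e"
  obtain d0 where d0: "d0 \<in> D" "norm (x - d0) < e / 6" using approximate_D [of "e/6" x] e by auto
  obtain d where d: "d \<in> D" "E d \<in> D" "norm (d0 - d) < e / 6"
    using approximate_D2 [OF d0(1), of "e/6"] e by auto
  have xd: "norm (x - d) < e / 3" using norm_triangle_ineq [of "x - d0" "d0 - d"] d0 d by simp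
  have "Cauchy (\<lambda>n. approx n t d)" using convergent_approx_D2 [OF t d(1,2)] by (rule convergent_Cauchy)
  then obtain N where N: "\<And>m n. N \<le> m \<Longrightarrow> N \<le> n \<Longrightarrow> dist (approx m t d) (approx n t d) < e / 3"
    using metric_CauchyD [of _ "e/3"] e by (metis divide_pos_pos zero_less_numeral)
  have xd_le: "dist (approx n t x) (approx n t d) \<le> norm (x - d)" for n
  proof -
    interpret bounded_linear "approx n t" using bounded_clinear_approx by (simp add: bounded_clinear_iff)
    show ?thesis using norm_approx [of n t "x - d"] by (simp add: dist_norm diff)
  qed
  have "dist (approx m t x) (approx n t x) < e" if "N \<le> m" "N \<le> n" for m n
    using N [OF that] xd xd_le [of m] xd_le [of n] dist_triangle2 [of "approx m t x" "approx n t x" "approx n t d"]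
      dist_triangle [of "approx m t x" "approx n t d" "approx m t d"] by linarith
  then show "\<exists>M. \<forall>m\<ge>M. \<forall>n\<ge>M. dist (approx m t x) (approx n t x) < e" by blast
qed

definition V :: "real \<Rightarrow> 'a \<Rightarrow> 'a" where "V t x = lim (\<lambda>n. approx n t x)"

lemma approx_tendsto: "0 \<le> t \<Longrightarrow> (\<lambda>n. approx n t x) \<longlonglongrightarrow> V t x"
  unfolding V_def by (rule convergent_LIMSEQ_iff [THEN iffD1, OF convergent_approx])

lemma bounded_clinear_V: "0 \<le> t \<Longrightarrow> bounded_clinear (V t)"
  by (rule bounded_clinear_strong_limit [OF bounded_clinear_approx norm_approx approx_tendsto])

lemma continuous_on_V: "0 \<le> t \<Longrightarrow> continuous_on A (V t)"
  using bounded_clinear_V by (simp add: bounded_clinear_iff linear_continuous_on)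

lemma V_0: "V 0 x = x"
  using approx_tendsto [of 0 x] by (simp add: approx_def LIMSEQ_const_iff)

lemma V_Lipschitz:
  assumes "x \<in> D" "0 \<le> s" "0 \<le> t"
  shows "norm (V s x - V t x) \<le> \<bar>s - t\<bar> * norm (E x)"
proof (rule LIMSEQ_le)
  show "(\<lambda>n. norm (approx n s x - approx n t x)) \<longlonglongrightarrow> norm (V s x - V t x)"
    using assms by (intro tendsto_intros approx_tendsto)
  show "(\<lambda>n. \<bar>nat \<lfloor>2 ^ n * s\<rfloor> * (1 / 2 ^ n) - nat \<lfloor>2 ^ n * t\<rfloor> * (1 / 2 ^ n)\<bar> * norm (E x))
      \<longlonglongrightarrow> \<bar>s - t\<bar> * norm (E x)"
    using assms by (intro tendsto_intros steps_tendsto)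
  have "norm (approx n s x - approx n t x)
    \<le> \<bar>nat \<lfloor>2 ^ n * s\<rfloor> * (1 / 2 ^ n) - nat \<lfloor>2 ^ n * t\<rfloor> * (1 / 2 ^ n)\<bar> * norm (E x)" for n
    using norm_J_pow_diff [OF _ assms(1), of "1 / 2 ^ n" "nat \<lfloor>2 ^ n * s\<rfloor>" "nat \<lfloor>2 ^ n * t\<rfloor>"]
    by (simp add: approx_def flip: diff_divide_distrib)
  then show "\<exists>N. \<forall>n\<ge>N. norm (approx n s x - approx n t x)
    \<le> \<bar>nat \<lfloor>2 ^ n * s\<rfloor> * (1 / 2 ^ n) - nat \<lfloor>2 ^ n * t\<rfloor> * (1 / 2 ^ n)\<bar> * norm (E x)" by blast
qed

lemma norm_V:
  assumes t: "0 \<le> t"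
  shows "norm (V t x) = norm x"
proof (rule eq_on_closure_UNIV [where f = "\<lambda>x. norm (V t x)" and g = norm, OF dense_D])
  fix x assume x: "x \<in> D"
  \<comment> \<open>The factor 0 is the limit of the step size in the bound for the lost squared
    norm.\<close>
  have "(norm x)\<^sup>2 - (norm (V t x))\<^sup>2 \<le> t * 0 * (norm (E x))\<^sup>2"
  proof (rule LIMSEQ_le [where X = "\<lambda>n. (norm x)\<^sup>2 - (norm (approx n t x))\<^sup>2"
        and Y = "\<lambda>n. (nat \<lfloor>2 ^ n * t\<rfloor> * (1 / 2 ^ n)) * (1 / 2 ^ n) * (norm (E x))\<^sup>2"])
    show "(\<lambda>n. (norm x)\<^sup>2 - (norm (approx n t x))\<^sup>2) \<longlonglongrightarrow> (norm x)\<^sup>2 - (norm (V t x))\<^sup>2"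
      by (intro tendsto_diff tendsto_const tendsto_power tendsto_norm approx_tendsto t)
    show "(\<lambda>n. (nat \<lfloor>2 ^ n * t\<rfloor> * (1 / 2 ^ n)) * (1 / 2 ^ n) * (norm (E x))\<^sup>2) \<longlonglongrightarrow> t * 0 * (norm (E x))\<^sup>2"
      by (intro tendsto_mult tendsto_const steps_tendsto step_size_tendsto t)
    have "(norm x)\<^sup>2 - (norm (approx n t x))\<^sup>2
        \<le> (nat \<lfloor>2 ^ n * t\<rfloor> * (1 / 2 ^ n)) * (1 / 2 ^ n) * (norm (E x))\<^sup>2" for n
      using norm_J_pow_loss [OF _ x, of "1 / 2 ^ n" "nat \<lfloor>2 ^ n * t\<rfloor>"]
      by (simp add: approx_def power2_eq_square)
    then show "\<exists>N. \<forall>n\<ge>N. (norm x)\<^sup>2 - (norm (approx n t x))\<^sup>2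
        \<le> (nat \<lfloor>2 ^ n * t\<rfloor> * (1 / 2 ^ n)) * (1 / 2 ^ n) * (norm (E x))\<^sup>2" by blast
  qed
  then have "norm x \<le> norm (V t x)" by - (rule power2_le_imp_le, auto)
  moreover have "norm (V t x) \<le> norm x"
    by (rule bounded_clinear_strong_limit(2) [OF bounded_clinear_approx norm_approx approx_tendsto [OF t]])
  ultimately show "norm (V t x) = norm x" by simp
qed (use t in \<open>auto intro!: continuous_intros continuous_on_V\<close>)

lemma V_add:
  assumes s: "0 \<le> s" and t: "0 \<le> t"
  shows "V (s + t) x = V s (V t x)"
proof (rule eq_on_closure_UNIV [where f = "V (s + t)" and g = "\<lambda>x. V s (V t x)", OF dense_D])
  fix x assume x: "x \<in> D"
  have "norm (approx n (s + t) x - V s (V t x)) \<le> 2 * (1 / 2 ^ n) * norm (E x)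
     + (norm (approx n t x - V t x) + norm (approx n s (V t x) - V s (V t x)))" for n
  proof -
    interpret S: bounded_linear "approx n s"
      using bounded_clinear_approx by (simp add: bounded_clinear_iff)
    define k l m where "k = nat \<lfloor>2 ^ n * s\<rfloor>" and "l = nat \<lfloor>2 ^ n * t\<rfloor>" and "m = nat \<lfloor>2 ^ n * (s + t)\<rfloor>"
    have "0 \<le> 2 ^ n * (s + t)" "0 \<le> 2 ^ n * s" "0 \<le> 2 ^ n * t" using s t by auto
    then have "real k \<le> 2 ^ n * s" "2 ^ n * s < real k + 1" "real l \<le> 2 ^ n * t" "2 ^ n * t < real l + 1"
      "real m \<le> 2 ^ n * (s + t)" "2 ^ n * (s + t) < real m + 1"
      using s t unfolding k_def l_def m_def by (auto simp: of_nat_nat)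
    \<comment> \<open>Rounding down is not additive, but the step counts differ by at most two, and
      two steps move a vector of \<open>D\<close> by an amount of order 2^-n.\<close>
    then have klm: "\<bar>real m - real (k + l)\<bar> \<le> 2" by (simp add: abs_le_iff distrib_left)
    have "norm (approx n (s + t) x - approx n s (approx n t x))
        \<le> \<bar>real m - real (k + l)\<bar> * (1 / 2 ^ n) * norm (E x)"
      using norm_J_pow_diff [OF _ x, of "1 / 2 ^ n" m "k + l"]
      by (simp add: approx_def k_def l_def m_def funpow_add)
    also have "\<dots> \<le> 2 * (1 / 2 ^ n) * norm (E x)"
      by (intro mult_right_mono klm) auto
    finally have 1: "norm (approx n (s + t) x - approx n s (approx n t x)) \<le> 2 * (1 / 2 ^ n) * norm (E x)" .
    have 2: "norm (approx n s (approx n t x) - approx n s (V t x)) \<le> norm (approx n t x - V t x)"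
      using norm_approx [of n s "approx n t x - V t x"] by (simp add: S.diff)
    have "approx n (s + t) x - V s (V t x) = (approx n (s + t) x - approx n s (approx n t x))
      + ((approx n s (approx n t x) - approx n s (V t x)) + (approx n s (V t x) - V s (V t x)))" by simp
    then have "norm (approx n (s + t) x - V s (V t x)) \<le> norm (approx n (s + t) x - approx n s (approx n t x))
      + (norm (approx n s (approx n t x) - approx n s (V t x)) + norm (approx n s (V t x) - V s (V t x)))"
      by (simp only: order_trans [OF norm_triangle_ineq add_left_mono [OF norm_triangle_ineq]])
    then show ?thesis using 1 2 by linarith
  qed
  then have *: "\<forall>\<^sub>F n in sequentially. norm (approx n (s + t) x - V s (V t x)) \<le> 2 * (1 / 2 ^ n) * norm (E x)
     + (norm (approx n t x - V t x) + norm (approx n s (V t x) - V s (V t x)))"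
    by (simp only: eventually_True)
  have "(\<lambda>n. 2 * (1 / 2 ^ n) * norm (E x)
     + (norm (approx n t x - V t x) + norm (approx n s (V t x) - V s (V t x)))) \<longlonglongrightarrow>
     2 * 0 * norm (E x) + (norm (V t x - V t x) + norm (V s (V t x) - V s (V t x)))"
    by (intro tendsto_intros step_size_tendsto approx_tendsto s t)
  then have "(\<lambda>n. 2 * (1 / 2 ^ n) * norm (E x)
     + (norm (approx n t x - V t x) + norm (approx n s (V t x) - V s (V t x)))) \<longlonglongrightarrow> 0" by simp
  from Lim_null_comparison [OF * this]
  have "(\<lambda>n. approx n (s + t) x) \<longlonglongrightarrow> V s (V t x)" by (simp add: LIM_zero_iff)
  moreover have "(\<lambda>n. approx n (s + t) x) \<longlonglongrightarrow> V (s + t) x"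
    using s t by (intro approx_tendsto) simp
  ultimately show "V (s + t) x = V s (V t x)" by (rule LIMSEQ_unique [rotated])
next
  show "continuous_on UNIV (\<lambda>x. V s (V t x))"
    by (rule continuous_on_compose2 [OF continuous_on_V continuous_on_V]) (use s t in auto)
qed (use s t in \<open>auto intro!: continuous_on_V\<close>)

lemma V_tendsto_0: "((\<lambda>t. V t x) \<longlongrightarrow> x) (at_right 0)"
proof (rule tendstoI)
  fix e :: real assume e: "0 < e"
  obtain d where d: "d \<in> D" "norm (x - d) < e / 3" using approximate_D [of "e/3" x] e by auto
  define p where "p = norm (E d) + 1"
  have p: "0 < p" by (simp add: p_def add_nonneg_pos)
  define \<delta> where "\<delta> = e / 3 / p"
  have \<delta>: "0 < \<delta>" "\<delta> * p = e / 3" using e p by (auto simp: \<delta>_def)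
  have "dist (V t x) x < e" if t: "0 < t" "t < \<delta>" for t
  proof -
    interpret bounded_linear "V t" using bounded_clinear_V t by (simp add: bounded_clinear_iff)
    have "norm (V t d - d) \<le> t * norm (E d)" using V_Lipschitz [OF d(1), of t 0] t by (simp add: V_0)
    also have "\<dots> \<le> \<delta> * p" using t by (intro mult_mono) (auto simp: p_def)
    finally have "norm (V t d - d) \<le> e / 3" using \<delta> by simp
    moreover have "norm (V t (x - d)) = norm (x - d)" using norm_V t by simp
    moreover have "V t x - x = V t (x - d) + ((V t d - d) - (x - d))" by (simp add: diff)
    then have "norm (V t x - x) \<le> norm (V t (x - d)) + (norm (V t d - d) + norm (x - d))"
      by (simp only: order_trans [OF norm_triangle_ineq add_left_mono [OF norm_triangle_ineq4]])
    ultimately show ?thesis using d(2) unfolding dist_norm by linarith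
  qed
  then show "\<forall>\<^sub>F t in at_right 0. dist (V t x) x < e"
    unfolding eventually_at_right_field using \<delta>(1) by blast
qed

lemma J_V: "0 < g \<Longrightarrow> 0 \<le> t \<Longrightarrow> J g (V t x) = V t (J g x)"
proof -
  assume g: "0 < g" and t: "0 \<le> t"
  interpret bounded_linear "J g" using bounded_clinear_J [OF g] by (simp add: bounded_clinear_iff)
  have "(\<lambda>n. J g (approx n t x)) \<longlonglongrightarrow> J g (V t x)" using t by (intro tendsto approx_tendsto)
  moreover have "J g (approx n t x) = approx n t (J g x)" for n
    using g by (simp add: approx_def J_pow_J)
  ultimately show ?thesis using approx_tendsto [OF t, of "J g x"] LIMSEQ_unique by simp
qed

lemma V_taylor:
  assumes "x \<in> D" "E x \<in> D" "0 \<le> t"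
  shows "norm (V t x - x - t *\<^sub>R E x) \<le> t\<^sup>2 * norm (E (E x))"
proof (rule LIMSEQ_le)
  let ?s = "\<lambda>n. nat \<lfloor>2 ^ n * t\<rfloor> * (1 / 2 ^ n) :: real"
  show "(\<lambda>n. norm (approx n t x - x - ?s n *\<^sub>R E x)) \<longlonglongrightarrow> norm (V t x - x - t *\<^sub>R E x)"
    using assms by (intro tendsto_intros steps_tendsto approx_tendsto)
  show "(\<lambda>n. (?s n)\<^sup>2 * norm (E (E x))) \<longlonglongrightarrow> t\<^sup>2 * norm (E (E x))"
    using assms by (intro tendsto_intros steps_tendsto)
  have "norm (approx n t x - x - ?s n *\<^sub>R E x) \<le> (?s n)\<^sup>2 * norm (E (E x))" for n
    unfolding approx_def by (rule norm_J_pow_taylor) (use assms in auto)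
  then show "\<exists>N. \<forall>n\<ge>N. norm (approx n t x - x - ?s n *\<^sub>R E x) \<le> (?s n)\<^sup>2 * norm (E (E x))" by blast
qed

section \<open>The generator of the limit semigroup\<close>

lemma V_derivative:
  assumes x: "x \<in> D"
  shows "((\<lambda>t. (1 / t) *\<^sub>R (V t x - x)) \<longlongrightarrow> E x) (at_right 0)"
proof (rule tendstoI)
  fix e :: real assume e: "0 < e"
  obtain d where d: "d \<in> D" "E d \<in> D" "norm (E x - E d) < e / 3"
    using approximate_D2 [OF x, of "e/3"] e by auto
  define p where "p = norm (E (E d)) + 1"
  have p: "0 < p" by (simp add: p_def add_nonneg_pos)
  define \<delta> where "\<delta> = e / 3 / p"
  have \<delta>: "0 < \<delta>" "\<delta> * p = e / 3" using e p by (auto simp: \<delta>_def)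
  have "dist ((1 / t) *\<^sub>R (V t x - x)) (E x) < e" if t: "0 < t" "t < \<delta>" for t
  proof -
    interpret bounded_linear "V t" using bounded_clinear_V t by (simp add: bounded_clinear_iff)
    \<comment> \<open>The Lipschitz bound controls the remainder \<open>x - d\<close> uniformly in
      \<open>t\<close>, because \<open>d\<close> is close to \<open>x\<close> in the graph norm; the
      Taylor bound takes care of \<open>d\<close>.\<close>
    have "norm (V t (x - d) - (x - d)) \<le> t * norm (E (x - d))"
      using V_Lipschitz [OF D_diff [OF x d(1)], of t 0] t by (simp add: V_0)
    then have "norm ((1 / t) *\<^sub>R (V t (x - d) - (x - d))) \<le> norm (E x - E d)"
      using t d(1) x by (simp add: E_diff pos_divide_le_eq mult.commute)
    then have 1: "norm ((1 / t) *\<^sub>R (V t (x - d) - (x - d))) < e / 3" using d(3) by linarith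
    have "norm ((1 / t) *\<^sub>R (V t d - d - t *\<^sub>R E d)) = norm (V t d - d - t *\<^sub>R E d) / t"
      using t by (subst norm_scaleR) simp
    also have "\<dots> \<le> t\<^sup>2 * norm (E (E d)) / t"
      using t by (intro divide_right_mono V_taylor d) auto
    also have "\<dots> = t * norm (E (E d))" by (simp add: power2_eq_square)
    also have "\<dots> \<le> \<delta> * p" using t by (intro mult_mono) (auto simp: p_def)
    finally have 2: "norm ((1 / t) *\<^sub>R (V t d - d - t *\<^sub>R E d)) \<le> e / 3" using \<delta> by simp
    have "(1 / t) *\<^sub>R (V t x - x) - E x = (1 / t) *\<^sub>R (V t (x - d) - (x - d))
      + ((1 / t) *\<^sub>R (V t d - d - t *\<^sub>R E d) - (E x - E d))"
      using t by (simp add: diff algebra_simps)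
    then have "norm ((1 / t) *\<^sub>R (V t x - x) - E x) \<le> norm ((1 / t) *\<^sub>R (V t (x - d) - (x - d)))
      + (norm ((1 / t) *\<^sub>R (V t d - d - t *\<^sub>R E d)) + norm (E x - E d))"
      by (simp only: order_trans [OF norm_triangle_ineq add_left_mono [OF norm_triangle_ineq4]])
    then show ?thesis using 1 2 d(3) unfolding dist_norm by linarith
  qed
  then show "\<forall>\<^sub>F t in at_right 0. dist ((1 / t) *\<^sub>R (V t x - x)) (E x) < e"
    unfolding eventually_at_right_field using \<delta>(1) by blast
qed

theorem generates_V: "generates D E V"
  unfolding generates_def
proof (intro conjI ballI)
  show "C0_semigroup V"
    unfolding C0_semigroup_def
    using bounded_clinear_V V_add V_tendsto_0 by (auto simp: V_0 fun_eq_iff)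
  show "E x = generator V x" if "x \<in> D" for x
    unfolding generator_def by (rule tendsto_Lim [symmetric, OF _ V_derivative [OF that]]) simp
  show "D = generator_domain V"
  proof (intro equalityI subsetI)
    fix x assume "x \<in> D"
    then show "x \<in> generator_domain V" unfolding generator_domain_def using V_derivative by blast
  next
    fix w assume "w \<in> generator_domain V"
    then obtain y where y: "((\<lambda>t. (1 / t) *\<^sub>R (V t w - w)) \<longlongrightarrow> y) (at_right 0)"
      unfolding generator_domain_def by blast
    interpret J1: bounded_linear "J 1" using bounded_clinear_J [of 1] by (simp add: bounded_clinear_iff)
    \<comment> \<open>The generator might extend \<open>E\<close> properly. To exclude this,
      \<open>J 1\<close>, which commutes with the semigroup, brings \<open>w\<close> into
      \<open>D\<close>, where the derivative is already known; comparing both derivatives puts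
      \<open>w\<close> into the range of \<open>J 1\<close>.\<close>
    have "((\<lambda>t. J 1 ((1 / t) *\<^sub>R (V t w - w))) \<longlongrightarrow> J 1 y) (at_right 0)"
      by (rule J1.tendsto [OF y])
    moreover have "\<forall>\<^sub>F t in at_right 0. J 1 ((1 / t) *\<^sub>R (V t w - w)) = (1 / t) *\<^sub>R (V t (J 1 w) - J 1 w)"
      unfolding eventually_at_right_field
      by (intro exI [of _ 1]) (auto simp: J1.scaleR J1.diff J_V)
    ultimately have "((\<lambda>t. (1 / t) *\<^sub>R (V t (J 1 w) - J 1 w)) \<longlongrightarrow> J 1 y) (at_right 0)"
      by (rule Lim_transform_eventually)
    then have "J 1 y = E (J 1 w)"
      by (rule tendsto_unique [rotated]) (simp_all add: V_derivative J)
    then have "w = J 1 (w - y)" using J(2) [of 1 w] by (simp add: J1.diff algebra_simps)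
    then show "w \<in> D" using J(1) [of 1 "w - y"] by simp
  qed
qed

end

section \<open>Total mass of a positive Laplace transform along a vertical line\<close>

text \<open>The characteristic function of the standard normal distribution, freed from the
  normalising factor.\<close>

lemma cis_Gaussian_integral:
  "integrable lborel (\<lambda>\<eta>. exp (- \<eta>\<^sup>2 / 2) *\<^sub>R cis (\<eta> * s))"
  "(\<integral>\<eta>. exp (- \<eta>\<^sup>2 / 2) *\<^sub>R cis (\<eta> * s) \<partial>lborel) = complex_of_real (sqrt (2 * pi) * exp (- s\<^sup>2 / 2))"
proof -
  have eq: "exp (- \<eta>\<^sup>2 / 2) *\<^sub>R cis (\<eta> * s) = sqrt (2 * pi) *\<^sub>R (std_normal_density \<eta> *\<^sub>R iexp (s * \<eta>))" for \<eta>
    by (simp add: std_normal_density_def cis_conv_exp mult.commute)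
  have int: "integrable lborel (\<lambda>\<eta>. std_normal_density \<eta> *\<^sub>R iexp (s * \<eta>))"
    by (rule Bochner_Integration.integrable_bound [OF integrable_std_normal_moment [of 0]]) auto
  then show "integrable lborel (\<lambda>\<eta>. exp (- \<eta>\<^sup>2 / 2) *\<^sub>R cis (\<eta> * s))"
    unfolding eq by (rule integrable_scaleR_right)
  have "(\<integral>\<eta>. std_normal_density \<eta> *\<^sub>R iexp (s * \<eta>) \<partial>lborel) = char std_normal_distribution s"
    unfolding char_def by (rule integral_density [symmetric]) (auto simp: normal_density_nonneg)
  then show "(\<integral>\<eta>. exp (- \<eta>\<^sup>2 / 2) *\<^sub>R cis (\<eta> * s) \<partial>lborel) = complex_of_real (sqrt (2 * pi) * exp (- s\<^sup>2 / 2))"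
    unfolding eq using int by (simp add: char_std_normal_distribution scaleR_conv_of_real)
qed

lemma integrable_exp_half_line:
  fixes a :: real
  assumes "a > 0"
  shows "integrable lborel (\<lambda>s. indicator {0..} s * exp (- a * s) :: real)"
proof -
  have "(\<lambda>s. indicator {0..} (0 + a * s) * exp (- (0 + a * s)) :: real) = (\<lambda>s. indicator {0..} s * exp (- a * s))"
    using assms by (auto simp: fun_eq_iff indicator_def zero_le_mult_iff)
  moreover have "integrable lborel (\<lambda>s. indicator {0..} s * exp (- s) :: real)"
    using has_bochner_integral_I0i_power_exp_m' [of 0] by (simp add: has_bochner_integral_iff mult.commute)
  ultimately show ?thesis
    using lborel_integrable_real_affine_iff [of a "\<lambda>s. indicator {0..} s * exp (- s) :: real" 0] assms by simp
qed

lemma half_Gaussian_integral: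
  "integrable lborel (\<lambda>s. indicator {0..} s * exp (- s\<^sup>2 / 2) :: real)"
  "(\<integral>s. indicator {0..} s * exp (- s\<^sup>2 / 2) \<partial>lborel) = sqrt 2 * (sqrt pi / 2)"
proof -
  have sqrt2: "sqrt 2 \<noteq> 0" by simp
  have sc: "(\<lambda>u. indicator {0..} (0 + sqrt 2 * u) * exp (- (0 + sqrt 2 * u)\<^sup>2 / 2) :: real)
      = (\<lambda>u. indicator {0..} u *\<^sub>R exp (- u\<^sup>2))"
    by (auto simp: fun_eq_iff indicator_def power_mult_distrib zero_le_mult_iff)
  show "integrable lborel (\<lambda>s. indicator {0..} s * exp (- s\<^sup>2 / 2) :: real)"
    using lborel_integrable_real_affine_iff [of "sqrt 2" "\<lambda>s. indicator {0..} s * exp (- s\<^sup>2 / 2) :: real" 0]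
      gaussian_moment_0 unfolding sc by (simp add: has_bochner_integral_iff)
  show "(\<integral>s. indicator {0..} s * exp (- s\<^sup>2 / 2) \<partial>lborel) = sqrt 2 * (sqrt pi / 2)"
    using gaussian_moment_0 unfolding has_bochner_integral_iff
      lborel_integral_real_affine [of "sqrt 2" "\<lambda>s. indicator {0..} s * exp (- s\<^sup>2 / 2) :: real" 0, OF sqrt2] sc
    by simp
qed

text \<open>Testing against the Gaussian \<open>exp (- (\<xi>/N)\<^sup>2 / 2)\<close> and substituting \<open>\<xi> = N \<eta>\<close>, \<open>t = s/N\<close>
  turns the double integral into one whose integrand is dominated uniformly in \<open>N\<close>.\<close>

lemma Laplace_Gaussian_limit:
  fixes c :: "real \<Rightarrow> complex" and \<epsilon> K :: real
  assumes c: "continuous_on UNIV c" and K: "\<And>t. cmod (c t) \<le> K" and \<epsilon>: "\<epsilon> > 0"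
  defines "\<phi> \<equiv> \<lambda>\<xi>. \<integral>t. indicator {0..} t * (exp (- \<epsilon> * t) * Re (cis (\<xi> * t) * c t)) \<partial>lborel"
  defines "N \<equiv> \<lambda>n. real (Suc n)"
  shows "integrable lborel (\<lambda>\<xi>. exp (- (\<xi> / N n)\<^sup>2 / 2) * \<phi> \<xi>)"
    and "(\<lambda>n. \<integral>\<xi>. exp (- (\<xi> / N n)\<^sup>2 / 2) * \<phi> \<xi> \<partial>lborel) \<longlonglongrightarrow> pi * Re (c 0)"
proof -
  have K0: "0 \<le> K" using K [of 0] norm_ge_zero order_trans by blast
  have [measurable]: "c \<in> borel_measurable borel" using c by (rule borel_measurable_continuous_onI)
  have [measurable]: "cis \<in> borel_measurable borel" 
    by (intro borel_measurable_continuous_onI continuous_intros)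
  have N: "N n > 0" for n by (simp add: N_def)
  \<comment> \<open>After both substitutions the damping and \<open>c\<close> see only
    \<open>s / N n\<close>, which tends to 0: in the limit only \<open>c 0\<close> survives, and
    \<epsilon> drops out.\<close>
  define g where "g n s \<eta> = indicator {0..} s * exp (- \<epsilon> * (s / N n)) * Re (cis (\<eta> * s) * c (s / N n))
      * exp (- \<eta>\<^sup>2 / 2)" for n s \<eta>
  have scale: "exp (- (N n * \<eta> / N n)\<^sup>2 / 2) * \<phi> (N n * \<eta>) = (1 / N n) * (\<integral>s. g n s \<eta> \<partial>lborel)" for n \<eta>
  proof -
    have "\<phi> (N n * \<eta>) = (1 / N n) * (\<integral>s. indicator {0..} s * exp (- \<epsilon> * (s / N n)) * Re (cis (\<eta> * s) * c (s / N n)) \<partial>lborel)"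
      unfolding \<phi>_def using N [of n]
      by (subst lborel_integral_real_affine [of "1 / N n" _ 0])
         (auto intro!: Bochner_Integration.integral_cong simp: indicator_def zero_le_divide_iff)
    then show ?thesis unfolding g_def integral_mult_left_zero using N [of n] by simp
  qed
  have exp_int: "integrable lborel (\<lambda>s. indicator {0..} s * exp (- a * s) :: real)" if "a > 0" for a
    using that by (rule integrable_exp_half_line)
  have g_meas [measurable]: "(\<lambda>(s, \<eta>). g n s \<eta>) \<in> borel_measurable (lborel \<Otimes>\<^sub>M lborel)" for n
    unfolding g_def by measurable
  have g_int: "integrable (lborel \<Otimes>\<^sub>M lborel) (\<lambda>(s, \<eta>). g n s \<eta>)" for n
  proof (rule Bochner_Integration.integrable_bound)
    \<comment> \<open>This majorant spreads out as \<open>n\<close> grows; it serves Fubini at a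
      fixed \<open>n\<close>, not the passage to the limit.\<close>
    have 1: "integrable lborel (\<lambda>s. K * (indicator {0..} s * exp (- (\<epsilon> / N n) * s)) :: real)"
      using exp_int [of "\<epsilon> / N n"] \<epsilon> N [of n] by simp
    have 2: "integrable lborel (\<lambda>\<eta>. exp (- \<eta>\<^sup>2 / 2) :: real)"
      using integrable_norm [OF cis_Gaussian_integral(1) [of 0]] by simp
    define p :: "real \<Rightarrow> real \<Rightarrow> real" where
      "p s \<eta> = K * (indicator {0..} s * exp (- (\<epsilon> / N n) * s)) * exp (- \<eta>\<^sup>2 / 2)" for s \<eta>
    show "integrable (lborel \<Otimes>\<^sub>M lborel) (\<lambda>(s, \<eta>). p s \<eta>)"
    proof (rule lborel_pair.Fubini_integrable)
      show "integrable lborel (\<lambda>s. \<integral>\<eta>. norm ((\<lambda>(s, \<eta>). p s \<eta>) (s, \<eta>)) \<partial>lborel)"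
        using K0 1 by (simp add: p_def abs_mult)
    qed (use 2 in \<open>auto simp: p_def\<close>)
    show "AE x in lborel \<Otimes>\<^sub>M lborel. norm (case x of (s, \<eta>) \<Rightarrow> g n s \<eta>)
      \<le> norm (case x of (s, \<eta>) \<Rightarrow> p s \<eta>)"
    proof (rule AE_I2, clarify)
      fix s \<eta> :: real
      have "\<bar>Re (cis (\<eta> * s) * c (s / N n))\<bar> \<le> K"
        by (rule order_trans [OF abs_Re_le_cmod]) (simp add: norm_mult K)
      then show "norm (g n s \<eta>) \<le> norm (p s \<eta>)"
        using K0 by (auto simp: g_def p_def abs_mult indicator_def intro!: mult_right_mono)
    qed
  qed simp
  have "integrable lborel (\<lambda>\<eta>. \<integral>s. g n s \<eta> \<partial>lborel)" for n
    using lborel_pair.integrable_snd [OF g_int] .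
  then have "integrable lborel (\<lambda>\<eta>. exp (- (N n * \<eta> / N n)\<^sup>2 / 2) * \<phi> (N n * \<eta>))"
    unfolding scale by (rule integrable_mult_right)
  then show "integrable lborel (\<lambda>\<xi>. exp (- (\<xi> / N n)\<^sup>2 / 2) * \<phi> \<xi>)"
    using lborel_integrable_real_affine_iff [of "N n" "\<lambda>\<xi>. exp (- (\<xi> / N n)\<^sup>2 / 2) * \<phi> \<xi>" 0] N [of n] by simp
  \<comment> \<open>Integrating over the frequency first replaces the oscillation by a Gaussian in
    \<open>s\<close>, and that Gaussian gives the majorant uniform in \<open>n\<close>.\<close>
  have inner: "(\<integral>\<eta>. g n s \<eta> \<partial>lborel)
      = indicator {0..} s * exp (- \<epsilon> * (s / N n)) * (sqrt (2 * pi) * exp (- s\<^sup>2 / 2) * Re (c (s / N n)))" for n s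
  proof -
    have int: "integrable lborel (\<lambda>\<eta>. (exp (- \<eta>\<^sup>2 / 2) *\<^sub>R cis (\<eta> * s)) * c (s / N n))"
      by (intro integrable_mult_left cis_Gaussian_integral)
    have "(\<integral>\<eta>. exp (- \<eta>\<^sup>2 / 2) * Re (cis (\<eta> * s) * c (s / N n)) \<partial>lborel)
      = (\<integral>\<eta>. Re ((exp (- \<eta>\<^sup>2 / 2) *\<^sub>R cis (\<eta> * s)) * c (s / N n)) \<partial>lborel)"
      by (simp only: mult_scaleR_left scaleR_complex.sel)
    also have "\<dots> = Re (\<integral>\<eta>. (exp (- \<eta>\<^sup>2 / 2) *\<^sub>R cis (\<eta> * s)) * c (s / N n) \<partial>lborel)"
      by (rule integral_Re [OF int])
    also have "\<dots> = sqrt (2 * pi) * exp (- s\<^sup>2 / 2) * Re (c (s / N n))"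
      unfolding integral_mult_left_zero cis_Gaussian_integral(2) by simp
    finally show ?thesis
      by (simp add: g_def mult.assoc) (simp add: mult.commute)
  qed
  have "(\<integral>\<xi>. exp (- (\<xi> / N n)\<^sup>2 / 2) * \<phi> \<xi> \<partial>lborel) = (\<integral>s. \<integral>\<eta>. g n s \<eta> \<partial>lborel \<partial>lborel)" for n
  proof -
    have "(\<integral>\<xi>. exp (- (\<xi> / N n)\<^sup>2 / 2) * \<phi> \<xi> \<partial>lborel)
        = N n * (\<integral>\<eta>. exp (- (N n * \<eta> / N n)\<^sup>2 / 2) * \<phi> (N n * \<eta>) \<partial>lborel)"
      using N [of n] by (subst lborel_integral_real_affine [of "N n" _ 0]) auto
    also have "\<dots> = (\<integral>\<eta>. \<integral>s. g n s \<eta> \<partial>lborel \<partial>lborel)" unfolding scale using N [of n] by simp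
    also have "\<dots> = (\<integral>s. \<integral>\<eta>. g n s \<eta> \<partial>lborel \<partial>lborel)"
      by (rule lborel_pair.Fubini_integral [OF g_int])
    finally show ?thesis .
  qed
  moreover have "(\<lambda>n. \<integral>s. \<integral>\<eta>. g n s \<eta> \<partial>lborel \<partial>lborel) \<longlonglongrightarrow>
      (\<integral>s. indicator {0..} s * exp (- \<epsilon> * 0) * (sqrt (2 * pi) * exp (- s\<^sup>2 / 2) * Re (c 0)) \<partial>lborel)"
  proof (rule integral_dominated_convergence)
    show "integrable lborel (\<lambda>s. sqrt (2 * pi) * K * (indicator {0..} s * exp (- s\<^sup>2 / 2)))"
      by (intro integrable_mult_right half_Gaussian_integral)
    have sN: "(\<lambda>n. s / N n) \<longlonglongrightarrow> 0" for s
      using tendsto_mult_right_zero [OF LIMSEQ_inverse_real_of_nat, of s] by (simp add: N_def divide_inverse)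
    have "(\<lambda>n. c (s / N n)) \<longlonglongrightarrow> c 0" for s
      using continuous_on_tendsto_compose [OF c sN] by simp
    then show "AE s in lborel. (\<lambda>n. \<integral>\<eta>. g n s \<eta> \<partial>lborel) \<longlonglongrightarrow>
        indicator {0..} s * exp (- \<epsilon> * 0) * (sqrt (2 * pi) * exp (- s\<^sup>2 / 2) * Re (c 0))"
      unfolding inner by (intro AE_I2 tendsto_mult tendsto_const tendsto_exp tendsto_Re sN)
    show "AE s in lborel. norm (\<integral>\<eta>. g n s \<eta> \<partial>lborel) \<le> sqrt (2 * pi) * K * (indicator {0..} s * exp (- s\<^sup>2 / 2))" for n
    proof (rule AE_I2)
      fix s
      have 1: "\<bar>Re (c (s / N n))\<bar> \<le> K" by (rule order_trans [OF abs_Re_le_cmod K])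
      have 2: "exp (- \<epsilon> * (s / N n)) \<le> 1" if "0 \<le> s" using that \<epsilon> N [of n] by simp
      show "norm (\<integral>\<eta>. g n s \<eta> \<partial>lborel) \<le> sqrt (2 * pi) * K * (indicator {0..} s * exp (- s\<^sup>2 / 2))"
      proof (cases "0 \<le> s")
        case True
        have "exp (- \<epsilon> * (s / N n)) * (sqrt (2 * pi) * exp (- s\<^sup>2 / 2) * \<bar>Re (c (s / N n))\<bar>)
          \<le> 1 * (sqrt (2 * pi) * exp (- s\<^sup>2 / 2) * K)"
          using True 1 2 by (intro mult_mono mult_left_mono) auto
        with True show ?thesis unfolding inner by (simp add: abs_mult mult_ac)
      qed (simp add: inner)
    qed
  qed (simp_all add: inner)
  \<comment> \<open>The transform is one-sided, so only half of the Gaussian mass enters: sqrt (2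
    pi) times sqrt (2 pi) / 2 is pi.\<close>
  moreover have "(\<integral>s. indicator {0..} s * exp (- \<epsilon> * 0) * (sqrt (2 * pi) * exp (- s\<^sup>2 / 2) * Re (c 0)) \<partial>lborel) = pi * Re (c 0)"
  proof -
    have "(\<integral>s. indicator {0..} s * exp (- \<epsilon> * 0) * (sqrt (2 * pi) * exp (- s\<^sup>2 / 2) * Re (c 0)) \<partial>lborel)
       = (\<integral>s. sqrt (2 * pi) * Re (c 0) * (indicator {0..} s * exp (- s\<^sup>2 / 2)) \<partial>lborel)"
      by (intro Bochner_Integration.integral_cong) auto
    also have "\<dots> = sqrt (2 * pi) * Re (c 0) * (sqrt 2 * (sqrt pi / 2))"
      using half_Gaussian_integral by simp
    also have "sqrt 2 * (sqrt pi / 2) = sqrt (2 * pi) / 2" by (simp only: real_sqrt_mult times_divide_eq_right)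
    also have "sqrt (2 * pi) * Re (c 0) * (sqrt (2 * pi) / 2) = (sqrt (2 * pi) * sqrt (2 * pi)) / 2 * Re (c 0)"
      by (simp only: mult_ac times_divide_eq_right times_divide_eq_left)
    also have "\<dots> = pi * Re (c 0)" by simp
    finally show ?thesis .
  qed
  ultimately show "(\<lambda>n. \<integral>\<xi>. exp (- (\<xi> / N n)\<^sup>2 / 2) * \<phi> \<xi> \<partial>lborel) \<longlonglongrightarrow> pi * Re (c 0)" by simp
qed

text \<open>The Gaussian weights increase to one, so nonnegativity allows monotone convergence. The
  mass is found although integrability of \<open>\<phi>\<close> is not known beforehand and the
  unweighted double integral need not converge absolutely.\<close>

lemma nn_integral_positive_Laplace:
  fixes c :: "real \<Rightarrow> complex" and \<epsilon> K :: real
  assumes c: "continuous_on UNIV c" and K: "\<And>t. cmod (c t) \<le> K" and \<epsilon>: "\<epsilon> > 0"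
  defines "\<phi> \<equiv> \<lambda>\<xi>. \<integral>t. indicator {0..} t * (exp (- \<epsilon> * t) * Re (cis (\<xi> * t) * c t)) \<partial>lborel"
  assumes nonneg: "\<And>\<xi>. 0 \<le> \<phi> \<xi>"
  shows "\<phi> \<in> borel_measurable borel" "(\<integral>\<^sup>+\<xi>. ennreal (\<phi> \<xi>) \<partial>lborel) = ennreal (pi * Re (c 0))"
proof -
  have [measurable]: "c \<in> borel_measurable borel" using c by (rule borel_measurable_continuous_onI)
  have [measurable]: "cis \<in> borel_measurable borel" 
    by (intro borel_measurable_continuous_onI continuous_intros)
  show \<phi>_meas [measurable]: "\<phi> \<in> borel_measurable borel"
    unfolding \<phi>_def by measurable
  define w where "w n \<xi> = exp (- (\<xi> / real (Suc n))\<^sup>2 / 2)" for n \<xi>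
  have lim: "integrable lborel (\<lambda>\<xi>. w n \<xi> * \<phi> \<xi>)"
     "(\<lambda>n. \<integral>\<xi>. w n \<xi> * \<phi> \<xi> \<partial>lborel) \<longlonglongrightarrow> pi * Re (c 0)" for n
    unfolding w_def \<phi>_def by (rule Laplace_Gaussian_limit [OF c K \<epsilon>])+
  have [measurable]: "w n \<in> borel_measurable borel" for n unfolding w_def by measurable
  have mono: "w m \<xi> \<le> w n \<xi>" if "m \<le> n" for m n \<xi>
  proof -
    have "\<xi>\<^sup>2 / (real (Suc n))\<^sup>2 \<le> \<xi>\<^sup>2 / (real (Suc m))\<^sup>2"
      using that by (intro divide_left_mono power_mono mult_pos_pos zero_less_power) auto
    then show ?thesis by (simp add: w_def power_divide del: of_nat_Suc)
  qed
  have "(\<lambda>n. \<integral>\<^sup>+\<xi>. ennreal (w n \<xi> * \<phi> \<xi>) \<partial>lborel) \<longlonglongrightarrow> (\<integral>\<^sup>+\<xi>. ennreal (\<phi> \<xi>) \<partial>lborel)"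
  proof (rule nn_integral_LIMSEQ)
    show "incseq (\<lambda>n \<xi>. ennreal (w n \<xi> * \<phi> \<xi>))"
      using mono nonneg by (auto simp: incseq_def le_fun_def intro!: ennreal_leI mult_right_mono)
    fix \<xi>
    have "(\<lambda>n. \<xi> * inverse (real (Suc n))) \<longlonglongrightarrow> 0"
      by (rule tendsto_mult_right_zero [OF LIMSEQ_inverse_real_of_nat])
    then have "(\<lambda>n. w n \<xi> * \<phi> \<xi>) \<longlonglongrightarrow> exp (- 0\<^sup>2 / 2) * \<phi> \<xi>"
      unfolding w_def divide_inverse [of \<xi>] by (intro tendsto_intros) simp_all
    also have "exp (- 0\<^sup>2 / 2) * \<phi> \<xi> = \<phi> \<xi>" by simp
    finally show "(\<lambda>n. ennreal (w n \<xi> * \<phi> \<xi>)) \<longlonglongrightarrow> ennreal (\<phi> \<xi>)" by (rule tendsto_ennrealI)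
  qed simp
  moreover have "(\<integral>\<^sup>+\<xi>. ennreal (w n \<xi> * \<phi> \<xi>) \<partial>lborel) = ennreal (\<integral>\<xi>. w n \<xi> * \<phi> \<xi> \<partial>lborel)" for n
    using lim(1) [of n] nonneg by (intro nn_integral_eq_integral) (auto simp: w_def)
  moreover have "(\<lambda>n. ennreal (\<integral>\<xi>. w n \<xi> * \<phi> \<xi> \<partial>lborel)) \<longlonglongrightarrow> ennreal (pi * Re (c 0))"
    using lim(2) by (intro tendsto_ennrealI) simp
  ultimately show "(\<integral>\<^sup>+\<xi>. ennreal (\<phi> \<xi>) \<partial>lborel) = ennreal (pi * Re (c 0))"
    using LIMSEQ_unique by simp
qed

section \<open>Resolvents\<close>

text \<open>Real Cauchy-Schwarz for \<open>v\<close> and for its multiple by \<i>; the factor two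
  from adding real and imaginary part is harmless, as only boundedness matters.\<close>

lemma cinner_bound: "cmod (cinner v h) \<le> norm v * (2 * norm (h::'a::complex_hilbert))"
proof -
  have "Im (cinner v h) = rinner (scaleC \<i> v) h"
    by (simp add: rinner_def cinner_scaleC_left)
  then have "\<bar>Im (cinner v h)\<bar> \<le> norm v * norm h"
    using Cauchy_Schwarz_rinner [of "scaleC \<i> v" h] by simp
  then show ?thesis
    using cmod_le [of "cinner v h"] Cauchy_Schwarz_rinner [of v h] by (simp add: rinner_def)
qed

lemma bounded_linear_cinner_left: "bounded_linear (\<lambda>v. cinner v (h::'a::complex_hilbert))"
proof (rule bounded_linear_intro)
  show "cinner (r *\<^sub>R v) h = r *\<^sub>R cinner v h" for r and v :: 'a
    by (simp add: scaleR_scaleC [of r v] cinner_scaleC_left scaleR_conv_of_real)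
qed (rule cinner_add_left cinner_bound)+

lemma resolvent_set_resolvent:
  assumes z: "z \<in> resolvent_set D E"
  shows "resolvent D E z y \<in> D" "scaleC z (resolvent D E z y) - E (resolvent D E z y) = y"
    and "x \<in> D \<Longrightarrow> resolvent D E z (scaleC z x - E x) = x"
    and "bounded_clinear (resolvent D E z)"
proof -
  obtain R where R: "bounded_clinear R" "\<And>y. R y \<in> D" "\<And>y. scaleC z (R y) - E (R y) = y"
      "\<And>x. x \<in> D \<Longrightarrow> R (scaleC z x - E x) = x"
    using z unfolding resolvent_set_def by blast
  have "resolvent D E z y = R y" for y
    unfolding resolvent_def by (rule the_equality) (use R in auto)
  then have "resolvent D E z = R" by blast
  with R show "resolvent D E z y \<in> D" "scaleC z (resolvent D E z y) - E (resolvent D E z y) = y"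
    "x \<in> D \<Longrightarrow> resolvent D E z (scaleC z x - E x) = x" "bounded_clinear (resolvent D E z)" by auto
qed

lemma resolvent_setI:
  assumes lin: "linear_operator D E"
    and surj: "\<And>y. \<exists>x\<in>D. scaleC z x - E x = y"
    and c: "0 < c" and lower: "\<And>x. x \<in> D \<Longrightarrow> c * norm x \<le> norm (scaleC z x - E x)"
  shows "z \<in> resolvent_set D E"
proof -
  obtain R where R: "\<And>y. R y \<in> D" "\<And>y. scaleC z (R y) - E (R y) = y" using surj by metis
  have D_add: "x + y \<in> D" "E (x + y) = E x + E y" if "x \<in> D" "y \<in> D" for x y
    using lin that by (auto simp: linear_operator_def csubspace_def)
  have D_scaleC: "scaleC a x \<in> D" "E (scaleC a x) = scaleC a (E x)" if "x \<in> D" for a x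
    using lin that by (auto simp: linear_operator_def csubspace_def)
  have inj: "x = y" if "x \<in> D" "y \<in> D" "scaleC z x - E x = scaleC z y - E y" for x y
  proof -
    have m: "scaleC (-1) y = - y" by (simp add: scaleC.minus_left scaleC_one)
    have "x + scaleC (-1) y \<in> D" using that by (simp add: D_add D_scaleC)
    moreover have "scaleC z (x + scaleC (-1) y) - E (x + scaleC (-1) y) = 0"
      using that by (simp add: D_add D_scaleC scaleC.add_right scaleC_scaleC)
        (simp add: scaleC.minus_left scaleC_one algebra_simps)
    ultimately have "c * norm (x + scaleC (-1) y) \<le> 0" using lower by (metis norm_zero)
    then show ?thesis using c by (simp add: m mult_le_0_iff)
  qed
  have "R (x + y) = R x + R y" for x y
    by (rule inj) (simp_all add: R D_add scaleC.add_right add_diff_add)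
  moreover have "R (scaleC a x) = scaleC a (R x)" for a x
  proof (rule inj)
    have "scaleC z (scaleC a (R x)) = scaleC a (scaleC z (R x))"
      by (simp only: scaleC_scaleC mult.commute)
    then show "scaleC z (R (scaleC a x)) - E (R (scaleC a x)) = scaleC z (scaleC a (R x)) - E (scaleC a (R x))"
      by (simp add: R D_scaleC scaleC.diff_right [symmetric])
  qed (simp_all add: R D_scaleC)
  moreover have "norm (R x) \<le> norm x * inverse c" for x
    using lower [OF R(1), of x] c by (simp add: R field_simps)
  ultimately have "bounded_clinear R" unfolding bounded_clinear_def clinear_def by blast
  moreover have "R (scaleC z x - E x) = x" if "x \<in> D" for x
    by (rule inj) (simp_all add: R that)
  ultimately show ?thesis unfolding resolvent_set_def using R by blast
qed

section \<open>The resolvent of the generator of an isometric semigroup\<close>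

locale isometric_semigroup =
  fixes D :: "'a::complex_hilbert set" and E :: "'a \<Rightarrow> 'a" and V :: "real \<Rightarrow> 'a \<Rightarrow> 'a"
  assumes linear: "linear_operator D E" and generates: "generates D E V"
    and isometric: "0 \<le> t \<Longrightarrow> norm (V t x) = norm x"
begin

lemma bounded_clinear_V: "0 \<le> t \<Longrightarrow> bounded_clinear (V t)"
  and V_0: "V 0 x = x"
  and V_add: "0 \<le> s \<Longrightarrow> 0 \<le> t \<Longrightarrow> V (s + t) x = V s (V t x)"
  and V_tendsto_0: "((\<lambda>t. V t x) \<longlongrightarrow> x) (at_right 0)"
  using generates by (auto simp: generates_def C0_semigroup_def)

lemma generator_eqI:
  assumes "((\<lambda>t. (1 / t) *\<^sub>R (V t x - x)) \<longlongrightarrow> y) (at_right 0)"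
  shows "x \<in> D" "E x = y"
proof -
  show "x \<in> D" using assms generates by (auto simp: generates_def generator_domain_def)
  then have "E x = generator V x" using generates by (simp add: generates_def)
  then show "E x = y" unfolding generator_def using tendsto_Lim [OF _ assms] by simp
qed

lemma generator_tendsto:
  assumes "x \<in> D"
  shows "((\<lambda>t. (1 / t) *\<^sub>R (V t x - x)) \<longlongrightarrow> E x) (at_right 0)"
proof -
  obtain y where y: "((\<lambda>t. (1 / t) *\<^sub>R (V t x - x)) \<longlongrightarrow> y) (at_right 0)"
    using assms generates by (auto simp: generates_def generator_domain_def)
  with generator_eqI(2) [OF y] show ?thesis by simp
qed

text \<open>The squared norm is constant along the orbit. Expanding it in the difference quotient
  and dividing by \<open>t\<close> gives an exact identity whose limit from the right is the
  claim.\<close>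

lemma skew: 
  assumes "x \<in> D"
  shows "rinner (E x) x = 0"
proof -
  define d where "d t = (1 / t) *\<^sub>R (V t x - x)" for t
  have d: "(d \<longlongrightarrow> E x) (at_right 0)" unfolding d_def by (rule generator_tendsto [OF assms])
  have "2 * rinner x (d t) + t * (norm (d t))\<^sup>2 = 0" if "0 < t" for t
  proof -
    have "V t x = x + t *\<^sub>R d t" using that by (simp add: d_def)
    then have "(norm x)\<^sup>2 = (norm (x + t *\<^sub>R d t))\<^sup>2" using isometric [of t x] that by simp
    then have "t * (2 * rinner x (d t) + t * (norm (d t))\<^sup>2) = 0"
      by (simp add: norm_add_sq rinner.scaleR_right power_mult_distrib power2_eq_square [of t] algebra_simps)
    then show ?thesis using that by simp
  qed
  then have "\<forall>\<^sub>F t in at_right 0. 2 * rinner x (d t) + t * (norm (d t))\<^sup>2 = 0"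
    unfolding eventually_at_right_field by (intro exI [of _ 1]) simp
  then have "((\<lambda>t. 2 * rinner x (d t) + t * (norm (d t))\<^sup>2) \<longlongrightarrow> 0) (at_right 0)"
    by (rule tendsto_eventually)
  moreover have "((\<lambda>t. 2 * rinner x (d t) + t * (norm (d t))\<^sup>2) \<longlongrightarrow> 2 * rinner x (E x) + 0 * (norm (E x))\<^sup>2) (at_right 0)"
    by (intro tendsto_add tendsto_mult tendsto_power tendsto_norm rinner.tendsto tendsto_const d tendsto_ident_at)
  ultimately have "0 = 2 * rinner x (E x) + 0 * (norm (E x))\<^sup>2"
    by (rule tendsto_unique [rotated]) simp
  then show ?thesis by (simp add: rinner_commute)
qed

lemma Re_norm_sq:
  assumes "x \<in> D"
  shows "rinner (scaleC z x - E x) x = Re z * (norm x)\<^sup>2"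
proof -
  have "rinner (scaleC z x) x = Re z * (norm x)\<^sup>2"
    by (simp add: rinner_def cinner_scaleC_left cinner_self)
  then show ?thesis by (simp add: rinner.diff_left skew [OF assms])
qed

text \<open>An isometry shifts the difference of two orbit points back to time 0, so a modulus of
  right continuity at 0 serves at every time and on both sides.\<close>

lemma continuous_on_orbit: "continuous_on {0..} (\<lambda>t. V t x)"
  unfolding continuous_on_iff
proof (intro ballI allI impI)
  fix t e :: real assume t: "t \<in> {0..}" and e: "0 < e"
  have "\<forall>\<^sub>F u in at_right 0. dist (V u x) x < e" using V_tendsto_0 e by (rule tendstoD)
  then obtain b where b: "0 < b" "\<And>u. 0 < u \<Longrightarrow> u < b \<Longrightarrow> dist (V u x) x < e"
    unfolding eventually_at_right_field by blast
  have *: "dist (V r x) (V s x) < e" if "0 \<le> r" "r \<le> s" "s - r < b" for r s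
  proof (cases "r = s")
    case False
    interpret bounded_linear "V r" using bounded_clinear_V that by (simp add: bounded_clinear_iff)
    have "V s x - V r x = V r (V (s - r) x - x)"
      using V_add [of r "s - r" x] that by (simp add: diff)
    then have "dist (V r x) (V s x) = dist (V (s - r) x) x"
      using isometric [OF that(1)] by (simp add: dist_norm norm_minus_commute [of "V r x"])
    then show ?thesis using b(2) [of "s - r"] that False by simp
  qed (use e in simp)
  have "dist (V s x) (V t x) < e" if "s \<in> {0..}" "dist s t < b" for s
    using * [of s t] * [of t s] that t by (cases "s \<le> t") (auto simp: dist_real_def dist_commute)
  then show "\<exists>d>0. \<forall>s\<in>{0..}. dist s t < d \<longrightarrow> dist (V s x) (V t x) < e" using b(1) by blast
qed

text \<open>The orbit integral is a limit of integrals of continuous functions over compact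
  intervals, which asks no separability of the space. Convergence comes from the exponential weight,
  and differentiating the shifted integral identifies it as a preimage of \<open>h\<close> under z -
  E.\<close>

lemma Laplace_transform:
  assumes z: "0 < Re z"
  obtains L where "L \<in> D" "scaleC z L - E L = h"
    "((\<lambda>b. integral {0..b} (\<lambda>t. scaleC (exp (- (z * of_real t))) (V t h))) \<longlongrightarrow> L) at_top"
proof -
  define u where "u t = scaleC (exp (- (z * of_real t))) (V t h)" for t
  define S where "S b = integral {0..b} u" for b
  have norm_u: "norm (u t) = exp (- Re z * t) * norm h" if "0 \<le> t" for t
    using isometric [OF that] by (simp add: u_def)
  have cont: "continuous_on {0..} u"
    unfolding u_def by (intro scaleC.continuous_on continuous_on_orbit continuous_intros)
  have cont': "continuous_on {a..b} u" if "0 \<le> a" for a b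
    by (rule continuous_on_subset [OF cont]) (use that in auto)
  have int: "u integrable_on {a..b}" if "0 \<le> a" for a b
    by (rule integrable_continuous_real [OF cont' [OF that]])
  have S_diff: "integral {a..b} u = S b - S a" if "0 \<le> a" "a \<le> b" for a b
    using Henstock_Kurzweil_Integration.integral_combine [of 0 a b u] that int [of 0 b]
    by (simp add: S_def eq_diff_eq add.commute)
  have S_bound: "norm (S b - S a) \<le> norm h / Re z * exp (- Re z * a)" if ab: "0 \<le> a" "a \<le> b" for a b
  proof -
    have "((\<lambda>t. exp (- Re z * t) * norm h) has_integral
        - (exp (- Re z * b) / Re z * norm h) - - (exp (- Re z * a) / Re z * norm h)) {a..b}"
      using z ab
      by (intro fundamental_theorem_of_calculus)
         (auto intro!: derivative_eq_intros simp flip: has_real_derivative_iff_has_vector_derivative)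
    note I = this [unfolded has_integral_iff]
    have "norm (integral {a..b} u) \<le> integral {a..b} (\<lambda>t. exp (- Re z * t) * norm h)"
      using I norm_u ab int by (intro Henstock_Kurzweil_Integration.integral_norm_bound_integral) auto
    also have "\<dots> = norm h / Re z * exp (- Re z * a) - norm h / Re z * exp (- Re z * b)"
      using I by (simp add: mult.commute)
    also have "\<dots> \<le> norm h / Re z * exp (- Re z * a)" using z by simp
    finally show ?thesis by (simp add: S_diff ab)
  qed
  have decay: "((\<lambda>b. norm h / Re z * exp (- Re z * b)) \<longlongrightarrow> 0) at_top"
    using z by real_asymp
  have "Cauchy (\<lambda>n. S (real n))"
  proof (rule metric_CauchyI)
    fix e :: real assume e: "0 < e"
    then have "\<forall>\<^sub>F b in at_top. norm h / Re z * exp (- Re z * b) < e"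
      using decay by (rule order_tendstoD(2) [rotated])
    then obtain B where B: "\<And>b. B \<le> b \<Longrightarrow> norm h / Re z * exp (- Re z * b) < e"
      unfolding eventually_at_top_linorder by blast
    define M where "M = nat \<lceil>B\<rceil>"
    have M: "B \<le> real m" if "M \<le> m" for m using that unfolding M_def by linarith
    have "dist (S (real m)) (S (real n)) < e" if "M \<le> m" "m \<le> n" for m n
      using S_bound [of m n] B [OF M [OF that(1)]] that by (simp add: dist_norm norm_minus_commute)
    then show "\<exists>M. \<forall>m\<ge>M. \<forall>n\<ge>M. dist (S (real m)) (S (real n)) < e"
      by (metis dist_commute nle_le)
  qed
  then obtain L where L: "(\<lambda>n. S (real n)) \<longlonglongrightarrow> L" using Cauchy_convergent convergent_def by blast
  have S_L: "norm (S b - L) \<le> norm h / Re z * exp (- Re z * b)" if b: "0 \<le> b" for b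
  proof (rule LIMSEQ_le_const2)
    show "(\<lambda>n. norm (S b - S (real n))) \<longlonglongrightarrow> norm (S b - L)" by (intro tendsto_intros L)
    obtain N where "b \<le> real N" using real_arch_simple by blast
    then have "norm (S b - S (real n)) \<le> norm h / Re z * exp (- Re z * b)" if "N \<le> n" for n
      using S_bound [OF b, of "real n"] that by (simp add: norm_minus_commute)
    then show "\<exists>N. \<forall>n\<ge>N. norm (S b - S (real n)) \<le> norm h / Re z * exp (- Re z * b)" by blast
  qed
  have S_lim: "(S \<longlongrightarrow> L) at_top"
  proof -
    have "\<forall>\<^sub>F b in at_top. norm (S b - L) \<le> norm h / Re z * exp (- Re z * b)"
      using eventually_ge_at_top [of 0] by eventually_elim (rule S_L)
    then have "((\<lambda>b. S b - L) \<longlongrightarrow> 0) at_top" by (rule Lim_null_comparison [OF _ decay])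
    then show ?thesis by (simp add: LIM_zero_iff)
  qed
  \<comment> \<open>Moving the orbit by \<open>r\<close> removes the initial piece
    \<open>S r\<close> and rescales the exponential weight. The right derivative at
    \<open>r = 0\<close> yields E L = z L - h.\<close>
  have V_L: "V r L = scaleC (exp (z * of_real r)) (L - S r)" if r: "0 \<le> r" for r
  proof -
    interpret Vr: bounded_linear "V r" using bounded_clinear_V r by (simp add: bounded_clinear_iff)
    have shift: "V r (S b) = scaleC (exp (z * of_real r)) (S (b + r) - S r)" if b: "0 \<le> b" for b
    proof -
      have "V r (S b) = integral {0..b} (V r \<circ> u)"
        unfolding S_def by (rule integral_linear [symmetric, OF int Vr.bounded_linear_axioms]) simp
      also have "\<dots> = integral {0..b} (scaleC (exp (z * of_real r)) \<circ> (u \<circ> (+) r))"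
      proof (rule Henstock_Kurzweil_Integration.integral_cong)
        fix t assume t: "t \<in> {0..b}"
        have "V r (u t) = scaleC (exp (- (z * of_real t))) (V (r + t) h)"
          using bounded_clinear_V [OF r] V_add [OF r, of t h] t by (simp add: u_def bounded_clinear_iff)
        also have "\<dots> = scaleC (exp (z * of_real r)) (u (r + t))"
          by (simp add: u_def scaleC_scaleC exp_add [symmetric] algebra_simps)
        finally show "(V r \<circ> u) t = (scaleC (exp (z * of_real r)) \<circ> (u \<circ> (+) r)) t" by simp
      qed
      also have "\<dots> = scaleC (exp (z * of_real r)) (integral {0..b} (u \<circ> (+) r))"
        by (rule integral_linear [OF _ scaleC.bounded_linear_right], rule integrable_continuous_real,
            rule continuous_on_compose, intro continuous_intros, rule continuous_on_subset [OF cont])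
           (use r in auto)
      also have "integral {0..b} (u \<circ> (+) r) = integral {r..b + r} u"
        using integral_shift_Icc_real [of 0 b u r] by simp
      also have "\<dots> = S (b + r) - S r" using S_diff [of r "b + r"] r b by simp
      finally show ?thesis .
    qed
    have lim_V: "((\<lambda>b. V r (S b)) \<longlongrightarrow> V r L) at_top" by (rule Vr.tendsto [OF S_lim])
    have "((\<lambda>b. S (b + r)) \<longlongrightarrow> L) at_top"
      by (rule filterlim_compose [OF S_lim]) real_asymp
    then have lim_S: "((\<lambda>b. scaleC (exp (z * of_real r)) (S (b + r) - S r)) \<longlongrightarrow> scaleC (exp (z * of_real r)) (L - S r)) at_top"
      by (intro scaleC.tendsto tendsto_const tendsto_diff)
    have "\<forall>\<^sub>F b in at_top. scaleC (exp (z * of_real r)) (S (b + r) - S r) = V r (S b)"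
      using eventually_ge_at_top [of 0] by eventually_elim (simp add: shift)
    from tendsto_unique [OF trivial_limit_at_top_linorder lim_V Lim_transform_eventually [OF lim_S this]]
    show ?thesis .
  qed
  have S_deriv: "((\<lambda>r. (1 / r) *\<^sub>R S r) \<longlongrightarrow> h) (at_right 0)"
  proof (rule tendstoI)
    fix e :: real assume e: "0 < e"
    have "u 0 = h" by (simp add: u_def V_0 scaleC_one)
    then obtain d where d: "0 < d" "\<And>t. 0 \<le> t \<Longrightarrow> t < d \<Longrightarrow> norm (u t - h) < e / 2"
      using cont [unfolded continuous_on_iff, rule_format, of 0 "e/2"] e by (auto simp: dist_norm)
    have "dist ((1 / r) *\<^sub>R S r) h < e" if r: "0 < r" "r < d" for r
    proof -
      have "norm (integral {0..r} (\<lambda>t. u t - h)) \<le> e / 2 * (r - 0)"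
        using r d by (intro integral_bound continuous_on_diff cont' continuous_on_const) (auto simp: less_imp_le)
      also have "integral {0..r} (\<lambda>t. u t - h) = S r - r *\<^sub>R h"
        using r by (subst Henstock_Kurzweil_Integration.integral_diff) (auto simp: int S_def)
      also have "S r - r *\<^sub>R h = r *\<^sub>R ((1 / r) *\<^sub>R S r - h)" using r by (simp add: scaleR_diff_right)
      finally show ?thesis using r e by (simp add: dist_norm)
    qed
    then show "\<forall>\<^sub>F r in at_right 0. dist ((1 / r) *\<^sub>R S r) h < e"
      unfolding eventually_at_right_field using d(1) by blast
  qed
  have exp_deriv: "((\<lambda>r. (exp (z * of_real r) - 1) / of_real r) \<longlongrightarrow> z) (at_right 0)"
  proof -
    have "((\<lambda>w. exp (z * w)) has_field_derivative z) (at 0)"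
      by (auto intro!: derivative_eq_intros)
    then have "((\<lambda>w. (exp (z * w) - 1) / w) \<longlongrightarrow> z) (at 0)"
      by (simp add: has_field_derivative_iff)
    moreover have "((\<lambda>r. complex_of_real r) \<longlongrightarrow> of_real 0) (at_right 0)"
      by (intro tendsto_of_real tendsto_ident_at)
    then have "filterlim (\<lambda>r. complex_of_real r) (at 0) (at_right 0)"
      unfolding filterlim_at by (auto simp: eventually_at_right_field intro!: exI [of _ 1])
    ultimately show ?thesis by (rule filterlim_compose)
  qed
  have "((\<lambda>r. scaleC ((exp (z * of_real r) - 1) / of_real r) L - scaleC (exp (z * of_real r)) ((1 / r) *\<^sub>R S r))
      \<longlongrightarrow> scaleC z L - scaleC (exp (z * of_real 0)) h) (at_right 0)"
    by (intro tendsto_diff scaleC.tendsto exp_deriv S_deriv tendsto_const tendsto_exp tendsto_mult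
        tendsto_of_real tendsto_ident_at)
  moreover have "\<forall>\<^sub>F r in at_right 0. scaleC ((exp (z * of_real r) - 1) / of_real r) L
      - scaleC (exp (z * of_real r)) ((1 / r) *\<^sub>R S r) = (1 / r) *\<^sub>R (V r L - L)"
  proof -
    have "scaleC ((exp (z * of_real r) - 1) / of_real r) L = (1 / r) *\<^sub>R (scaleC (exp (z * of_real r)) L - L)" if "0 < r" for r
    proof -
      have "(exp (z * of_real r) - 1) / of_real r = (1 / r) *\<^sub>R (exp (z * of_real r) - 1)"
        by (simp add: scaleR_conv_of_real)
      then show ?thesis by (simp only: scaleC.scaleR_left scaleC.diff_left scaleC_one)
    qed
    then show ?thesis unfolding eventually_at_right_field
      by (intro exI [of _ 1]) (simp add: V_L scaleC.diff_right scaleC.scaleR_right scaleR_diff_right)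
  qed
  ultimately have "((\<lambda>r. (1 / r) *\<^sub>R (V r L - L)) \<longlongrightarrow> scaleC z L - h) (at_right 0)"
    using Lim_transform_eventually by (fastforce simp: scaleC_one)
  then have "L \<in> D" "E L = scaleC z L - h" by (rule generator_eqI)+
  moreover note S_lim [unfolded S_def u_def]
  ultimately show thesis using that by simp
qed

lemma right_half_plane_resolvent_set:
  assumes z: "0 < Re z"
  shows "z \<in> resolvent_set D E"
proof (rule resolvent_setI [OF linear _ z])
  show "\<exists>x\<in>D. scaleC z x - E x = y" for y by (rule Laplace_transform [OF z]) blast
  fix x assume x: "x \<in> D"
  have "norm x * (Re z * norm x) \<le> norm x * norm (scaleC z x - E x)"
    using Re_norm_sq [OF x, of z] Cauchy_Schwarz_rinner [of "scaleC z x - E x" x]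
    by (simp add: power2_eq_square ac_simps)
  then show "Re z * norm x \<le> norm (scaleC z x - E x)"
    by (cases "x = 0") auto
qed

lemma resolvent_integral:
  assumes \<epsilon>: "0 < \<epsilon>"
  shows "(\<lambda>\<xi>. (norm (resolvent D E (Complex \<epsilon> \<xi>) h))\<^sup>2) \<in> borel_measurable borel"
    and "ennreal \<epsilon> * (\<integral>\<^sup>+\<xi>. ennreal ((norm (resolvent D E (Complex \<epsilon> \<xi>) h))\<^sup>2) \<partial>lborel) = ennreal (pi * (norm h)\<^sup>2)"
proof -
  \<comment> \<open>Freezing the time at 0 on the negative axis gives a continuous function on the
    whole line; the transform sees only nonnegative times.\<close>
  define c where "c t = cinner (V (max 0 t) h) h" for t
  have c_cont: "continuous_on UNIV c"
  proof -
    have "bounded_linear (\<lambda>v. cinner v h)" by (rule bounded_linear_cinner_left)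
    then show ?thesis unfolding c_def
      by (rule bounded_linear.continuous_on)
         (rule continuous_on_compose2 [OF continuous_on_orbit], auto intro!: continuous_intros)
  qed
  have c_bound: "cmod (c t) \<le> 2 * (norm h)\<^sup>2" for t
    using cinner_bound [of "V (max 0 t) h"] isometric [of "max 0 t" h] by (simp add: c_def power2_eq_square ac_simps)
  define \<phi> where "\<phi> \<xi> = (\<integral>t. indicator {0..} t * (exp (- \<epsilon> * t) * Re (cis (\<xi> * t) * c t)) \<partial>lborel)" for \<xi>
  have \<phi>: "\<phi> \<xi> = \<epsilon> * (norm (resolvent D E (Complex \<epsilon> \<xi>) h))\<^sup>2" for \<xi>
  proof -
    define z where "z = Complex \<epsilon> \<xi>"
    have z: "0 < Re z" using \<epsilon> by (simp add: z_def)
    obtain L where L: "L \<in> D" "scaleC z L - E L = h"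
      and lim: "((\<lambda>b. integral {0..b} (\<lambda>t. scaleC (exp (- (z * of_real t))) (V t h))) \<longlongrightarrow> L) at_top"
      by (rule Laplace_transform [OF z])
    have res: "resolvent D E z h = L"
      using resolvent_set_resolvent(3) [OF right_half_plane_resolvent_set [OF z] L(1)] L(2) by simp
    define f where "f t = exp (- \<epsilon> * t) * Re (cis (\<xi> * t) * c t)" for t
    have f: "rinner h (scaleC (exp (- (z * of_real t))) (V t h)) = f t" if "0 \<le> t" for t
    proof -
      \<comment> \<open>\<open>cinner\<close> is conjugate linear in its first argument, which turns
        the frequency factor into \<open>cis (\<xi> * t)\<close>, the sign used for
        \<open>\<phi>\<close>.\<close>
      have cnj: "cnj (exp (- (z * of_real t))) = exp (- \<epsilon> * t) *\<^sub>R cis (\<xi> * t)"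
        by (simp add: z_def complex_eq_iff Re_exp Im_exp)
      then show ?thesis using that
        by (subst rinner_commute)
           (simp only: rinner_def cinner_scaleC_left f_def c_def cnj mult_scaleR_left scaleR_complex.sel max_absorb2)
    qed
    have f_int: "set_integrable lborel {0..} f"
      unfolding set_integrable_def
    proof (rule Bochner_Integration.integrable_bound)
      show "integrable lborel (\<lambda>t. 2 * (norm h)\<^sup>2 * (indicator {0..} t * exp (- \<epsilon> * t)))"
        by (intro integrable_mult_right integrable_exp_half_line \<epsilon>)
      have "continuous_on UNIV f" unfolding f_def
        by (intro continuous_intros c_cont)
      then have [measurable]: "f \<in> borel_measurable borel" by (rule borel_measurable_continuous_onI)
      show "(\<lambda>t. indicator {0..} t *\<^sub>R f t) \<in> borel_measurable lborel" by measurable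
      have "\<bar>Re (cis (\<xi> * t) * c t)\<bar> \<le> 2 * (norm h)\<^sup>2" for t
        by (rule order_trans [OF abs_Re_le_cmod]) (simp add: norm_mult c_bound)
      then have "\<bar>f t\<bar> \<le> exp (- \<epsilon> * t) * (2 * (norm h)\<^sup>2)" for t
        unfolding f_def abs_mult by (simp add: mult_left_mono)
      then show "AE t in lborel. norm (indicator {0..} t *\<^sub>R f t) \<le> norm (2 * (norm h)\<^sup>2 * (indicator {0..} t * exp (- \<epsilon> * t)))"
        by (intro AE_I2) (simp add: indicator_def mult.commute)
    qed
    have "set_lebesgue_integral lborel {0..b} f = integral {0..b} (\<lambda>t. rinner h (scaleC (exp (- (z * of_real t))) (V t h)))" for b
    proof -
      have "set_integrable lborel {0..b} f" by (rule set_integrable_subset [OF f_int]) auto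
      then have "set_lebesgue_integral lborel {0..b} f = integral {0..b} f"
        by (rule set_borel_integral_eq_integral)
      also have "\<dots> = integral {0..b} (\<lambda>t. rinner h (scaleC (exp (- (z * of_real t))) (V t h)))"
        by (rule Henstock_Kurzweil_Integration.integral_cong) (simp add: f)
      finally show ?thesis .
    qed
    also have "integral {0..b} (\<lambda>t. rinner h (scaleC (exp (- (z * of_real t))) (V t h)))
      = rinner h (integral {0..b} (\<lambda>t. scaleC (exp (- (z * of_real t))) (V t h)))" for b
    proof -
      have "(\<lambda>t. scaleC (exp (- (z * of_real t))) (V t h)) integrable_on {0..b}"
        by (intro integrable_continuous_real scaleC.continuous_on continuous_intros
            continuous_on_subset [OF continuous_on_orbit]) auto
      from integral_linear [OF this rinner.bounded_linear_right] show ?thesis by (simp add: o_def)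
    qed
    finally have "((\<lambda>b. set_lebesgue_integral lborel {0..b} f) \<longlongrightarrow> rinner h L) at_top"
      by (simp add: rinner.tendsto [OF tendsto_const lim])
    moreover have "((\<lambda>b. set_lebesgue_integral lborel {0..b} f) \<longlongrightarrow> set_lebesgue_integral lborel {0..} f) at_top"
      by (rule tendsto_set_lebesgue_integral_at_top [OF _ f_int]) auto
    ultimately have "rinner h L = set_lebesgue_integral lborel {0..} f"
      by (rule tendsto_unique [OF trivial_limit_at_top_linorder])
    then have "set_lebesgue_integral lborel {0..} f = rinner h L" ..
    also have "\<dots> = \<epsilon> * (norm L)\<^sup>2"
      using Re_norm_sq [OF L(1), of z] L(2) by (simp add: z_def)
    finally show ?thesis
      by (simp add: \<phi>_def f_def set_lebesgue_integral_def z_def [symmetric] res)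
  qed
  \<comment> \<open>Positivity is invisible in the oscillating integral; it is read off from the
    resolvent norm.\<close>
  have nonneg: "0 \<le> \<phi> \<xi>" for \<xi> using \<epsilon> by (simp add: \<phi>)
  have "\<phi> \<in> borel_measurable borel" and mass: "(\<integral>\<^sup>+\<xi>. ennreal (\<phi> \<xi>) \<partial>lborel) = ennreal (pi * Re (c 0))"
    using nn_integral_positive_Laplace [OF c_cont c_bound \<epsilon>] nonneg unfolding \<phi>_def by auto
  then have "(\<lambda>\<xi>. \<phi> \<xi> / \<epsilon>) \<in> borel_measurable borel" by measurable
  then show meas: "(\<lambda>\<xi>. (norm (resolvent D E (Complex \<epsilon> \<xi>) h))\<^sup>2) \<in> borel_measurable borel"
    using \<epsilon> by (simp add: \<phi>)
  have "ennreal \<epsilon> * (\<integral>\<^sup>+\<xi>. ennreal ((norm (resolvent D E (Complex \<epsilon> \<xi>) h))\<^sup>2) \<partial>lborel)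
      = (\<integral>\<^sup>+\<xi>. ennreal (\<phi> \<xi>) \<partial>lborel)"
    using \<epsilon> meas by (subst nn_integral_cmult [symmetric]) (auto simp: \<phi> ennreal_mult)
  also have "Re (c 0) = (norm h)\<^sup>2" by (simp add: c_def V_0 cinner_self)
  note mass [unfolded this]
  finally show "ennreal \<epsilon> * (\<integral>\<^sup>+\<xi>. ennreal ((norm (resolvent D E (Complex \<epsilon> \<xi>) h))\<^sup>2) \<partial>lborel) = ennreal (pi * (norm h)\<^sup>2)" .
qed

end

section \<open>Similarity transforms of operators and semigroups\<close>

locale similarity =
  fixes S Sinv :: "'a::complex_hilbert \<Rightarrow> 'a"
  assumes S: "bounded_clinear S" and Sinv: "bounded_clinear Sinv"
    and Sinv_S [simp]: "Sinv (S x) = x" and S_Sinv [simp]: "S (Sinv x) = x"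
begin

sublocale S: bounded_linear S using S by (simp add: bounded_clinear_iff)
sublocale Sinv: bounded_linear Sinv using Sinv by (simp add: bounded_clinear_iff)

lemma S_scaleC: "S (scaleC c x) = scaleC c (S x)"
  and Sinv_scaleC: "Sinv (scaleC c x) = scaleC c (Sinv x)"
  using S Sinv by (auto simp: bounded_clinear_iff)

lemma inverse_similarity: "similarity Sinv S"
  by unfold_locales (auto simp: S Sinv)

lemma in_S_image_iff: "y \<in> S ` D \<longleftrightarrow> Sinv y \<in> D"
  by (metis S_Sinv Sinv_S image_iff)

lemma linear_operator_conj:
  assumes "linear_operator D E"
  shows "linear_operator (S ` D) (\<lambda>y. S (E (Sinv y)))"
  using assms unfolding linear_operator_def csubspace_def
  by (auto simp: in_S_image_iff Sinv.add Sinv_scaleC S.add S_scaleC Sinv.zero)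

lemma difference_quotient_conj:
  assumes "((\<lambda>t. (1 / t) *\<^sub>R (T t x - x)) \<longlongrightarrow> y) (at_right 0)"
  shows "((\<lambda>t. (1 / t) *\<^sub>R (S (T t (Sinv (S x))) - S x)) \<longlongrightarrow> S y) (at_right 0)"
  using S.tendsto [OF assms] by (simp add: S.diff S.scaleR)

lemma generates_conj:
  assumes gen: "generates D E T"
  shows "generates (S ` D) (\<lambda>y. S (E (Sinv y))) (\<lambda>t y. S (T t (Sinv y)))"
proof -
  interpret inv: similarity Sinv S by (rule inverse_similarity)
  have T: "C0_semigroup T" and D: "D = generator_domain T" and E: "\<And>x. x \<in> D \<Longrightarrow> E x = generator T x"
    using gen by (auto simp: generates_def)
  have "C0_semigroup (\<lambda>t y. S (T t (Sinv y)))"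
    unfolding C0_semigroup_def
  proof (intro conjI allI impI)
    show "bounded_clinear (\<lambda>y. S (T t (Sinv y)))" if "0 \<le> t" for t
      using T that unfolding C0_semigroup_def
      by (intro bounded_clinear_compose [OF S] bounded_clinear_compose [OF _ Sinv]) simp
    show "(\<lambda>y. S (T 0 (Sinv y))) = id" using T by (auto simp: C0_semigroup_def)
    show "(\<lambda>y. S (T (s + t) (Sinv y))) = (\<lambda>y. S (T s (Sinv y))) \<circ> (\<lambda>y. S (T t (Sinv y)))"
      if "0 \<le> s" "0 \<le> t" for s t
      using T that by (auto simp: C0_semigroup_def)
    show "((\<lambda>t. S (T t (Sinv x))) \<longlongrightarrow> x) (at_right 0)" for x
    proof -
      have "((\<lambda>t. T t (Sinv x)) \<longlongrightarrow> Sinv x) (at_right 0)" using T by (simp add: C0_semigroup_def)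
      from S.tendsto [OF this] show ?thesis by simp
    qed
  qed
  moreover have "S ` D = generator_domain (\<lambda>t y. S (T t (Sinv y)))"
  proof (intro equalityI subsetI)
    fix y assume "y \<in> S ` D"
    then obtain x w where "y = S x" "((\<lambda>t. (1 / t) *\<^sub>R (T t x - x)) \<longlongrightarrow> w) (at_right 0)"
      unfolding D generator_domain_def by auto
    with difference_quotient_conj show "y \<in> generator_domain (\<lambda>t y. S (T t (Sinv y)))"
      unfolding generator_domain_def by blast
  next
    fix y assume "y \<in> generator_domain (\<lambda>t y. S (T t (Sinv y)))"
    then obtain w where "((\<lambda>t. (1 / t) *\<^sub>R (S (T t (Sinv y)) - y)) \<longlongrightarrow> w) (at_right 0)"
      unfolding generator_domain_def by blast
    from inv.difference_quotient_conj [where T = "\<lambda>t y. S (T t (Sinv y))", OF this] have "Sinv y \<in> D"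
      unfolding D generator_domain_def by auto
    then show "y \<in> S ` D" by (simp add: in_S_image_iff)
  qed
  moreover have "S (E (Sinv y)) = generator (\<lambda>t y. S (T t (Sinv y))) y" if "y \<in> S ` D" for y
  proof -
    have x: "Sinv y \<in> D" using that by (simp add: in_S_image_iff)
    then obtain w where w: "((\<lambda>t. (1 / t) *\<^sub>R (T t (Sinv y) - Sinv y)) \<longlongrightarrow> w) (at_right 0)"
      unfolding D generator_domain_def by blast
    then have "E (Sinv y) = w"
      using tendsto_Lim [OF _ w] E [OF x] by (simp add: generator_def)
    then show ?thesis
      using tendsto_Lim [OF _ difference_quotient_conj [where T = T, OF w]] by (simp add: generator_def)
  qed
  ultimately show ?thesis unfolding generates_def by blast
qed

lemma resolvent_conj:
  assumes z: "z \<in> resolvent_set (S ` D) (\<lambda>y. S (E (Sinv y)))"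
  shows "z \<in> resolvent_set D E"
    and "resolvent D E z h = Sinv (resolvent (S ` D) (\<lambda>y. S (E (Sinv y))) z (S h))"
proof -
  define R where "R = resolvent (S ` D) (\<lambda>y. S (E (Sinv y))) z"
  note R = resolvent_set_resolvent [OF z, folded R_def]
  define Q where "Q h = Sinv (R (S h))" for h
  have Q: "bounded_clinear Q"
    unfolding Q_def by (intro bounded_clinear_compose [OF Sinv] bounded_clinear_compose [OF R(4)] S)
  have QD: "Q y \<in> D" for y using R(1) [of "S y"] by (simp add: Q_def in_S_image_iff)
  have eq: "scaleC z (Q y) - E (Q y) = y" for y
  proof -
    have "Sinv (scaleC z (R (S y)) - S (E (Sinv (R (S y))))) = y" unfolding R(2) by simp
    then show ?thesis by (simp add: Q_def Sinv.diff Sinv_scaleC)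
  qed
  have inv: "Q (scaleC z x - E x) = x" if "x \<in> D" for x
    using R(3) [of "S x"] that by (simp add: Q_def S.diff S_scaleC)
  show z': "z \<in> resolvent_set D E" unfolding resolvent_set_def using Q QD eq inv by blast
  have "resolvent D E z (scaleC z (Q h) - E (Q h)) = Q h"
    by (rule resolvent_set_resolvent(3) [OF z' QD])
  then show "resolvent D E z h = Sinv (resolvent (S ` D) (\<lambda>y. S (E (Sinv y))) z (S h))"
    by (simp only: eq) (simp add: Q_def R_def)
qed

end

section \<open>The quadratic means along vertical lines\<close>

text \<open>Extended nonnegative values keep the mean meaningful when the integral diverges.\<close>

definition line_mean :: "'a::complex_hilbert set \<Rightarrow> ('a \<Rightarrow> 'a) \<Rightarrow> 'a \<Rightarrow> real \<Rightarrow> ennreal" where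
  "line_mean D E h \<epsilon> = ennreal \<epsilon> * (\<integral>\<^sup>+ \<xi>. ennreal ((norm (resolvent D E (Complex \<epsilon> \<xi>) h))\<^sup>2) \<partial>lborel)"

text \<open>In the isometric model the mean equals pi times the squared norm for every positive
  \<epsilon>. Going back through the similarity costs at most the factor \<open>\<kappa>\<close> in
  either direction, uniformly in \<epsilon>, so both limits inherit the bounds.\<close>

theorem line_mean_bounds:
  fixes D :: "'a::complex_hilbert set"
  assumes lin: "linear_operator D E" and gen: "generates D E T" and sim: "similar_to_isometries T"
  shows "{z. 0 < Re z} \<subseteq> resolvent_set D E"
    and "\<exists>\<alpha>>0. \<exists>\<beta>>0. \<forall>h. \<forall>\<epsilon>>0. ennreal (\<alpha> * (norm h)\<^sup>2) \<le> line_mean D E h \<epsilon> \<and> line_mean D E h \<epsilon> \<le> ennreal (\<beta> * (norm h)\<^sup>2)"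
proof -
  obtain S Sinv :: "'a \<Rightarrow> 'a" where sim_S: "bounded_clinear S" "bounded_clinear Sinv"
    "\<And>x. Sinv (S x) = x" "\<And>x. S (Sinv x) = x" "\<And>t x. 0 \<le> t \<Longrightarrow> norm (S (T t (Sinv x))) = norm x"
    using sim unfolding similar_to_isometries_def by blast
  interpret similarity S Sinv using sim_S by unfold_locales auto
  define D' E' where "D' = S ` D" and "E' = (\<lambda>y. S (E (Sinv y)))"
  interpret V: isometric_semigroup D' E' "\<lambda>t y. S (T t (Sinv y))"
    unfolding D'_def E'_def using lin gen sim_S(5)
    by unfold_locales (auto intro: linear_operator_conj generates_conj)
  note res = resolvent_conj [of _ D E, folded D'_def E'_def, OF V.right_half_plane_resolvent_set]
  show "{z. 0 < Re z} \<subseteq> resolvent_set D E" using res(1) by blast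
  obtain K where K: "0 < K" "\<And>x. norm (S x) \<le> norm x * K" using S.pos_bounded by blast
  obtain K' where K': "0 < K'" "\<And>x. norm (Sinv x) \<le> norm x * K'" using Sinv.pos_bounded by blast
  define \<kappa> where "\<kappa> = (K * K')\<^sup>2"
  have \<kappa>: "0 < \<kappa>" using K K' by (simp add: \<kappa>_def)
  have bounds: "ennreal (pi / \<kappa> * (norm h)\<^sup>2) \<le> line_mean D E h \<epsilon>" "line_mean D E h \<epsilon> \<le> ennreal (pi * \<kappa> * (norm h)\<^sup>2)"
    if \<epsilon>: "0 < \<epsilon>" for h \<epsilon>
  proof -
    define f where "f \<xi> = (norm (resolvent D' E' (Complex \<epsilon> \<xi>) (S h)))\<^sup>2" for \<xi>
    define g where "g \<xi> = (norm (resolvent D E (Complex \<epsilon> \<xi>) h))\<^sup>2" for \<xi>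
    have f_meas [measurable]: "f \<in> borel_measurable borel"
      unfolding f_def by (rule V.resolvent_integral(1) [OF \<epsilon>])
    have f_int: "ennreal \<epsilon> * (\<integral>\<^sup>+\<xi>. ennreal (f \<xi>) \<partial>lborel) = ennreal (pi * (norm (S h))\<^sup>2)"
      unfolding f_def by (rule V.resolvent_integral(2) [OF \<epsilon>])
    have g: "g \<xi> = (norm (Sinv (resolvent D' E' (Complex \<epsilon> \<xi>) (S h))))\<^sup>2" for \<xi>
      using \<epsilon> by (simp add: g_def res(2))
    have g_le: "g \<xi> \<le> K'\<^sup>2 * f \<xi>" for \<xi>
      unfolding g f_def power_mult_distrib [symmetric]
      using K'(2) [of "resolvent D' E' (Complex \<epsilon> \<xi>) (S h)"] by (intro power_mono) (simp_all add: mult.commute)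
    have f_le: "f \<xi> \<le> K\<^sup>2 * g \<xi>" for \<xi>
      unfolding g f_def power_mult_distrib [symmetric]
      using K(2) [of "Sinv (resolvent D' E' (Complex \<epsilon> \<xi>) (S h))"] by (intro power_mono) (simp_all add: mult.commute)
    have "norm (S h) \<le> K * norm h" "norm h \<le> K' * norm (S h)"
      using K(2) [of h] K'(2) [of "S h"] by (simp_all add: mult.commute)
    then have Sh: "(norm (S h))\<^sup>2 \<le> K\<^sup>2 * (norm h)\<^sup>2" "(norm h)\<^sup>2 \<le> K'\<^sup>2 * (norm (S h))\<^sup>2"
      unfolding power_mult_distrib [symmetric] by (simp_all add: power_mono)
    have mean: "line_mean D E h \<epsilon> = ennreal \<epsilon> * (\<integral>\<^sup>+\<xi>. ennreal (g \<xi>) \<partial>lborel)"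
      by (simp add: line_mean_def g_def)
    have "line_mean D E h \<epsilon> \<le> ennreal \<epsilon> * (\<integral>\<^sup>+\<xi>. ennreal (K'\<^sup>2) * ennreal (f \<xi>) \<partial>lborel)"
      unfolding mean using g_le
      by (intro mult_left_mono nn_integral_mono) (auto simp: ennreal_mult' [symmetric] ennreal_leI)
    also have "\<dots> = ennreal (K'\<^sup>2) * ennreal (pi * (norm (S h))\<^sup>2)"
      by (subst nn_integral_cmult) (simp_all add: f_int [symmetric] mult.left_commute)
    also have "\<dots> = ennreal (pi * K'\<^sup>2 * (norm (S h))\<^sup>2)"
      by (simp add: ennreal_mult' [symmetric] mult_ac)
    also have "\<dots> \<le> ennreal (pi * \<kappa> * (norm h)\<^sup>2)"
      using mult_left_mono [OF Sh(1), of "pi * K'\<^sup>2"]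
      by (intro ennreal_leI) (simp add: \<kappa>_def power_mult_distrib mult_ac)
    finally show "line_mean D E h \<epsilon> \<le> ennreal (pi * \<kappa> * (norm h)\<^sup>2)" .
    have "(\<integral>\<^sup>+\<xi>. ennreal (f \<xi>) \<partial>lborel) \<le> ennreal (K\<^sup>2) * (\<integral>\<^sup>+\<xi>. ennreal (g \<xi>) \<partial>lborel)"
    proof -
      \<comment> \<open>The constant is moved to the side of \<open>f\<close>, whose measurability
        is at hand for pulling it out of the integral.\<close>
      have "(\<integral>\<^sup>+\<xi>. ennreal (inverse (K\<^sup>2)) * ennreal (f \<xi>) \<partial>lborel) \<le> (\<integral>\<^sup>+\<xi>. ennreal (g \<xi>) \<partial>lborel)"
      proof (rule nn_integral_mono)
        fix \<xi>
        have "inverse (K\<^sup>2) * f \<xi> \<le> g \<xi>"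
          using f_le [of \<xi>] K(1) by (simp add: inverse_eq_divide pos_divide_le_eq mult.commute)
        then show "ennreal (inverse (K\<^sup>2)) * ennreal (f \<xi>) \<le> ennreal (g \<xi>)"
          by (subst ennreal_mult' [symmetric]) (simp_all add: ennreal_leI)
      qed
      then have "ennreal (K\<^sup>2) * (ennreal (inverse (K\<^sup>2)) * (\<integral>\<^sup>+\<xi>. ennreal (f \<xi>) \<partial>lborel))
          \<le> ennreal (K\<^sup>2) * (\<integral>\<^sup>+\<xi>. ennreal (g \<xi>) \<partial>lborel)"
        by (intro mult_left_mono) (simp_all add: nn_integral_cmult)
      moreover have "ennreal (K\<^sup>2) * ennreal (inverse (K\<^sup>2)) = 1"
        using K(1) by (simp add: ennreal_mult' [symmetric])
      ultimately show ?thesis by (simp add: mult.assoc [symmetric])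
    qed
    then have "ennreal (pi * (norm (S h))\<^sup>2) \<le> ennreal (K\<^sup>2) * line_mean D E h \<epsilon>"
      unfolding f_int [symmetric] mean by (simp add: mult_left_mono mult.left_commute)
    then have "ennreal (inverse (K\<^sup>2)) * ennreal (pi * (norm (S h))\<^sup>2)
        \<le> ennreal (inverse (K\<^sup>2)) * (ennreal (K\<^sup>2) * line_mean D E h \<epsilon>)"
      by (rule mult_left_mono) simp
    also have "ennreal (inverse (K\<^sup>2)) * (ennreal (K\<^sup>2) * line_mean D E h \<epsilon>) = line_mean D E h \<epsilon>"
      using K(1) by (simp add: mult.assoc [symmetric] ennreal_mult' [symmetric])
    also have "ennreal (inverse (K\<^sup>2)) * ennreal (pi * (norm (S h))\<^sup>2) = ennreal (inverse (K\<^sup>2) * (pi * (norm (S h))\<^sup>2))"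
      by (simp add: ennreal_mult')
    finally have "ennreal (inverse (K\<^sup>2) * (pi * (norm (S h))\<^sup>2)) \<le> line_mean D E h \<epsilon>" .
    moreover have "pi / \<kappa> * (norm h)\<^sup>2 \<le> inverse (K\<^sup>2) * (pi * (norm (S h))\<^sup>2)"
      using mult_left_mono [OF Sh(2), of "pi / \<kappa>"] \<kappa> K(1) K'(1)
      by (simp add: \<kappa>_def power_mult_distrib field_simps)
    ultimately show "ennreal (pi / \<kappa> * (norm h)\<^sup>2) \<le> line_mean D E h \<epsilon>"
      using ennreal_leI order_trans by blast
  qed
  show "\<exists>\<alpha>>0. \<exists>\<beta>>0. \<forall>h. \<forall>\<epsilon>>0. ennreal (\<alpha> * (norm h)\<^sup>2) \<le> line_mean D E h \<epsilon> \<and> line_mean D E h \<epsilon> \<le> ennreal (\<beta> * (norm h)\<^sup>2)"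
    by (rule exI [of _ "pi / \<kappa>"], rule conjI, use \<kappa> in simp, rule exI [of _ "pi * \<kappa>"])
       (use \<kappa> bounds in simp)
qed


text \<open>The resolvent identity in a form that bounds \<open>?R w h\<close> by
  \<open>?R z h\<close> for \<open>w\<close> near \<open>z\<close>. It supplies measurability of the
  integrands on vertical lines.\<close>

lemma continuous_on_resolvent:
  assumes sub: "{z. 0 < Re z} \<subseteq> resolvent_set D E"
  shows "continuous_on {z. 0 < Re z} (\<lambda>z. resolvent D E z h)"
  unfolding continuous_on_iff
proof (intro ballI allI impI)
  fix z and e :: real assume z: "z \<in> {z. 0 < Re z}" and e: "0 < e"
  let ?R = "resolvent D E"
  have Rz: "z \<in> resolvent_set D E" using sub z by blast
  interpret Rz: bounded_linear "?R z"
    using resolvent_set_resolvent(4) [OF Rz] by (simp add: bounded_clinear_iff)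
  obtain K where K: "0 < K" "\<And>x. norm (?R z x) \<le> norm x * K" using Rz.pos_bounded by blast
  define N where "N = norm (?R z h) + 1"
  have N: "0 < N" "norm (?R z h) \<le> N" by (simp_all add: N_def add_nonneg_pos)
  \<comment> \<open>The first bound absorbs half of \<open>norm x\<close> and gives
    \<open>norm x\<close> at most \<open>2 * N\<close>; the second then makes the difference smaller
    than \<open>e\<close>.\<close>
  define d where "d = min (1 / (2 * K)) (e / (2 * K * N))"
  have "dist (?R w h) (?R z h) < e" if w: "0 < Re w" and dw: "dist w z < d" for w
  proof -
    have Rw: "w \<in> resolvent_set D E" using sub w by blast
    define x where "x = ?R w h"
    note x = resolvent_set_resolvent(1,2) [OF Rw, of h, folded x_def]
    define \<delta> where "\<delta> = cmod (w - z)"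
    have \<delta>: "\<delta> < 1 / (2 * K)" "\<delta> < e / (2 * K * N)" "0 \<le> \<delta>" using dw by (auto simp: \<delta>_def d_def dist_norm)
    then have \<delta>': "\<delta> * K < 1 / 2" "\<delta> * (2 * K * N) < e"
      using K(1) N(1) by (auto simp: field_simps)
    have "h = (scaleC z x - E x) + scaleC (w - z) x"
      using x(2) by (simp add: scaleC.diff_left)
    then have "?R z h = x + ?R z (scaleC (w - z) x)"
      using resolvent_set_resolvent(3) [OF Rz x(1)] by (simp add: Rz.add)
    moreover have "norm (?R z (scaleC (w - z) x)) \<le> \<delta> * K * norm x"
      using K(2) [of "scaleC (w - z) x"] by (simp add: \<delta>_def mult_ac)
    ultimately have diff: "norm (x - ?R z h) \<le> \<delta> * K * norm x" by simp
    have "\<delta> * K * norm x \<le> 1 / 2 * norm x" using \<delta>'(1) by (intro mult_right_mono) auto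
    with diff have "norm x \<le> 2 * norm (?R z h)" using norm_triangle_ineq2 [of x "?R z h"] by linarith
    then have "norm x \<le> 2 * N" using N(2) by linarith
    then have "\<delta> * K * norm x \<le> \<delta> * K * (2 * N)" using \<delta>(3) K(1) by (intro mult_left_mono) auto
    with diff \<delta>'(2) show ?thesis by (simp add: dist_norm x_def mult_ac)
  qed
  moreover have "0 < d" using K(1) N(1) e by (simp add: d_def)
  ultimately show "\<exists>d>0. \<forall>w\<in>{z. 0 < Re z}. dist w z < d \<longrightarrow> dist (?R w h) (?R z h) < e" by blast
qed

text \<open>Young's inequality with a parameter. The coefficient of \<open>u\<^sup>2\<close> has to
  be close to one for the invariance to be exact; the large coefficient falls on the error
  term.\<close>

lemma sq_add_le:
  fixes u v \<delta> :: real
  assumes "0 < \<delta>"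
  shows "(u + v)\<^sup>2 \<le> (1 + \<delta>) * u\<^sup>2 + (1 + 1 / \<delta>) * v\<^sup>2"
proof -
  have "0 \<le> (\<delta> * u - v)\<^sup>2 / \<delta>" using assms by simp
  also have "\<dots> = (1 + \<delta>) * u\<^sup>2 + (1 + 1 / \<delta>) * v\<^sup>2 - (u + v)\<^sup>2"
    using assms by (simp add: power2_eq_square field_simps)
  finally show ?thesis by simp
qed

lemma inverse_1_plus_square_finite: "(\<integral>\<^sup>+\<xi>. ennreal (inverse (1 + \<xi>\<^sup>2)) \<partial>lborel) < \<infinity>"
proof -
  have "integrable lborel (\<lambda>\<xi>::real. inverse (1 + \<xi>\<^sup>2))"
    using integrable_inverse_1_plus_square by (simp add: set_integrable_def)
  then show ?thesis by (simp add: integrable_iff_bounded)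
qed

text \<open>The error term \<open>2 * X / cmod (1 + z)\<close> is square integrable along the line, uniformly in \<open>\<epsilon>\<close>,
  so the factor \<open>\<epsilon>\<close> in the mean removes it in the limit.\<close>

lemma line_mean_comparison:
  assumes sub: "{z. 0 < Re z} \<subseteq> resolvent_set D E"
    and le: "\<And>z. 0 < Re z \<Longrightarrow> Re z < 1 \<Longrightarrow> norm (resolvent D E z x)
        \<le> (1 + Re z) / (1 - Re z) * (norm (resolvent D E z y) + 2 * X / cmod (1 + z))"
    and X: "0 \<le> X" and \<eta>: "0 < \<eta>"
  shows "\<forall>\<^sub>F \<epsilon> in at_right 0. line_mean D E x \<epsilon> \<le> ennreal (1 + \<eta>) * line_mean D E y \<epsilon> + ennreal \<eta>"
proof -
  define w where "w = enn2real (\<integral>\<^sup>+\<xi>. ennreal (inverse (1 + \<xi>\<^sup>2)) \<partial>lborel)"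
  have w: "(\<integral>\<^sup>+\<xi>. ennreal (inverse (1 + \<xi>\<^sup>2)) \<partial>lborel) = ennreal w" "0 \<le> w"
    using inverse_1_plus_square_finite by (auto simp: w_def)
  \<comment> \<open>Half of \<open>\<eta>\<close> leaves room for the squared factor in
    \<open>a\<close>, which tends to one.\<close>
  define \<delta> where "\<delta> = \<eta> / 2"
  have \<delta>: "0 < \<delta>" "1 + \<delta> < 1 + \<eta>" using \<eta> by (auto simp: \<delta>_def)
  define a where "a \<epsilon> = ((1 + \<epsilon>) / (1 - \<epsilon>))\<^sup>2 * (1 + \<delta>)" for \<epsilon> :: real
  define b where "b \<epsilon> = ((1 + \<epsilon>) / (1 - \<epsilon>))\<^sup>2 * (1 + 1 / \<delta>) * (2 * X)\<^sup>2" for \<epsilon> :: real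
  have "(a \<longlongrightarrow> ((1 + 0) / (1 - 0))\<^sup>2 * (1 + \<delta>)) (at_right 0)"
    unfolding a_def by (intro tendsto_intros) auto
  then have a: "\<forall>\<^sub>F \<epsilon> in at_right 0. a \<epsilon> < 1 + \<eta>" using \<delta>(2) by (intro order_tendstoD(2)) auto
  have "((\<lambda>\<epsilon>. \<epsilon> * b \<epsilon> * w) \<longlongrightarrow> 0 * (((1 + 0) / (1 - 0))\<^sup>2 * (1 + 1 / \<delta>) * (2 * X)\<^sup>2) * w) (at_right 0)"
    unfolding b_def by (intro tendsto_intros) auto
  then have b: "\<forall>\<^sub>F \<epsilon> in at_right 0. \<epsilon> * b \<epsilon> * w < \<eta>" using \<eta> by (intro order_tendstoD(2)) auto
  have "\<forall>\<^sub>F \<epsilon> in at_right 0. 0 < \<epsilon> \<and> \<epsilon> < (1::real)"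
    unfolding eventually_at_right_field by (rule exI [of _ 1]) simp
  with a b show ?thesis
  proof eventually_elim
    case (elim \<epsilon>)
    have nonneg: "0 \<le> a \<epsilon>" "0 \<le> b \<epsilon>" using \<delta> by (auto simp: a_def b_def)
    define f where "f h \<xi> = (norm (resolvent D E (Complex \<epsilon> \<xi>) h))\<^sup>2" for h \<xi>
    have "continuous_on UNIV (f h)" for h
      unfolding f_def using elim
      by (intro continuous_intros continuous_on_compose2 [OF continuous_on_resolvent [OF sub, of h]])
         (auto simp: complex_eq_iff intro!: continuous_on_Complex continuous_intros)
    then have [measurable]: "f h \<in> borel_measurable borel" for h by (rule borel_measurable_continuous_onI)
    have pw: "f x \<xi> \<le> a \<epsilon> * f y \<xi> + b \<epsilon> * inverse (1 + \<xi>\<^sup>2)" for \<xi>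
    proof -
      define z where "z = Complex \<epsilon> \<xi>"
      define q where "q = (1 + \<epsilon>) / (1 - \<epsilon>)"
      have "norm (resolvent D E z x) \<le> q * (norm (resolvent D E z y) + 2 * X / cmod (1 + z))"
        using le [of z] elim by (simp add: z_def q_def)
      then have "f x \<xi> \<le> (q * (norm (resolvent D E z y) + 2 * X / cmod (1 + z)))\<^sup>2"
        unfolding f_def z_def [symmetric] by (rule power_mono) simp
      also have "\<dots> \<le> q\<^sup>2 * ((1 + \<delta>) * f y \<xi> + (1 + 1 / \<delta>) * (2 * X / cmod (1 + z))\<^sup>2)"
        unfolding power_mult_distrib f_def z_def [symmetric]
        by (intro mult_left_mono sq_add_le \<delta>) simp
      also have "\<dots> = a \<epsilon> * f y \<xi> + b \<epsilon> * inverse ((cmod (1 + z))\<^sup>2)"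
        by (simp add: a_def b_def q_def power_divide divide_inverse power_inverse algebra_simps)
      also have "\<dots> \<le> a \<epsilon> * f y \<xi> + b \<epsilon> * inverse (1 + \<xi>\<^sup>2)"
      proof -
        have "(cmod (1 + z))\<^sup>2 = (1 + \<epsilon>)\<^sup>2 + \<xi>\<^sup>2" by (simp add: cmod_power2 z_def)
        moreover have "1 \<le> (1 + \<epsilon>)\<^sup>2" using elim by (intro one_le_power) simp
        \<comment> \<open>A lower bound independent of \<epsilon>, so a single finite constant
          \<open>w\<close> controls the error on all lines.\<close>
        ultimately have "1 + \<xi>\<^sup>2 \<le> (cmod (1 + z))\<^sup>2" by linarith
        then show ?thesis
          using nonneg by (intro add_left_mono mult_left_mono le_imp_inverse_le) (auto simp: add_pos_nonneg)
      qed
      finally show ?thesis .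
    qed
    have "(\<integral>\<^sup>+\<xi>. ennreal (f x \<xi>) \<partial>lborel)
      \<le> (\<integral>\<^sup>+\<xi>. ennreal (a \<epsilon>) * ennreal (f y \<xi>) + ennreal (b \<epsilon>) * ennreal (inverse (1 + \<xi>\<^sup>2)) \<partial>lborel)"
    proof (rule nn_integral_mono)
      fix \<xi>
      have "ennreal (f x \<xi>) \<le> ennreal (a \<epsilon> * f y \<xi> + b \<epsilon> * inverse (1 + \<xi>\<^sup>2))" by (rule ennreal_leI [OF pw])
      also have "\<dots> = ennreal (a \<epsilon>) * ennreal (f y \<xi>) + ennreal (b \<epsilon>) * ennreal (inverse (1 + \<xi>\<^sup>2))"
        using nonneg by (simp add: ennreal_plus ennreal_mult f_def)
      finally show "ennreal (f x \<xi>) \<le> \<dots>" .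
    qed
    also have "\<dots> = ennreal (a \<epsilon>) * (\<integral>\<^sup>+\<xi>. ennreal (f y \<xi>) \<partial>lborel) + ennreal (b \<epsilon>) * ennreal w"
      by (subst nn_integral_add) (simp_all add: nn_integral_cmult w)
    finally have "line_mean D E x \<epsilon> \<le> ennreal \<epsilon> * (ennreal (a \<epsilon>) * (\<integral>\<^sup>+\<xi>. ennreal (f y \<xi>) \<partial>lborel) + ennreal (b \<epsilon>) * ennreal w)"
      by (simp add: line_mean_def f_def [symmetric] mult_left_mono)
    also have "\<dots> = ennreal (a \<epsilon>) * line_mean D E y \<epsilon> + ennreal (\<epsilon> * b \<epsilon> * w)"
      using elim nonneg w(2) by (simp add: line_mean_def f_def [symmetric] distrib_left ennreal_mult mult_ac)
    also have "\<dots> \<le> ennreal (1 + \<eta>) * line_mean D E y \<epsilon> + ennreal \<eta>"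
      using elim by (intro add_mono mult_right_mono ennreal_leI) auto
    finally show ?case .
  qed
qed

text \<open>On the line Re z = \<epsilon> the ratio of the two moduli is largest at Im z = 0, where
  it equals (1 + \<epsilon>) / (1 - \<epsilon>); this is a bound uniform along the line that tends
  to one.\<close>

lemma cmod_Cayley:
  assumes "0 < Re z" "Re z < 1"
  shows "cmod (1 - z) \<le> cmod (1 + z)"
    and "cmod (1 + z) \<le> (1 + Re z) / (1 - Re z) * cmod (1 - z)"
proof -
  have sq: "(cmod (1 - z))\<^sup>2 = (1 - Re z)\<^sup>2 + (Im z)\<^sup>2" "(cmod (1 + z))\<^sup>2 = (1 + Re z)\<^sup>2 + (Im z)\<^sup>2"
    by (simp_all add: cmod_power2)
  have "(1 - Re z)\<^sup>2 \<le> (1 + Re z)\<^sup>2" using assms by (intro power_mono) auto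
  then show "cmod (1 - z) \<le> cmod (1 + z)"
    by (intro power2_le_imp_le [OF _ norm_ge_zero]) (simp only: sq)
  define q where "q = (1 + Re z) / (1 - Re z)"
  have q: "1 \<le> q" "q * (1 - Re z) = 1 + Re z" using assms by (auto simp: q_def)
  have "(1 + Re z)\<^sup>2 + (Im z)\<^sup>2 = (q * (1 - Re z))\<^sup>2 + 1 * (Im z)\<^sup>2" by (simp only: q(2) mult_1)
  also have "\<dots> \<le> (q * (1 - Re z))\<^sup>2 + q\<^sup>2 * (Im z)\<^sup>2"
    using q(1) by (intro add_left_mono mult_right_mono one_le_power) auto
  also have "\<dots> = q\<^sup>2 * ((1 - Re z)\<^sup>2 + (Im z)\<^sup>2)" by (simp add: power_mult_distrib distrib_left)
  finally have "(cmod (1 + z))\<^sup>2 \<le> (q * cmod (1 - z))\<^sup>2" unfolding power_mult_distrib sq .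
  then have "cmod (1 + z) \<le> q * cmod (1 - z)" by (rule power2_le_imp_le) (use q in simp)
  then show "cmod (1 + z) \<le> (1 + Re z) / (1 - Re z) * cmod (1 - z)" by (simp only: q_def)
qed

text \<open>With \<open>x = (1 - E)\<inverse> y\<close> and the Cayley transform \<open>C y = x + E x\<close>, the resolvent satisfies
  \<open>R(z) y = (1 - z) R(z) x + x\<close> and \<open>R(z) (C y) = (1 + z) R(z) x - x\<close>; eliminating \<open>R(z) x\<close>
  compares the resolvents at \<open>y\<close> and \<open>C y\<close> up to an error of order \<open>1 / cmod (1 + z)\<close>.\<close>

lemma resolvent_Cayley:
  assumes sub: "{z. 0 < Re z} \<subseteq> resolvent_set D E" and x: "x \<in> D" and z: "0 < Re z" "Re z < 1"
  defines "R \<equiv> resolvent D E z"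
  shows "norm (R (x - E x)) \<le> (1 + Re z) / (1 - Re z) * (norm (R (x + E x)) + 2 * norm x / cmod (1 + z))"
    and "norm (R (x + E x)) \<le> (1 + Re z) / (1 - Re z) * (norm (R (x - E x)) + 2 * norm x / cmod (1 + z))"
proof -
  have zR: "z \<in> resolvent_set D E" using sub z by blast
  interpret R: bounded_linear R
    unfolding R_def using resolvent_set_resolvent(4) [OF zR] by (simp add: bounded_clinear_iff)
  have R_scaleC: "R (scaleC c v) = scaleC c (R v)" for c v
    unfolding R_def using resolvent_set_resolvent(4) [OF zR] by (simp add: bounded_clinear_iff)
  have Rx: "R (scaleC z x - E x) = x" unfolding R_def by (rule resolvent_set_resolvent(3) [OF zR x])
  have "x - E x = scaleC (1 - z) x + (scaleC z x - E x)" by (simp add: scaleC.diff_left scaleC_one)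
  then have 1: "R (x - E x) = scaleC (1 - z) (R x) + x" by (simp only: R.add R_scaleC Rx)
  have "x + E x = scaleC (1 + z) x - (scaleC z x - E x)" by (simp add: scaleC.add_left scaleC_one)
  then have "R (x + E x) = R (scaleC (1 + z) x) - R (scaleC z x - E x)" by (simp only: R.diff [symmetric])
  then have 2: "R (x + E x) = scaleC (1 + z) (R x) - x" by (simp only: R_scaleC Rx)
  have key: "scaleC (1 + z) (R (x - E x)) = scaleC (1 - z) (R (x + E x)) + 2 *\<^sub>R x"
  proof -
    have "scaleC (1 + z) (R (x - E x)) - scaleC (1 - z) (R (x + E x)) = scaleC (1 + z) x + scaleC (1 - z) x"
      unfolding 1 2 scaleC.add_right scaleC.diff_right scaleC_scaleC by (simp add: mult.commute)
    also have "\<dots> = 2 *\<^sub>R x"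
      by (simp add: scaleC.add_left scaleC.diff_left scaleC_one scaleR_2)
    finally show ?thesis by (simp add: algebra_simps)
  qed
  define q where "q = (1 + Re z) / (1 - Re z)"
  have q: "1 \<le> q" using z by (simp add: q_def)
  note cm = cmod_Cayley [OF z, folded q_def]
  have "1 + z \<noteq> 0" "1 - z \<noteq> 0" using z by (auto simp: complex_eq_iff)
  then have pos: "0 < cmod (1 + z)" "0 < cmod (1 - z)" by simp_all
  have nonneg: "0 \<le> norm (R (x + E x)) + 2 * norm x / cmod (1 + z)" "0 \<le> norm (R (x - E x)) + 2 * norm x / cmod (1 + z)"
    by simp_all
  have "cmod (1 + z) * norm (R (x - E x)) \<le> cmod (1 - z) * norm (R (x + E x)) + 2 * norm x"
    using arg_cong [OF key, of norm] norm_triangle_ineq [of "scaleC (1 - z) (R (x + E x))" "2 *\<^sub>R x"] by simp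
  also have "\<dots> \<le> cmod (1 + z) * (norm (R (x + E x)) + 2 * norm x / cmod (1 + z))"
    using cm(1) pos by (simp add: distrib_left mult_right_mono)
  finally have "norm (R (x - E x)) \<le> 1 * (norm (R (x + E x)) + 2 * norm x / cmod (1 + z))"
    using pos(1) by simp
  \<comment> \<open>The factor \<open>q\<close> is inserted so that both directions have the same
    shape and \<open>line_mean_comparison\<close> covers both.\<close>
  also have "\<dots> \<le> q * (norm (R (x + E x)) + 2 * norm x / cmod (1 + z))"
    by (rule mult_right_mono [OF q nonneg(1)])
  finally show "norm (R (x - E x)) \<le> (1 + Re z) / (1 - Re z) * (norm (R (x + E x)) + 2 * norm x / cmod (1 + z))"
    by (simp only: q_def)
  have "cmod (1 - z) * norm (R (x + E x)) \<le> cmod (1 + z) * norm (R (x - E x)) + 2 * norm x"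
  proof -
    have "scaleC (1 - z) (R (x + E x)) = scaleC (1 + z) (R (x - E x)) - 2 *\<^sub>R x" by (simp add: key)
    from arg_cong [OF this, of norm] norm_triangle_ineq4 [of "scaleC (1 + z) (R (x - E x))" "2 *\<^sub>R x"]
    show ?thesis by simp
  qed
  also have "\<dots> = cmod (1 + z) * (norm (R (x - E x)) + 2 * norm x / cmod (1 + z))"
    using pos by (simp add: distrib_left)
  also have "\<dots> \<le> q * cmod (1 - z) * (norm (R (x - E x)) + 2 * norm x / cmod (1 + z))"
    by (rule mult_right_mono [OF cm(2) nonneg(2)])
  finally have "cmod (1 - z) * norm (R (x + E x)) \<le> cmod (1 - z) * (q * (norm (R (x - E x)) + 2 * norm x / cmod (1 + z)))"
    by (simp only: mult_ac)
  then have "norm (R (x + E x)) \<le> q * (norm (R (x - E x)) + 2 * norm x / cmod (1 + z))"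
    using pos(2) by simp
  then show "norm (R (x + E x)) \<le> (1 + Re z) / (1 - Re z) * (norm (R (x - E x)) + 2 * norm x / cmod (1 + z))"
    by (simp only: q_def)
qed

text \<open>The functional \<open>\<L>\<close> is going to be the upper or the lower limit as \<open>\<epsilon>\<close> tends to \<open>0\<close>.\<close>

locale limit_functional =
  fixes \<L> :: "(real \<Rightarrow> ennreal) \<Rightarrow> ennreal"
  assumes mono: "(\<forall>\<^sub>F \<epsilon> in at_right 0. f \<epsilon> \<le> g \<epsilon>) \<Longrightarrow> \<L> f \<le> \<L> g"
    and affine: "\<L> (\<lambda>\<epsilon>. ennreal a * f \<epsilon> + ennreal b) = ennreal a * \<L> f + ennreal b"
begin

text \<open>A finite value \<open>s\<close> of the functional at \<open>g\<close> allows the choice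
  \<eta> = e / (s + 1), for which the total excess \<eta> s + \<eta> is exactly
  \<open>e\<close>.\<close>

lemma le_if_approximately_le:
  assumes le: "\<And>\<eta>. 0 < \<eta> \<Longrightarrow> \<forall>\<^sub>F \<epsilon> in at_right 0. f \<epsilon> \<le> ennreal (1 + \<eta>) * g \<epsilon> + ennreal \<eta>"
    and fin: "\<L> g \<le> ennreal r"
  shows "\<L> f \<le> \<L> g"
proof (rule ennreal_le_epsilon)
  fix e :: real assume e: "0 < e"
  obtain s where s: "\<L> g = ennreal s" "0 \<le> s"
    using fin by (cases "\<L> g") (auto simp: top_unique)
  define \<eta> where "\<eta> = e / (s + 1)"
  have "0 < s + 1" using s(2) by simp
  then have "0 < \<eta>" "\<eta> * (s + 1) = e" using e by (auto simp: \<eta>_def)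
  then have \<eta>: "0 < \<eta>" "(1 + \<eta>) * s + \<eta> = s + e" by (auto simp: algebra_simps)
  have "\<L> f \<le> ennreal (1 + \<eta>) * ennreal s + ennreal \<eta>"
    using mono [OF le [OF \<eta>(1)]] unfolding affine s(1) .
  also have "\<dots> = ennreal ((1 + \<eta>) * s + \<eta>)"
    using \<eta>(1) s(2) by (simp add: ennreal_plus ennreal_mult')
  also have "\<dots> = \<L> g + ennreal e" unfolding \<eta>(2) s(1) using e s(2) by (simp add: ennreal_plus)
  finally show "\<L> f \<le> \<L> g + ennreal e" .
qed

theorem generates_similar_to_isometries:
  fixes D :: "'a::complex_hilbert set"
  assumes lin: "linear_operator D E" and sub: "{z. 0 < Re z} \<subseteq> resolvent_set D E"
    and \<alpha>: "0 < \<alpha>" and \<beta>: "0 < \<beta>"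
    and lower: "\<And>h. ennreal (\<alpha> * (norm h)\<^sup>2) \<le> \<L> (line_mean D E h)"
    and upper: "\<And>h. \<L> (line_mean D E h) \<le> ennreal (\<beta> * (norm h)\<^sup>2)"
  shows "\<exists>T. generates D E T \<and> similar_to_isometries T"
proof -
  have one: "1 \<in> resolvent_set D E" using sub by auto
  define R where "R = resolvent D E 1"
  note R = resolvent_set_resolvent [OF one, folded R_def, unfolded scaleC_one]
  \<comment> \<open>The Cayley transform as a bounded operator: 1 + E equals 2 - (1 - E).\<close>
  define C where "C y = 2 *\<^sub>R R y - y" for y
  have C_eq: "C (x - E x) = x + E x" if "x \<in> D" for x
    using R(3) [OF that] by (simp add: C_def scaleR_2)
  have "\<L> (line_mean D E (C y)) = \<L> (line_mean D E y)" for y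
  proof -
    define x where "x = R y"
    have x: "x \<in> D" "y = x - E x" using R(1,2) by (auto simp: x_def)
    have Cy: "C y = x + E x" unfolding x(2) by (rule C_eq [OF x(1)])
    have "\<L> (line_mean D E (C y)) \<le> \<L> (line_mean D E y)"
      unfolding Cy unfolding x(2)
      by (rule le_if_approximately_le [OF _ upper], rule line_mean_comparison [OF sub, where X = "norm x"])
         (assumption | rule resolvent_Cayley [OF sub x(1)] norm_ge_zero)+
    moreover have "\<L> (line_mean D E y) \<le> \<L> (line_mean D E (C y))"
      unfolding Cy unfolding x(2)
      by (rule le_if_approximately_le [OF _ upper], rule line_mean_comparison [OF sub, where X = "norm x"])
         (assumption | rule resolvent_Cayley [OF sub x(1)] norm_ge_zero)+
    ultimately show ?thesis by (rule antisym)
  qed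
  then have inv: "\<L> (line_mean D E ((C ^^ k) y)) = \<L> (line_mean D E y)" for k y
    by (induction k) auto
  have powers: "\<alpha> * (norm y)\<^sup>2 \<le> \<beta> * (norm ((C ^^ k) y))\<^sup>2" "\<alpha> * (norm ((C ^^ k) y))\<^sup>2 \<le> \<beta> * (norm y)\<^sup>2" for k y
  proof -
    have "ennreal (\<alpha> * (norm y)\<^sup>2) \<le> ennreal (\<beta> * (norm ((C ^^ k) y))\<^sup>2)"
      using lower [of y] upper [of "(C ^^ k) y"] unfolding inv by (rule order_trans)
    then show "\<alpha> * (norm y)\<^sup>2 \<le> \<beta> * (norm ((C ^^ k) y))\<^sup>2" using \<beta> by (subst (asm) ennreal_le_iff) auto
    have "ennreal (\<alpha> * (norm ((C ^^ k) y))\<^sup>2) \<le> ennreal (\<beta> * (norm y)\<^sup>2)"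
      using lower [of "(C ^^ k) y"] upper [of y] unfolding inv by (rule order_trans)
    then show "\<alpha> * (norm ((C ^^ k) y))\<^sup>2 \<le> \<beta> * (norm y)\<^sup>2" using \<beta> by (subst (asm) ennreal_le_iff) auto
  qed
  \<comment> \<open>Comparing \<alpha> times the squared norm at one end with \<beta> times it at
    the other, across the invariant functional, costs this factor for every power, forwards and
    backwards.\<close>
  define M where "M = sqrt (\<beta> / \<alpha>)"
  have M: "0 < M" "M\<^sup>2 = \<beta> / \<alpha>" using \<alpha> \<beta> by (auto simp: M_def)
  have C_upper: "norm ((C ^^ k) y) \<le> M * norm y" for k y
  proof (rule power2_le_imp_le)
    show "(norm ((C ^^ k) y))\<^sup>2 \<le> (M * norm y)\<^sup>2"
      using powers(2) [where k = k and y = y] \<alpha> by (simp add: power_mult_distrib M field_simps)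
  qed (use M in simp)
  have "norm y \<le> M * norm ((C ^^ k) y)" for k y
  proof (rule power2_le_imp_le)
    show "(norm y)\<^sup>2 \<le> (M * norm ((C ^^ k) y))\<^sup>2"
      using powers(1) [where k = k and y = y] \<alpha> by (simp add: power_mult_distrib M field_simps)
  qed (use M in simp)
  then have C_lower: "inverse M * norm y \<le> norm ((C ^^ k) y)" for k y
    using M by (simp add: inverse_eq_divide pos_divide_le_eq mult.commute)
  have C: "bounded_clinear C"
    using R(4) unfolding bounded_clinear_iff C_def
    by (auto intro!: bounded_linear_sub bounded_linear_const_scaleR bounded_linear_ident
        simp: scaleC.scaleR_right scaleC.diff_right)
  obtain S Sinv :: "'a \<Rightarrow> 'a" where sim_S: "bounded_clinear S" "bounded_clinear Sinv"
    "\<And>x. Sinv (S x) = x" "\<And>x. S (Sinv x) = x" and S_C: "\<And>x. norm (S (C x)) = norm (S x)"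
    using power_bounded_similar_to_isometry [OF C _ C_lower C_upper] M(1) by auto
  interpret similarity S Sinv using sim_S by unfold_locales auto
  interpret inv: similarity Sinv S by (rule inverse_similarity)
  define D' E' where "D' = S ` D" and "E' = (\<lambda>y. S (E (Sinv y)))"
  interpret skew_operator D' E'
  proof
    show "linear_operator D' E'" unfolding D'_def E'_def by (rule linear_operator_conj [OF lin])
    fix v assume "v \<in> D'"
    then obtain x where x: "x \<in> D" "v = S x" by (auto simp: D'_def)
    \<comment> \<open>Polarisation: the squared norms of a + b and a - b differ by four times their
      inner product, so isometry of the Cayley transform is skewness of \<open>E'\<close>.\<close>
    have "norm (S x + S (E x)) = norm (S x - S (E x))"
      using S_C [of "x - E x"] by (simp add: C_eq [OF x(1)] S.add S.diff)
    then have "(norm (S x + S (E x)))\<^sup>2 = (norm (S x - S (E x)))\<^sup>2" by simp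
    then show "rinner (E' v) v = 0"
      unfolding norm_add_sq norm_diff_sq by (simp add: E'_def x(2) rinner_commute)
  next
    fix r :: real and y assume r: "0 < r"
    have z: "of_real r \<in> resolvent_set D E" using sub r by auto
    define x where "x = resolvent D E (of_real r) (Sinv y)"
    note x = resolvent_set_resolvent(1,2) [OF z, of "Sinv y", folded x_def]
    have "S (r *\<^sub>R x - E x) = y" using x(2) by (simp add: scaleR_scaleC)
    then have "r *\<^sub>R S x - E' (S x) = y" by (simp add: E'_def S.diff S.scaleR)
    then show "\<exists>x\<in>D'. r *\<^sub>R x - E' x = y" unfolding D'_def using x(1) by blast
  qed
  have "generates (Sinv ` D') (\<lambda>y. Sinv (E' (S y))) (\<lambda>t y. Sinv (V t (S y)))"
    by (rule inv.generates_conj [OF generates_V])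
  moreover have "Sinv ` D' = D" by (simp add: D'_def image_image)
  moreover have "(\<lambda>y. Sinv (E' (S y))) = E" by (simp add: E'_def)
  ultimately have "generates D E (\<lambda>t y. Sinv (V t (S y)))" by simp
  moreover have "similar_to_isometries (\<lambda>t y. Sinv (V t (S y)))"
    unfolding similar_to_isometries_def
    by (rule exI [of _ S], rule exI [of _ Sinv]) (simp add: S Sinv norm_V)
  ultimately show ?thesis by blast
qed

end

section \<open>The two limits and the equivalence\<close>

lemma continuous_mono_affine_ennreal:
  "continuous_on UNIV (\<lambda>x. ennreal a * x + ennreal b)" "mono (\<lambda>x. ennreal a * x + ennreal b)"
  by (auto intro!: continuous_on_add_ennreal ennreal_continuous_on_cmult continuous_on_id continuous_on_const
      monoI add_mono mult_left_mono)

text \<open>Continuous increasing maps commute with the upper limit along a proper filter, which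
  yields the affine law.\<close>

lemma limit_functional_Limsup: "limit_functional (Limsup (at_right 0))"
  by unfold_locales (auto intro: Limsup_mono
      Limsup_compose_continuous_mono [OF continuous_mono_affine_ennreal] simp: trivial_limit_at_right_real)

lemma limit_functional_Liminf: "limit_functional (Liminf (at_right 0))"
  by unfold_locales (auto intro: Liminf_mono
      Liminf_compose_continuous_mono [OF continuous_mono_affine_ennreal] simp: trivial_limit_at_right_real)

theorem theoremA1:
  fixes D :: "'a::complex_hilbert set" and E :: "'a \<Rightarrow> 'a"
  assumes "linear_operator D E"
  shows "(\<exists>T. generates D E T \<and> similar_to_isometries T) \<longleftrightarrow>
    (spectrum D E \<subseteq> {z. Re z \<le> 0} \<and>
     (\<exists>\<alpha>>0. \<exists>\<beta>>0.
       (\<forall>h. ennreal (\<alpha> * (norm h)\<^sup>2)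
              \<le> Limsup (at_right 0) (\<lambda>\<epsilon>. ennreal \<epsilon> *
                   (\<integral>\<^sup>+ \<xi>. ennreal ((norm (resolvent D E (Complex \<epsilon> \<xi>) h))\<^sup>2) \<partial>lborel))
          \<and> Limsup (at_right 0) (\<lambda>\<epsilon>. ennreal \<epsilon> *
                   (\<integral>\<^sup>+ \<xi>. ennreal ((norm (resolvent D E (Complex \<epsilon> \<xi>) h))\<^sup>2) \<partial>lborel))
              \<le> ennreal (\<beta> * (norm h)\<^sup>2))
     \<or> (\<forall>h. ennreal (\<alpha> * (norm h)\<^sup>2)
              \<le> Liminf (at_right 0) (\<lambda>\<epsilon>. ennreal \<epsilon> *
                   (\<integral>\<^sup>+ \<xi>. ennreal ((norm (resolvent D E (Complex \<epsilon> \<xi>) h))\<^sup>2) \<partial>lborel))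
          \<and> Liminf (at_right 0) (\<lambda>\<epsilon>. ennreal \<epsilon> *
                   (\<integral>\<^sup>+ \<xi>. ennreal ((norm (resolvent D E (Complex \<epsilon> \<xi>) h))\<^sup>2) \<partial>lborel))
              \<le> ennreal (\<beta> * (norm h)\<^sup>2))))"
  unfolding line_mean_def [symmetric]
proof
  assume "\<exists>T. generates D E T \<and> similar_to_isometries T"
  then obtain T where T: "generates D E T" "similar_to_isometries T" by blast
  note bounds = line_mean_bounds [OF assms T]
  obtain \<alpha> \<beta> where \<alpha>\<beta>: "\<alpha> > 0" "\<beta> > 0"
    and le: "\<And>h \<epsilon>. 0 < \<epsilon> \<Longrightarrow> ennreal (\<alpha> * (norm h)\<^sup>2) \<le> line_mean D E h \<epsilon>"
      "\<And>h \<epsilon>. 0 < \<epsilon> \<Longrightarrow> line_mean D E h \<epsilon> \<le> ennreal (\<beta> * (norm h)\<^sup>2)"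
    using bounds(2) by blast
  have pos: "\<forall>\<^sub>F \<epsilon> in at_right 0. 0 < (\<epsilon>::real)"
    unfolding eventually_at_right_field by (rule exI [of _ 1]) simp
  have lower: "ennreal (\<alpha> * (norm h)\<^sup>2) \<le> Liminf (at_right 0) (line_mean D E h)" for h
    by (rule Liminf_bounded, rule eventually_mono [OF pos le(1)])
  have upper: "Limsup (at_right 0) (line_mean D E h) \<le> ennreal (\<beta> * (norm h)\<^sup>2)" for h
    by (rule Limsup_bounded, rule eventually_mono [OF pos le(2)])
  \<comment> \<open>The upper-limit alternative is the one established; its lower bound comes from
    the lower limit.\<close>
  have "ennreal (\<alpha> * (norm h)\<^sup>2) \<le> Limsup (at_right 0) (line_mean D E h)" for h
    using lower [of h] Liminf_le_Limsup [of "at_right (0::real)" "line_mean D E h"]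
    by (auto simp: trivial_limit_at_right_real)
  moreover have "spectrum D E \<subseteq> {z. Re z \<le> 0}"
    using bounds(1) by (auto simp: spectrum_def not_less [symmetric])
  ultimately show "spectrum D E \<subseteq> {z. Re z \<le> 0} \<and> (\<exists>\<alpha>>0. \<exists>\<beta>>0.
       (\<forall>h. ennreal (\<alpha> * (norm h)\<^sup>2) \<le> Limsup (at_right 0) (line_mean D E h)
          \<and> Limsup (at_right 0) (line_mean D E h) \<le> ennreal (\<beta> * (norm h)\<^sup>2))
     \<or> (\<forall>h. ennreal (\<alpha> * (norm h)\<^sup>2) \<le> Liminf (at_right 0) (line_mean D E h)
          \<and> Liminf (at_right 0) (line_mean D E h) \<le> ennreal (\<beta> * (norm h)\<^sup>2)))"
    using \<alpha>\<beta> upper by blast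
next
  assume *: "spectrum D E \<subseteq> {z. Re z \<le> 0} \<and> (\<exists>\<alpha>>0. \<exists>\<beta>>0.
       (\<forall>h. ennreal (\<alpha> * (norm h)\<^sup>2) \<le> Limsup (at_right 0) (line_mean D E h)
          \<and> Limsup (at_right 0) (line_mean D E h) \<le> ennreal (\<beta> * (norm h)\<^sup>2))
     \<or> (\<forall>h. ennreal (\<alpha> * (norm h)\<^sup>2) \<le> Liminf (at_right 0) (line_mean D E h)
          \<and> Liminf (at_right 0) (line_mean D E h) \<le> ennreal (\<beta> * (norm h)\<^sup>2)))"
  then have sub: "{z. 0 < Re z} \<subseteq> resolvent_set D E"
    by (auto simp: spectrum_def subset_iff not_less [symmetric])
  show "\<exists>T. generates D E T \<and> similar_to_isometries T"
    using * limit_functional.generates_similar_to_isometries [OF limit_functional_Limsup assms sub]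
      limit_functional.generates_similar_to_isometries [OF limit_functional_Liminf assms sub] by metis
qed

end
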